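(* The Bloch spectrum of a quantum graph determines its Albanese torus as a Riemannian manifold. That is: if $G$ and $G'$ are Bloch isospectral quantum graphs, then the Albanese tori $\mathrm{Alb}(G)=H_1(G,\mathbb{R})/H_1(G,\mathbb{Z})$ and $\mathrm{Alb}(G')=H_1(G',\mathbb{R})/H_1(G',\mathbb{Z})$, with their flat Riemannian metrics, are isometric.
   Context: Quantum graphs. A quantum graph $G$ is a finite connected graph (loops and multiple edges allowed, no vertices of degree $2$) with vertex set $V$ and edge set $E$, in which every edge $e$ has a length $L_e>0$ and is identified with the interval $[0,L_e]$. For a vertex $v$, $e\sim v$ ranges over the edges adjacent to $v$ (a loop at $v$ is counted once for each of its two ends), and $\nu_{v,e}$ is the outward unit normal of $e$ at $v$. A $0$-form is a continuous function $f$ on $G$ that is $C^\infty$ on each closed edge and satisfies $\sum_{e\sim v}\nu_{v,e}(f|_e)=0$ at every vertex $v$ (Kirchhoff condition). A $1$-form $\alpha$ consists of a smooth $1$-form $\alpha_e$ on each closed edge such that $\sum_{e\sim v}\alpha_e(\nu_{v,e})=0$ at every $v$. $H^1_{dR}(G,\mathbb{R})$ is the space of real $1$-forms modulo $d$ of real $0$-forms, and $H^1_{dR}(G,\mathbb{Z})$ is the subgroup of classes whose integrals over all closed walks are integers. Bloch spectrum. For a real $1$-form $\alpha$ put $d_\alpha f=df+2\pi i f\alpha$ and $\Delta_\alpha=d_\alpha^*d_\alpha$; explicitly, if $\alpha=a\,dx$ in the arc length coordinate on an edge, then $\Delta_\alpha f=-\left(\frac{d}{dx}+2\pi i a\right)^2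 f$ on that edge. Its domain consists of the continuous $f$ that lie in the $L^2$-Sobolev space of order $2$ on each edge and satisfy the Kirchhoff condition at each vertex. $\mathrm{Spec}_\alpha(G)$ is the spectrum of $\Delta_\alpha$, with multiplicities; it depends only on the coset of $[\alpha]$ in the torus $H^1_{dR}(G,\mathbb{R})/H^1_{dR}(G,\mathbb{Z})$. The Bloch spectrum of $G$ is the map $[\alpha]\mapsto \mathrm{Spec}_\alpha(G)$ on this torus, where the torus is known only as an abstract Lie group. Two quantum graphs $G,G'$ are Bloch isospectral if there is a Lie group isomorphism $\Phi: H^1_{dR}(G,\mathbb{R})/H^1_{dR}(G,\mathbb{Z})\to H^1_{dR}(G',\mathbb{R})/H^1_{dR}(G',\mathbb{Z})$ with $\mathrm{Spec}_\alpha(G)=\mathrm{Spec}_{\Phi(\alpha)}(G')$ for all $[\alpha]$. Albanese torus. Every class in $H^1(G,\mathbb{R})=H^1_{dR}(G,\mathbb{R})$ has a unique harmonic representative, i.e. a $1$-form that is a constant multiple of $dx$ on each edge. The inner product on $H^1(G,\mathbb{R})$ is $([\alpha],[\beta])=\int_G\tilde\alpha(X_1)\tilde\beta(X_1)\,dx$, where $\tilde\alpha,\tilde\beta$ are the harmonic representatives and $X_1$ is a unit length vector field on the edges. $H_1(G,\mathbb{R})$ carries the dual inner product via the pairing $([\alpha],[p])\mapsto\int_p\alpha$, and this induces the Riemannian metric of $\mathrm{Alb}(G)$. *)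

theory Defs
  imports
    "HOL-Analysis.Analysis"
    "HOL-Library.Function_Algebras"
    "HOL-Algebra.Coset"
begin

section \<open>Quantum graphs\<close>

text \<open>
  An edge \<open>e\<close> is identified with \<open>{0..len G e}\<close>; the point \<open>0\<close> is attached to \<open>src G e\<close> and the
  point \<open>len G e\<close> to \<open>tgt G e\<close>. Loops and multiple edges are allowed. The choice of source and
  target only fixes the arc length coordinate. The edges form a set in a finite type, so that edge
  vectors can be elements of \<open>real ^ 'e\<close> vanishing outside \<open>edges G\<close>.
\<close>

record ('v, 'e) qgraph =
  verts :: "'v set"
  edges :: "'e set"
  src :: "'e \<Rightarrow> 'v"
  tgt :: "'e \<Rightarrow> 'v"
  len :: "'e \<Rightarrow> real"

text \<open>The step \<open>(e, True)\<close> traverses \<open>e\<close> from source to target, \<open>(e, False)\<close> the other way round.\<close>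

fun step_start :: "('v, 'e) qgraph \<Rightarrow> 'e \<times> bool \<Rightarrow> 'v" where
  "step_start G (e, b) = (if b then src G e else tgt G e)"

fun step_end :: "('v, 'e) qgraph \<Rightarrow> 'e \<times> bool \<Rightarrow> 'v" where
  "step_end G (e, b) = (if b then tgt G e else src G e)"

fun walk :: "('v, 'e) qgraph \<Rightarrow> 'v \<Rightarrow> ('e \<times> bool) list \<Rightarrow> 'v \<Rightarrow> bool" where
  "walk G u [] w \<longleftrightarrow> u \<in> verts G \<and> u = w"
| "walk G u (s # ss) w \<longleftrightarrow> fst s \<in> edges G \<and> step_start G s = u \<and> walk G (step_end G s) ss w"

definition closed_walk :: "('v, 'e) qgraph \<Rightarrow> ('e \<times> bool) list \<Rightarrow> bool" where
  "closed_walk G ss \<longleftrightarrow> (\<exists>v. walk G v ss v)"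

text \<open>A loop contributes two to the degree of its vertex.\<close>

definition vertex_degree :: "('v, 'e) qgraph \<Rightarrow> 'v \<Rightarrow> nat" where
  "vertex_degree G v = card {e \<in> edges G. src G e = v} + card {e \<in> edges G. tgt G e = v}"

definition quantum_graph :: "('v, 'e) qgraph \<Rightarrow> bool" where
  "quantum_graph G \<longleftrightarrow>
     finite (verts G) \<and> verts G \<noteq> {} \<and> finite (edges G) \<and>
     (\<forall>e\<in>edges G. src G e \<in> verts G \<and> tgt G e \<in> verts G \<and> 0 < len G e) \<and>
     (\<forall>u\<in>verts G. \<forall>w\<in>verts G. \<exists>ss. walk G u ss w) \<and>
     (\<forall>v\<in>verts G. vertex_degree G v \<noteq> 2)"


section \<open>Functions and differential forms\<close>

text \<open>
  A function on \<open>G\<close> is a family \<open>f e x\<close> with \<open>e \<in> edges G\<close> and \<open>0 \<le> x \<le> len G e\<close>. A 1-form is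
  represented in the same way by its coefficient in front of \<open>dx\<close>. Requiring the value \<open>0\<close> at all
  other arguments makes equality of families the same as equality on \<open>G\<close>.
\<close>

definition on_graph :: "('v, 'e) qgraph \<Rightarrow> 'e \<Rightarrow> real \<Rightarrow> bool" where
  "on_graph G e x \<longleftrightarrow> e \<in> edges G \<and> x \<in> {0..len G e}"

definition supported :: "('v, 'e) qgraph \<Rightarrow> ('e \<Rightarrow> real \<Rightarrow> 'a::zero) \<Rightarrow> bool" where
  "supported G f \<longleftrightarrow> (\<forall>e x. \<not> on_graph G e x \<longrightarrow> f e x = 0)"

definition smooth_interval :: "real \<Rightarrow> (real \<Rightarrow> 'a::real_normed_vector) \<Rightarrow> bool" where
  "smooth_interval L f \<longleftrightarrow>
     (\<exists>D :: nat \<Rightarrow> real \<Rightarrow> 'a. D 0 = f \<and>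
        (\<forall>n. \<forall>x\<in>{0..L}. (D n has_vector_derivative D (Suc n) x) (at x within {0..L})))"

definition continuous_graph :: "('v, 'e) qgraph \<Rightarrow> ('e \<Rightarrow> real \<Rightarrow> 'a::topological_space) \<Rightarrow> bool" where
  "continuous_graph G f \<longleftrightarrow>
     (\<forall>e\<in>edges G. continuous_on {0..len G e} (f e)) \<and>
     (\<exists>val. \<forall>e\<in>edges G. f e 0 = val (src G e) \<and> f e (len G e) = val (tgt G e))"

definition edge_deriv ::
  "('v, 'e) qgraph \<Rightarrow> ('e \<Rightarrow> real \<Rightarrow> 'a::real_normed_vector) \<Rightarrow> 'e \<Rightarrow> real \<Rightarrow> 'a" where
  "edge_deriv G f e x =
     (if on_graph G e x then vector_derivative (f e) (at x within {0..len G e}) else 0)"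

text \<open>
  The sum over the edge ends at \<open>v\<close> of \<open>a e dx\<close> evaluated on the outward unit normal, which is
  \<open>d/dx\<close> at the target end and \<open>- d/dx\<close> at the source end.
\<close>

definition normal_sum ::
  "('v, 'e) qgraph \<Rightarrow> ('e \<Rightarrow> real \<Rightarrow> 'a::ab_group_add) \<Rightarrow> 'v \<Rightarrow> 'a" where
  "normal_sum G a v =
     (\<Sum>e\<in>{e \<in> edges G. tgt G e = v}. a e (len G e)) + (\<Sum>e\<in>{e \<in> edges G. src G e = v}. - a e 0)"

definition kirchhoff ::
  "('v, 'e) qgraph \<Rightarrow> ('e \<Rightarrow> real \<Rightarrow> 'a::real_normed_vector) \<Rightarrow> bool" where
  "kirchhoff G f \<longleftrightarrow> (\<forall>v\<in>verts G. normal_sum G (edge_deriv G f) v = 0)"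

definition zero_forms :: "('v, 'e) qgraph \<Rightarrow> ('e \<Rightarrow> real \<Rightarrow> real) set" where
  "zero_forms G =
     {f. supported G f \<and> continuous_graph G f \<and>
         (\<forall>e\<in>edges G. smooth_interval (len G e) (f e)) \<and> kirchhoff G f}"

definition one_forms :: "('v, 'e) qgraph \<Rightarrow> ('e \<Rightarrow> real \<Rightarrow> real) set" where
  "one_forms G =
     {a. supported G a \<and> (\<forall>e\<in>edges G. smooth_interval (len G e) (a e)) \<and>
         (\<forall>v\<in>verts G. normal_sum G a v = 0)}"


section \<open>De Rham cohomology\<close>

definition one_form_group :: "('v, 'e) qgraph \<Rightarrow> ('e \<Rightarrow> real \<Rightarrow> real) monoid" where
  "one_form_group G = \<lparr>carrier = one_forms G, mult = (+), one = 0\<rparr>"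

definition exact_forms :: "('v, 'e) qgraph \<Rightarrow> ('e \<Rightarrow> real \<Rightarrow> real) set" where
  "exact_forms G = edge_deriv G ` zero_forms G"

definition H1_dR :: "('v, 'e) qgraph \<Rightarrow> ('e \<Rightarrow> real \<Rightarrow> real) set monoid" where
  "H1_dR G = one_form_group G Mod exact_forms G"

definition dR_class ::
  "('v, 'e) qgraph \<Rightarrow> ('e \<Rightarrow> real \<Rightarrow> real) \<Rightarrow> ('e \<Rightarrow> real \<Rightarrow> real) set" where
  "dR_class G a = exact_forms G #>\<^bsub>one_form_group G\<^esub> a"

definition walk_integral ::
  "('v, 'e) qgraph \<Rightarrow> ('e \<times> bool) list \<Rightarrow> ('e \<Rightarrow> real \<Rightarrow> real) \<Rightarrow> real" where
  "walk_integral G ss a =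
     (\<Sum>(e, b)\<leftarrow>ss. (if b then 1 else - 1) * integral {0..len G e} (a e))"

definition H1_dR_int :: "('v, 'e) qgraph \<Rightarrow> ('e \<Rightarrow> real \<Rightarrow> real) set set" where
  "H1_dR_int G =
     {A \<in> carrier (H1_dR G). \<forall>a\<in>A. \<forall>ss. closed_walk G ss \<longrightarrow> walk_integral G ss a \<in> \<int>}"

definition dR_torus :: "('v, 'e) qgraph \<Rightarrow> ('e \<Rightarrow> real \<Rightarrow> real) set set monoid" where
  "dR_torus G = H1_dR G Mod H1_dR_int G"

definition dR_torus_class ::
  "('v, 'e) qgraph \<Rightarrow> ('e \<Rightarrow> real \<Rightarrow> real) \<Rightarrow> ('e \<Rightarrow> real \<Rightarrow> real) set set" where
  "dR_torus_class G a = H1_dR_int G #>\<^bsub>H1_dR G\<^esub> dR_class G a"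

definition harmonic_forms :: "('v, 'e) qgraph \<Rightarrow> ('e \<Rightarrow> real \<Rightarrow> real) set" where
  "harmonic_forms G =
     {a \<in> one_forms G. \<forall>e\<in>edges G. \<exists>c. \<forall>x\<in>{0..len G e}. a e x = c}"

definition harmonic_rep ::
  "('v, 'e) qgraph \<Rightarrow> ('e \<Rightarrow> real \<Rightarrow> real) set \<Rightarrow> 'e \<Rightarrow> real \<Rightarrow> real" where
  "harmonic_rep G A = (THE a. a \<in> A \<and> a \<in> harmonic_forms G)"

definition H1_inner ::
  "('v, 'e) qgraph \<Rightarrow> ('e \<Rightarrow> real \<Rightarrow> real) set \<Rightarrow> ('e \<Rightarrow> real \<Rightarrow> real) set \<Rightarrow> real" where
  "H1_inner G A B =
     (\<Sum>e\<in>edges G. integral {0..len G e} (\<lambda>x. harmonic_rep G A e x * harmonic_rep G B e x))"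


section \<open>The Bloch spectrum\<close>

text \<open>\<open>magnetic_deriv G a f\<close> is the coefficient of \<open>dx\<close> in \<open>df + 2 \<pi> i f a\<close>.\<close>

definition magnetic_deriv ::
  "('v, 'e) qgraph \<Rightarrow> ('e \<Rightarrow> real \<Rightarrow> real) \<Rightarrow> ('e \<Rightarrow> real \<Rightarrow> complex) \<Rightarrow> 'e \<Rightarrow> real \<Rightarrow> complex" where
  "magnetic_deriv G a f e x =
     edge_deriv G f e x + 2 * of_real pi * \<i> * f e x * of_real (a e x)"

definition magnetic_laplacian ::
  "('v, 'e) qgraph \<Rightarrow> ('e \<Rightarrow> real \<Rightarrow> real) \<Rightarrow> ('e \<Rightarrow> real \<Rightarrow> complex) \<Rightarrow> 'e \<Rightarrow> real \<Rightarrow> complex" where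
  "magnetic_laplacian G a f e x = - magnetic_deriv G a (magnetic_deriv G a f) e x"

definition square_integrable :: "real \<Rightarrow> (real \<Rightarrow> complex) \<Rightarrow> bool" where
  "square_integrable L h \<longleftrightarrow>
     h \<in> borel_measurable (lebesgue_on {0..L}) \<and>
     integrable (lebesgue_on {0..L}) (\<lambda>x. (cmod (h x))\<^sup>2)"

text \<open>
  On a compact interval the \<open>L\<^sup>2\<close>-Sobolev space of order two consists of the \<open>C\<^sup>1\<close> functions whose
  derivative is absolutely continuous with square integrable derivative. Such a function is twice
  differentiable almost everywhere, and its weak derivatives are the pointwise ones.
\<close>

definition sobolev2 :: "real \<Rightarrow> (real \<Rightarrow> complex) \<Rightarrow> bool" where
  "sobolev2 L f \<longleftrightarrow>
     (\<exists>g h. (\<forall>x\<in>{0..L}. (f has_vector_derivative g x) (at x within {0..L})) \<and>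
            square_integrable L h \<and>
            (\<forall>x\<in>{0..L}. g x = g 0 + (LINT t|lebesgue_on {0..x}. h t)))"

definition laplacian_domain :: "('v, 'e) qgraph \<Rightarrow> ('e \<Rightarrow> real \<Rightarrow> complex) set" where
  "laplacian_domain G =
     {f. supported G f \<and> continuous_graph G f \<and> (\<forall>e\<in>edges G. sobolev2 (len G e) (f e)) \<and>
         kirchhoff G f}"

definition L2_graph :: "('v, 'e) qgraph \<Rightarrow> ('e \<Rightarrow> real \<Rightarrow> complex) set" where
  "L2_graph G = {g. \<forall>e\<in>edges G. square_integrable (len G e) (g e)}"

definition L2_norm :: "('v, 'e) qgraph \<Rightarrow> ('e \<Rightarrow> real \<Rightarrow> complex) \<Rightarrow> real" where
  "L2_norm G g = sqrt (\<Sum>e\<in>edges G. LINT x|lebesgue_on {0..len G e}. (cmod (g e x))\<^sup>2)"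

definition L2_eq ::
  "('v, 'e) qgraph \<Rightarrow> ('e \<Rightarrow> real \<Rightarrow> complex) \<Rightarrow> ('e \<Rightarrow> real \<Rightarrow> complex) \<Rightarrow> bool" where
  "L2_eq G f g \<longleftrightarrow> (\<forall>e\<in>edges G. AE x in lebesgue_on {0..len G e}. f e x = g e x)"

definition shifted_laplacian ::
  "('v, 'e) qgraph \<Rightarrow> ('e \<Rightarrow> real \<Rightarrow> real) \<Rightarrow> complex \<Rightarrow> ('e \<Rightarrow> real \<Rightarrow> complex) \<Rightarrow>
    'e \<Rightarrow> real \<Rightarrow> complex" where
  "shifted_laplacian G a z f e x = magnetic_laplacian G a f e x - z * f e x"

text \<open>
  The resolvent set: the unbounded operator \<open>\<Delta>\<^sub>a - z\<close> is a bijection from its domain onto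
  \<open>L\<^sup>2(G)\<close> with bounded inverse.
\<close>

definition resolvent_set :: "('v, 'e) qgraph \<Rightarrow> ('e \<Rightarrow> real \<Rightarrow> real) \<Rightarrow> complex set" where
  "resolvent_set G a =
     {z. (\<forall>g\<in>L2_graph G. \<exists>!f. f \<in> laplacian_domain G \<and> L2_eq G (shifted_laplacian G a z f) g) \<and>
         (\<exists>C. \<forall>f\<in>laplacian_domain G. L2_norm G f \<le> C * L2_norm G (shifted_laplacian G a z f))}"

definition eigenspace ::
  "('v, 'e) qgraph \<Rightarrow> ('e \<Rightarrow> real \<Rightarrow> real) \<Rightarrow> complex \<Rightarrow> ('e \<Rightarrow> real \<Rightarrow> complex) set" where
  "eigenspace G a z =
     {f \<in> laplacian_domain G. L2_eq G (shifted_laplacian G a z f) (\<lambda>e x. 0)}"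

definition cscale :: "complex \<Rightarrow> ('e \<Rightarrow> real \<Rightarrow> complex) \<Rightarrow> 'e \<Rightarrow> real \<Rightarrow> complex" where
  "cscale c f = (\<lambda>e x. c * f e x)"

lemma vector_space_cscale: "vector_space cscale"
  by unfold_locales (auto simp: cscale_def fun_eq_iff algebra_simps)

definition eigen_multiplicity :: "('v, 'e) qgraph \<Rightarrow> ('e \<Rightarrow> real \<Rightarrow> real) \<Rightarrow> complex \<Rightarrow> nat" where
  "eigen_multiplicity G a z = vector_space.dim cscale (eigenspace G a z)"

text \<open>The spectrum with multiplicities, as the set of pairs (spectral value, multiplicity).\<close>

definition Spec :: "('v, 'e) qgraph \<Rightarrow> ('e \<Rightarrow> real \<Rightarrow> real) \<Rightarrow> (complex \<times> nat) set" where
  "Spec G a = {(z, eigen_multiplicity G a z) | z. z \<notin> resolvent_set G a}"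


section \<open>Smooth maps between tori\<close>

text \<open>
  \<open>C\<^sup>\<infinity>\<close> maps on a relatively open subset \<open>U\<close> of a linear subspace \<open>W\<close> of a Euclidean space: all
  iterated directional derivatives along \<open>W\<close> exist and are continuous.
\<close>

definition smooth_on_subspace ::
  "'a::euclidean_space set \<Rightarrow> 'a set \<Rightarrow> ('a \<Rightarrow> 'b::euclidean_space) \<Rightarrow> bool" where
  "smooth_on_subspace W U f \<longleftrightarrow>
     openin (top_of_set W) U \<and>
     (\<exists>D :: 'a list \<Rightarrow> 'a \<Rightarrow> 'b. (\<forall>x\<in>U. D [] x = f x) \<and>
        (\<forall>vs. set vs \<subseteq> W \<longrightarrow>
           continuous_on U (D vs) \<and>
           (\<forall>v\<in>W. \<forall>x\<in>U.
              ((\<lambda>t. D vs (x + t *\<^sub>R v)) has_vector_derivative D (v # vs) x) (at 0))))"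

text \<open>
  A torus \<open>T\<close> with smooth structure is given by a linear subspace \<open>W\<close> and the quotient map
  \<open>p\<close> from \<open>W\<close> onto \<open>T\<close> by a lattice; the local inverses of \<open>p\<close> are the charts of \<open>T\<close>. So a map
  \<open>F\<close> of tori is smooth iff it can be lifted locally to smooth maps of the linear spaces.
\<close>

definition local_lift ::
  "'a::euclidean_space set \<Rightarrow> ('a \<Rightarrow> 't) \<Rightarrow> 'b::euclidean_space set \<Rightarrow> ('b \<Rightarrow> 's) \<Rightarrow> ('t \<Rightarrow> 's) \<Rightarrow>
    'a set \<Rightarrow> ('a \<Rightarrow> 'b) \<Rightarrow> bool" where
  "local_lift W p W' p' F U \<phi> \<longleftrightarrow>
     smooth_on_subspace W U \<phi> \<and> \<phi> ` U \<subseteq> W' \<and> (\<forall>u\<in>U. F (p u) = p' (\<phi> u))"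

definition smooth_torus_map ::
  "'a::euclidean_space set \<Rightarrow> ('a \<Rightarrow> 't) \<Rightarrow> 'b::euclidean_space set \<Rightarrow> ('b \<Rightarrow> 's) \<Rightarrow> ('t \<Rightarrow> 's) \<Rightarrow>
    bool" where
  "smooth_torus_map W p W' p' F \<longleftrightarrow> (\<forall>x\<in>W. \<exists>U \<phi>. x \<in> U \<and> local_lift W p W' p' F U \<phi>)"

text \<open>
  \<open>F\<close> is a diffeomorphism, and in the charts its differential at every point is isometric from
  the inner product \<open>g\<close> on \<open>W\<close> to the inner product \<open>g'\<close> on \<open>W'\<close>.
\<close>

definition riemannian_isometry ::
  "'a::euclidean_space set \<Rightarrow> ('a \<Rightarrow> 't) \<Rightarrow> ('a \<Rightarrow> 'a \<Rightarrow> real) \<Rightarrow>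
    'b::euclidean_space set \<Rightarrow> ('b \<Rightarrow> 's) \<Rightarrow> ('b \<Rightarrow> 'b \<Rightarrow> real) \<Rightarrow> ('t \<Rightarrow> 's) \<Rightarrow> bool" where
  "riemannian_isometry W p g W' p' g' F \<longleftrightarrow>
     bij_betw F (p ` W) (p' ` W') \<and>
     smooth_torus_map W p W' p' F \<and>
     smooth_torus_map W' p' W p (inv_into (p ` W) F) \<and>
     (\<forall>x\<in>W. \<exists>U \<phi>. x \<in> U \<and> local_lift W p W' p' F U \<phi> \<and>
        (\<forall>u\<in>U. \<forall>v\<in>W. \<forall>w\<in>W.
           g' (vector_derivative (\<lambda>t. \<phi> (u + t *\<^sub>R v)) (at 0))
              (vector_derivative (\<lambda>t. \<phi> (u + t *\<^sub>R w)) (at 0)) = g v w))"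


section \<open>Bloch isospectrality\<close>

text \<open>
  The harmonic forms, described by their constant coefficients, serve as linear coordinates on the
  vector space \<open>H1_dR G\<close> and hence determine the Lie group structure of \<open>dR_torus G\<close>.
\<close>

definition constant_form :: "('v, 'e::finite) qgraph \<Rightarrow> real ^ 'e \<Rightarrow> 'e \<Rightarrow> real \<Rightarrow> real" where
  "constant_form G c e x = (if on_graph G e x then c $ e else 0)"

definition harmonic_coords :: "('v, 'e::finite) qgraph \<Rightarrow> (real ^ 'e) set" where
  "harmonic_coords G = {c. (\<forall>e. e \<notin> edges G \<longrightarrow> c $ e = 0) \<and> constant_form G c \<in> harmonic_forms G}"

definition dR_torus_proj ::
  "('v, 'e::finite) qgraph \<Rightarrow> real ^ 'e \<Rightarrow> ('e \<Rightarrow> real \<Rightarrow> real) set set" where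
  "dR_torus_proj G c = dR_torus_class G (constant_form G c)"

definition lie_group_iso ::
  "('v, 'e::finite) qgraph \<Rightarrow> ('w, 'f::finite) qgraph \<Rightarrow>
    (('e \<Rightarrow> real \<Rightarrow> real) set set \<Rightarrow> ('f \<Rightarrow> real \<Rightarrow> real) set set) \<Rightarrow> bool" where
  "lie_group_iso G G' \<Phi> \<longleftrightarrow>
     \<Phi> \<in> iso (dR_torus G) (dR_torus G') \<and>
     smooth_torus_map (harmonic_coords G) (dR_torus_proj G)
       (harmonic_coords G') (dR_torus_proj G') \<Phi> \<and>
     smooth_torus_map (harmonic_coords G') (dR_torus_proj G')
       (harmonic_coords G) (dR_torus_proj G) (inv_into (carrier (dR_torus G)) \<Phi>)"

definition bloch_isospectral :: "('v, 'e::finite) qgraph \<Rightarrow> ('w, 'f::finite) qgraph \<Rightarrow> bool" where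
  "bloch_isospectral G G' \<longleftrightarrow>
     (\<exists>\<Phi>. lie_group_iso G G' \<Phi> \<and>
        (\<forall>a\<in>one_forms G. \<forall>b\<in>one_forms G'.
           \<Phi> (dR_torus_class G a) = dR_torus_class G' b \<longrightarrow> Spec G a = Spec G' b))"


section \<open>The Albanese torus\<close>

text \<open>A graph has no 2-cells, so its first homology is the group of 1-cycles.\<close>

definition H1_real :: "('v, 'e::finite) qgraph \<Rightarrow> (real ^ 'e) set" where
  "H1_real G =
     {c. (\<forall>e. e \<notin> edges G \<longrightarrow> c $ e = 0) \<and>
         (\<forall>v\<in>verts G. (\<Sum>e\<in>{e \<in> edges G. tgt G e = v}. c $ e) =
                      (\<Sum>e\<in>{e \<in> edges G. src G e = v}. c $ e))}"

definition H1_int :: "('v, 'e::finite) qgraph \<Rightarrow> (real ^ 'e) set" where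
  "H1_int G = {c \<in> H1_real G. \<forall>e. c $ e \<in> \<int>}"

definition cycle_integral :: "('v, 'e::finite) qgraph \<Rightarrow> real ^ 'e \<Rightarrow> ('e \<Rightarrow> real \<Rightarrow> real) \<Rightarrow> real" where
  "cycle_integral G c a = (\<Sum>e\<in>edges G. c $ e * integral {0..len G e} (a e))"

definition pairing :: "('v, 'e::finite) qgraph \<Rightarrow> ('e \<Rightarrow> real \<Rightarrow> real) set \<Rightarrow> real ^ 'e \<Rightarrow> real" where
  "pairing G A c = the_elem (cycle_integral G c ` A)"

text \<open>The class that represents the functional given by pairing with \<open>c\<close>.\<close>

definition dual_class :: "('v, 'e::finite) qgraph \<Rightarrow> real ^ 'e \<Rightarrow> ('e \<Rightarrow> real \<Rightarrow> real) set" where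
  "dual_class G c =
     (THE A. A \<in> carrier (H1_dR G) \<and> (\<forall>B\<in>carrier (H1_dR G). H1_inner G B A = pairing G B c))"

definition dual_inner :: "('v, 'e::finite) qgraph \<Rightarrow> real ^ 'e \<Rightarrow> real ^ 'e \<Rightarrow> real" where
  "dual_inner G c d = H1_inner G (dual_class G c) (dual_class G d)"

text \<open>
  \<open>Alb_proj G\<close> sends a real cycle to its coset modulo \<open>H1_int G\<close>; its image on \<open>H1_real G\<close> is the
  Albanese torus.
\<close>

definition Alb_proj :: "('v, 'e::finite) qgraph \<Rightarrow> real ^ 'e \<Rightarrow> (real ^ 'e) set" where
  "Alb_proj G c = (\<lambda>z. c + z) ` H1_int G"

definition Alb_isometry ::
  "('v, 'e::finite) qgraph \<Rightarrow> ('w, 'f::finite) qgraph \<Rightarrow> ((real ^ 'e) set \<Rightarrow> (real ^ 'f) set) \<Rightarrow> bool"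
  where
  "Alb_isometry G G' F \<longleftrightarrow>
     riemannian_isometry (H1_real G) (Alb_proj G) (dual_inner G)
       (H1_real G') (Alb_proj G') (dual_inner G') F"

end

theory Submission
  imports Defs
begin

text \<open>
  Harmonic representatives identify both \<open>H\<^sup>1(G, \<real>)\<close> and \<open>H\<^sub>1(G, \<real>)\<close> with the space \<open>W = H1_real G\<close> of edge
  vectors \<open>c\<close> that are balanced at every vertex. Under this identification the inner product on cohomology and the
  dual inner product on homology are both \<open><c, d> = \<Sum>e. len e * c e * d e\<close> (\<open>len_inner\<close>, \<open>dual_inner_eq\<close>). The
  classes with integral periods form a lattice in \<open>W\<close>, and the integral cycles are its dual lattice
  (\<open>H1_int_iff_dual\<close>). Hence a linear isometry from \<open>W\<close> onto \<open>W'\<close> that matches the period lattices also matches the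
  integral cycles and induces an isometry of the Albanese tori. An isomorphism of the cohomology tori lifts to a
  linear isomorphism \<open>A\<close> that matches the period lattices (\<open>torus_isomorphism_lift\<close>), so it remains to recover the
  inner product from the spectra.

  Two consequences of the spectra suffice. First, near the trivial class the lowest eigenvalue at \<open>c\<close> is
  asymptotically \<open>4 \<pi>\<^sup>2 <c, c> / L\<close>, where \<open>L\<close> is the total length of \<open>G\<close>: the constant functions have this Rayleigh
  quotient (\<open>small_eigenvalue_exists\<close>), and conversely an eigenfunction with a small eigenvalue is nearly constant
  (\<open>eigenvalues_bounded_below\<close>). As \<open>c\<close> and \<open>A c\<close> have the same eigenvalues, \<open><A c, A c> / L' = <c, c> / L\<close>. Second, by
  Weyl's law the spectrum of the trivial class determines \<open>L\<close>: the number of eigenvalues \<open>k\<^sup>2\<close> with \<open>0 \<le> k < K\<close>, counted with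
  multiplicity, is \<open>K L / \<pi>\<close> up to a bounded error (\<open>weyl_lower_bound\<close>, \<open>weyl_upper_bound\<close>).

  The existence of eigenvalues in both arguments comes from spectral flow in finite dimensions. If each edge is cut
  into pieces of length less than \<open>\<pi> / K\<close>, then for \<open>k < K\<close> the kernel of a Hermitian matrix indexed by the
  subdivision points embeds into the eigenspace for \<open>k\<^sup>2\<close> (\<open>extension_bloch_pair\<close>). This matrix depends continuously on \<open>k\<close> and is
  positive semidefinite for \<open>k = 0\<close>, and along such a path the negative index cannot exceed the sum of the dimensions
  of the kernels that have been passed (\<open>spectral_flow_bound\<close>). So every negative definite family for \<open>k = K\<close> forces
  eigenvalues below \<open>K\<^sup>2\<close>. In the other direction, too many eigenfunctions below \<open>K\<^sup>2\<close> would have a nontrivial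
  combination that vanishes at all subdivision points, which contradicts Wirtinger's inequality
  (\<open>eigenvalue_count_upper_bound\<close>).
\<close>

section \<open>Differentiating an indefinite integral\<close>

text \<open>
  Every exceptional point is an end point of arbitrarily short intervals on which the integral of
  \<open>h\<close> deviates from \<open>t *\<^sub>R h x\<close> by more than \<open>\<eta> * t\<close>. By Henstock's lemma disjoint intervals of
  this kind that are fine for a suitable gauge have small total length, and by Vitali's covering
  lemma the balls with five times their lengths as radii cover the exceptional set. The sign \<open>\<sigma>\<close>
  chooses between intervals to the right and to the left.
\<close>

lemma negligible_one_sided_derivative_failure:
  fixes h :: "real \<Rightarrow> 'a::euclidean_space"
  assumes h: "h integrable_on {a..b}" and \<eta>: "\<eta> > 0" and sg: "\<sigma> = 1 \<or> \<sigma> = (-1::real)"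
  shows "negligible {x\<in>{a..b}. \<forall>\<delta>>0. \<exists>t. 0 < t \<and> t < \<delta> \<and> x + \<sigma> * t \<in> {a..b} \<and>
           norm (t *\<^sub>R h x - integral {min x (x + \<sigma> * t)..max x (x + \<sigma> * t)} h) > \<eta> * t}"
    (is "negligible ?E")
proof -
  define E where "E = ?E"
  have Esub: "E \<subseteq> {a..b}" by (auto simp: E_def)
  define I where "I = (\<lambda>x t. {min x (x + \<sigma> * t)..max x (x + \<sigma> * t)})"
  show ?thesis
  unfolding negligible_outer_le E_def[symmetric]
  proof (intro allI impI)
    fix e :: real assume "e > 0"
    define e' where "e' = e * \<eta> / 10"
    have e': "e' > 0" using \<open>e > 0\<close> \<eta> by (simp add: e'_def)
    obtain \<gamma> where \<gamma>: "gauge \<gamma>"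
      and hl: "\<And>p. \<lbrakk>p tagged_partial_division_of (cbox a b); \<gamma> fine p\<rbrakk> \<Longrightarrow>
               sum (\<lambda>(x,k). norm (measure lborel k *\<^sub>R h x - integral k h)) p < e'"
      using Henstock_lemma[of h a b e'] h e' by (auto simp: cbox_interval)
    define K where "K = {(x,t). x \<in> E \<and> 0 < t \<and> t \<le> 1 \<and> x + \<sigma> * t \<in> {a..b} \<and> I x t \<subseteq> \<gamma> x \<and>
           norm (t *\<^sub>R h x - integral (I x t) h) > \<eta> * t}"
    have ex: "\<exists>t. (x,t) \<in> K" if x: "x \<in> E" for x
    proof -
      have "open (\<gamma> x)" "x \<in> \<gamma> x" using \<gamma> by (auto simp: gauge_def)
      then obtain d where d: "d > 0" "ball x d \<subseteq> \<gamma> x" by (meson openE)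
      then have "min 1 d > 0" by simp
      with x obtain t where t: "0 < t" "t < min 1 d" "x + \<sigma> * t \<in> {a..b}"
        "norm (t *\<^sub>R h x - integral (I x t) h) > \<eta> * t"
        unfolding I_def E_def by blast
      have "I x t \<subseteq> ball x d"
        using t sg by (auto simp: I_def dist_real_def min_def max_def split: if_splits)
      with d have "I x t \<subseteq> \<gamma> x" by blast
      with t x show ?thesis unfolding K_def by (intro exI[of _ t]) auto
    qed
    have cov: "E \<subseteq> (\<Union>i\<in>K. cball (fst i) (snd i))"
    proof
      fix x assume "x \<in> E"
      then obtain t where t: "(x,t) \<in> K" using ex by blast
      then have "0 < t" by (auto simp: K_def)
      with t show "x \<in> (\<Union>i\<in>K. cball (fst i) (snd i))" by (intro UN_I[of "(x,t)"]) simp_all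
    qed
    have Kb: "0 < snd i \<and> snd i \<le> 1" if "i \<in> K" for i using that by (simp add: K_def case_prod_unfold)
    obtain C where C: "countable C" "C \<subseteq> K"
     "pairwise (\<lambda>i j. disjnt (cball (fst i) (snd i)) (cball (fst j) (snd j))) C"
     "E \<subseteq> (\<Union>i\<in>C. cball (fst i) (5 * snd i))"
      by (rule Vitali_covering_lemma_cballs[OF cov, where B = 1]) (erule Kb, assumption)
    have fin: "(\<Sum>i\<in>F. snd i) \<le> e' / \<eta>" if F: "finite F" "F \<subseteq> C" for F
    proof -
      let ?p = "(\<lambda>i. (fst i, I (fst i) (snd i))) ` F"
      have sub: "I (fst i) (snd i) \<subseteq> cball (fst i) (snd i)" if "i \<in> F" for i
        using that F C(2) sg by (auto simp: I_def K_def dist_real_def)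
      have FK: "i \<in> K" if "i \<in> F" for i using that F C(2) by blast
      have inj: "fst i \<noteq> fst j \<and> I (fst i) (snd i) \<inter> I (fst j) (snd j) = {}" if "i \<in> F" "j \<in> F" "i \<noteq> j" for i j
      proof -
        have "disjnt (cball (fst i) (snd i)) (cball (fst j) (snd j))"
          using C(3) that F by (auto simp: pairwise_def)
        moreover have "fst i \<in> cball (fst i) (snd i)" "fst j \<in> cball (fst j) (snd j)"
          using FK[OF that(1)] FK[OF that(2)] by (auto simp: K_def)
        ultimately show ?thesis using sub[OF that(1)] sub[OF that(2)] unfolding disjnt_def by fastforce
      qed
      have injon: "inj_on (\<lambda>i. (fst i, I (fst i) (snd i))) F"
        using inj by (auto simp: inj_on_def)
      have "?p tagged_partial_division_of (cbox a b)"
        unfolding tagged_partial_division_of_def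
      proof (intro conjI allI impI)
        show "finite ?p" using F by simp
      next
        fix x k assume xk: "(x,k) \<in> ?p"
        then obtain i where i: "i \<in> F" "x = fst i" "k = I (fst i) (snd i)" by auto
        have K: "x \<in> {a..b}" "0 < snd i" "x + \<sigma> * snd i \<in> {a..b}" using FK[OF i(1)] i Esub by (auto simp: K_def)
        show "x \<in> k" using K i by (auto simp: I_def)
        show "k \<subseteq> cbox a b" using K i by (auto simp: I_def cbox_interval)
        show "\<exists>a b. k = cbox a b" using i by (auto simp: I_def cbox_interval intro!: exI)
      next
        fix x1 k1 x2 k2
        assume "(x1, k1) \<in> ?p \<and> (x2, k2) \<in> ?p \<and> (x1, k1) \<noteq> (x2, k2)"
        then obtain i j where "i \<in> F" "j \<in> F" "i \<noteq> j" "k1 = I (fst i) (snd i)" "k2 = I (fst j) (snd j)"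
          by auto
        then show "interior k1 \<inter> interior k2 = {}" using inj by (metis interior_Int interior_empty)
      qed
      moreover have "\<gamma> fine ?p"
        unfolding fine_def
      proof clarify
        fix i x assume "i \<in> F" "x \<in> I (fst i) (snd i)"
        then show "x \<in> \<gamma> (fst i)" using FK[OF \<open>i \<in> F\<close>] by (auto simp: K_def)
      qed
      ultimately have "sum (\<lambda>(x,k). norm (measure lborel k *\<^sub>R h x - integral k h)) ?p < e'" by (rule hl)
      then have "(\<Sum>i\<in>F. norm (measure lborel (I (fst i) (snd i)) *\<^sub>R h (fst i) - integral (I (fst i) (snd i)) h)) < e'"
        by (simp add: sum.reindex[OF injon] case_prod_unfold)
      moreover have "(\<Sum>i\<in>F. \<eta> * snd i) \<le> (\<Sum>i\<in>F. norm (measure lborel (I (fst i) (snd i)) *\<^sub>R h (fst i) - integral (I (fst i) (snd i)) h))"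
      proof (rule sum_mono)
        fix i assume "i \<in> F"
        then have "i \<in> K" by (rule FK)
        then have "measure lborel (I (fst i) (snd i)) = snd i"
          using sg by (auto simp: I_def K_def min_def max_def)
        with \<open>i \<in> K\<close> show "\<eta> * snd i \<le> norm (measure lborel (I (fst i) (snd i)) *\<^sub>R h (fst i) - integral (I (fst i) (snd i)) h)"
          by (auto simp: K_def)
      qed
      ultimately have "\<eta> * (\<Sum>i\<in>F. snd i) \<le> e'" by (simp add: sum_distrib_left)
      then show ?thesis using \<eta> by (simp add: field_simps)
    qed
    let ?T = "\<Union>i\<in>C. cball (fst i) (5 * snd i)"
    have pos: "0 < snd i" if "i \<in> C" for i using that C(2) by (auto simp: K_def)
    have bd: "measure lebesgue (\<Union>i\<in>F. cball (fst i) (5 * snd i)) \<le> 10 * (e' / \<eta>)"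
      if F: "F \<subseteq> C" "finite F" for F
    proof -
      have "measure lebesgue (\<Union>i\<in>F. cball (fst i) (5 * snd i)) \<le> (\<Sum>i\<in>F. measure lebesgue (cball (fst i) (5 * snd i)))"
        by (rule measure_UNION_le) (use F in auto)
      also have "\<dots> = (\<Sum>i\<in>F. 10 * snd i)"
      proof (rule sum.cong)
        fix i assume "i \<in> F"
        then have "0 < snd i" using pos[of i] F by blast
        then show "measure lebesgue (cball (fst i) (5 * snd i)) = 10 * snd i"
          by (simp add: cball_eq_atLeastAtMost)
      qed simp
      also have "\<dots> \<le> 10 * (e' / \<eta>)"
        using fin[OF F(2,1)] by (simp add: sum_distrib_left[symmetric])
      finally show ?thesis .
    qed
    have "?T \<in> lmeasurable"
      by (rule fmeasurable_UN_bound[OF C(1) _ bd]) auto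
    moreover have "measure lebesgue ?T \<le> 10 * (e' / \<eta>)"
      by (rule measure_UN_bound[OF C(1) _ bd]) auto
    ultimately show "\<exists>T. E \<subseteq> T \<and> T \<in> lmeasurable \<and> measure lebesgue T \<le> e"
      using C(4) \<eta> by (intro exI[of _ ?T]) (auto simp: e'_def)
  qed
qed

text \<open>
  A Sobolev function of order two satisfies the eigenvalue equation only almost everywhere, and
  the equation involves pointwise derivatives. This theorem identifies them with the weak ones.
\<close>

theorem indefinite_integral_has_derivative_ae:
  fixes h :: "real \<Rightarrow> 'a::euclidean_space"
  assumes h: "h integrable_on {a..b}"
  obtains N where "negligible N"
    "\<And>x. x \<in> {a..b} - N \<Longrightarrow> ((\<lambda>x. integral {a..x} h) has_vector_derivative h x) (at x within {a..b})"
proof -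
  define bad where "bad \<sigma> \<eta> = {x\<in>{a..b}. \<forall>\<delta>>0. \<exists>t. 0 < t \<and> t < \<delta> \<and> x + \<sigma> * t \<in> {a..b} \<and>
           norm (t *\<^sub>R h x - integral {min x (x + \<sigma> * t)..max x (x + \<sigma> * t)} h) > \<eta> * t}" for \<sigma> \<eta> :: real
  have bad: "negligible (bad \<sigma> \<eta>)" if "\<eta> > 0" "\<sigma> = 1 \<or> \<sigma> = -1" for \<sigma> \<eta>
    unfolding bad_def by (rule negligible_one_sided_derivative_failure[OF h that])
  have good: "\<exists>\<delta>>0. \<forall>t. 0 < t \<and> t < \<delta> \<and> x + \<sigma> * t \<in> {a..b} \<longrightarrow>
      norm (t *\<^sub>R h x - integral {min x (x + \<sigma> * t)..max x (x + \<sigma> * t)} h) \<le> \<eta> * t"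
    if "x \<in> {a..b}" "x \<notin> bad \<sigma> \<eta>" for \<sigma> \<eta> x
    using that unfolding bad_def mem_Collect_eq not_less[symmetric] by meson
  define N where "N = (\<Union>n. bad 1 (inverse (real (Suc n))) \<union> bad (-1) (inverse (real (Suc n))))"
  have 1: "negligible N"
    unfolding N_def by (intro negligible_Union_nat negligible_Un bad) auto
  show ?thesis
  proof (rule that[OF 1])
    fix x assume x: "x \<in> {a..b} - N"
    let ?F = "\<lambda>x. integral {a..x} h"
    have step: "?F y - ?F x = (y - x) *\<^sub>R h x - (sgn (y - x)) *\<^sub>R (\<bar>y - x\<bar> *\<^sub>R h x - integral {min x y..max x y} h)" if y: "y \<in> {a..b}" for y
    proof (cases "x \<le> y")
      case True
      have "integral {a..x} h + integral {x..y} h = integral {a..y} h"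
        using x y True h by (intro Henstock_Kurzweil_Integration.integral_combine) (auto intro: integrable_on_subinterval)
      with True show ?thesis by (cases "x = y") (auto simp: algebra_simps sgn_if max_def min_def)
    next
      case False
      have "integral {a..y} h + integral {y..x} h = integral {a..x} h"
        using x y False h by (intro Henstock_Kurzweil_Integration.integral_combine) (auto intro: integrable_on_subinterval)
      with False show ?thesis by (auto simp: algebra_simps sgn_if max_def min_def)
    qed
    show "(?F has_vector_derivative h x) (at x within {a..b})"
      unfolding has_vector_derivative_def has_derivative_within_alt
    proof (intro conjI allI impI)
      fix e :: real assume "e > 0"
      then obtain n where n: "inverse (real (Suc n)) < e" using reals_Archimedean by blast
      let ?e = "inverse (real (Suc n))"
      from x have "x \<in> {a..b}" "x \<notin> bad 1 ?e" "x \<notin> bad (-1) ?e" unfolding N_def by blast+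
      then obtain d1 d2 where d: "d1 > 0" "d2 > 0"
        and 1: "\<forall>t. 0 < t \<and> t < d1 \<and> x + 1 * t \<in> {a..b} \<longrightarrow> norm (t *\<^sub>R h x - integral {min x (x + 1 * t)..max x (x + 1 * t)} h) \<le> ?e * t"
        and 2: "\<forall>t. 0 < t \<and> t < d2 \<and> x + (-1) * t \<in> {a..b} \<longrightarrow> norm (t *\<^sub>R h x - integral {min x (x + (-1) * t)..max x (x + (-1) * t)} h) \<le> ?e * t"
        using good[of x 1 ?e] good[of x "-1" ?e] by metis
      show "\<exists>d>0. \<forall>y\<in>{a..b}. norm (y - x) < d \<longrightarrow> norm (?F y - ?F x - (y - x) *\<^sub>R h x) \<le> e * norm (y - x)"
      proof (intro exI[of _ "min d1 d2"] conjI ballI impI)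
        fix y assume y: "y \<in> {a..b}" "norm (y - x) < min d1 d2"
        have "norm (\<bar>y - x\<bar> *\<^sub>R h x - integral {min x y..max x y} h) \<le> ?e * \<bar>y - x\<bar>"
        proof (cases y x rule: linorder_cases)
          case less
          then show ?thesis using 2[rule_format, of "x - y"] y by (simp add: min_def max_def split: if_splits)
        next
          case greater
          then show ?thesis using 1[rule_format, of "y - x"] y by (simp add: min_def max_def split: if_splits)
        qed auto
        also have "\<dots> \<le> e * \<bar>y - x\<bar>" using n by (intro mult_right_mono) auto
        finally show "norm (?F y - ?F x - (y - x) *\<^sub>R h x) \<le> e * norm (y - x)"
          unfolding step[OF y(1)] by (cases "y = x") (auto simp: sgn_if)
      qed (use d in auto)
    qed (auto intro: bounded_linear_intros)
  qed
qed

section \<open>Spectral flow of a path of Hermitian forms\<close>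

text \<open>
  Vectors and matrices are functions on an arbitrary finite index set \<open>I\<close> and not on a finite
  type, because the number of subdivision points of a graph has to vary inside a proof.
\<close>

definition hform :: "'i set \<Rightarrow> ('i \<Rightarrow> 'i \<Rightarrow> complex) \<Rightarrow> ('i \<Rightarrow> complex) \<Rightarrow> ('i \<Rightarrow> complex) \<Rightarrow> complex" where
  "hform I H x y = (\<Sum>i\<in>I. \<Sum>j\<in>I. cnj (x i) * H i j * y j)"

definition lin_comb :: "nat \<Rightarrow> (nat \<Rightarrow> complex) \<Rightarrow> (nat \<Rightarrow> 'i \<Rightarrow> complex) \<Rightarrow> 'i \<Rightarrow> complex" where
  "lin_comb n c w i = (\<Sum>k<n. c k * w k i)"

text \<open>
  A negative definite family is automatically linearly independent, so the largest possible \<open>n\<close> is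
  the negative index of the form.
\<close>

definition neg_family :: "'i set \<Rightarrow> ('i \<Rightarrow> 'i \<Rightarrow> complex) \<Rightarrow> nat \<Rightarrow> (nat \<Rightarrow> 'i \<Rightarrow> complex) \<Rightarrow> bool" where
  "neg_family I H n w \<longleftrightarrow>
     (\<forall>c. (\<exists>k<n. c k \<noteq> 0) \<longrightarrow> Re (hform I H (lin_comb n c w) (lin_comb n c w)) < 0)"

lemma underdetermined_system:
  fixes a :: "'e \<Rightarrow> 'b \<Rightarrow> complex"
  assumes "finite E" "finite B" "card E < card B"
  shows "\<exists>c. (\<exists>b\<in>B. c b \<noteq> 0) \<and> (\<forall>e\<in>E. (\<Sum>b\<in>B. a e b * c b) = 0)"
  using assms
proof (induction E arbitrary: B a rule: finite_induct)
  case empty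
  then have "B \<noteq> {}" by auto
  then show ?case by (intro exI[of _ "\<lambda>_. 1"]) auto
next
  case (insert e E)
  show ?case
  proof (cases "\<forall>b\<in>B. a e b = 0")
    case True
    have "card E < card B" using insert.prems insert.hyps by simp
    then obtain c where c: "\<exists>b\<in>B. c b \<noteq> 0" "\<forall>e\<in>E. (\<Sum>b\<in>B. a e b * c b) = 0"
      using insert.IH[of B a] insert.prems(1) by blast
    moreover have "(\<Sum>b\<in>B. a e b * c b) = 0" using True by simp
    ultimately show ?thesis by blast
  next
    case False
    then obtain b0 where b0: "b0 \<in> B" "a e b0 \<noteq> 0" by blast
    define B' where "B' = B - {b0}"
    have B': "finite B'" "card E < card B'" "B = insert b0 B'" "b0 \<notin> B'"
      using insert.prems insert.hyps b0 by (auto simp: B'_def)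
    obtain c where c: "\<exists>b\<in>B'. c b \<noteq> 0"
      "\<forall>f\<in>E. (\<Sum>b\<in>B'. (a f b - a f b0 * a e b / a e b0) * c b) = 0"
      using insert.IH[OF B'(1,2), of "\<lambda>f b. a f b - a f b0 * a e b / a e b0"] by blast
    define s where "s = (\<Sum>b\<in>B'. a e b * c b)"
    define c' where "c' = c(b0 := - s / a e b0)"
    have sum': "(\<Sum>b\<in>B'. a f b * c' b) = (\<Sum>b\<in>B'. a f b * c b)" for f
      by (rule sum.cong) (use B'(4) in \<open>auto simp: c'_def\<close>)
    have "(\<Sum>b\<in>B. a f b * c' b) = 0" if "f \<in> insert e E" for f
    proof (cases "f = e")
      case True
      then show ?thesis using B' b0 by (simp add: sum') (simp add: c'_def s_def)
    next
      case False
      with that have "f \<in> E" by simp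
      have "(\<Sum>b\<in>B'. a f b * c b) - a f b0 / a e b0 * s = (\<Sum>b\<in>B'. (a f b - a f b0 * a e b / a e b0) * c b)"
        unfolding s_def sum_distrib_left sum_subtractf[symmetric]
        by (rule sum.cong) (auto simp: algebra_simps)
      also have "\<dots> = 0" using c(2) \<open>f \<in> E\<close> by blast
      finally show ?thesis using B' by (simp add: sum') (simp add: c'_def)
    qed
    moreover have "\<exists>b\<in>B. c' b \<noteq> 0" using c(1) B' by (auto simp: c'_def)
    ultimately show ?thesis by blast
  qed
qed

lemma bounded_families_subsequence:
  fixes x :: "nat \<Rightarrow> 'i \<Rightarrow> complex"
  assumes "finite I" "\<And>m i. i \<in> I \<Longrightarrow> norm (x m i) \<le> 1"
  shows "\<exists>r l. strict_mono (r::nat\<Rightarrow>nat) \<and> (\<forall>i\<in>I. (\<lambda>m. x (r m) i) \<longlonglongrightarrow> l i)"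
  using assms
proof (induction I rule: finite_induct)
  case empty
  then show ?case by (auto intro!: exI[of _ id] simp: strict_mono_def)
next
  case (insert a I)
  then obtain r l where r: "strict_mono r" "\<forall>i\<in>I. (\<lambda>m. x (r m) i) \<longlonglongrightarrow> l i" by auto
  have "bounded (range (\<lambda>m. x (r m) a))"
    by (rule boundedI[of _ 1]) (use insert.prems in auto)
  then obtain l' r' where r': "strict_mono r'" "((\<lambda>m. x (r m) a) \<circ> r') \<longlonglongrightarrow> l'"
    using bounded_imp_convergent_subsequence by blast
  have "(\<lambda>m. x ((r \<circ> r') m) i) \<longlonglongrightarrow> (l(a := l')) i" if "i \<in> insert a I" for i
  proof (cases "i = a")
    case True
    then show ?thesis using r'(2) by (simp add: o_def)
  next
    case False
    then show ?thesis using LIMSEQ_subseq_LIMSEQ[of "\<lambda>m. x (r m) i" "l i" r'] r r'(1) that by (auto simp: o_def)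
  qed
  then show ?case using strict_mono_o[OF r(1) r'(1)] by blast
qed

lemma hform_scale: "hform I H (\<lambda>i. of_real s * x i) (\<lambda>i. of_real s * x i) = of_real (s\<^sup>2) * hform I H x x"
  unfolding hform_def sum_distrib_left by (intro sum.cong) (auto simp: power2_eq_square)

lemma hform_diff_bound:
  assumes "finite I" "\<And>i j. i \<in> I \<Longrightarrow> j \<in> I \<Longrightarrow> norm (H i j - H' i j) \<le> \<epsilon>"
  shows "\<bar>Re (hform I H x x) - Re (hform I H' x x)\<bar> \<le> \<epsilon> * (\<Sum>i\<in>I. norm (x i))\<^sup>2"
proof -
  have "\<bar>Re (hform I H x x) - Re (hform I H' x x)\<bar> \<le> norm (hform I H x x - hform I H' x x)"
    using abs_Re_le_cmod by (metis minus_complex.simps(1))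
  also have "hform I H x x - hform I H' x x = (\<Sum>i\<in>I. \<Sum>j\<in>I. cnj (x i) * (H i j - H' i j) * x j)"
    unfolding hform_def sum_subtractf[symmetric] by (intro sum.cong) (auto simp: algebra_simps)
  also have "norm \<dots> \<le> (\<Sum>i\<in>I. \<Sum>j\<in>I. norm (x i) * \<epsilon> * norm (x j))"
    by (intro sum_norm_le order.trans[OF norm_sum] sum_mono)
      (auto simp: norm_mult intro!: mult_right_mono mult_left_mono assms)
  also have "\<dots> = \<epsilon> * (\<Sum>i\<in>I. norm (x i))\<^sup>2"
    unfolding power2_eq_square sum_product unfolding sum_distrib_left by (intro sum.cong) auto
  finally show ?thesis .
qed

text \<open>
  Compactness of the unit sphere, for the norm \<open>\<Sum>i\<in>I. norm (x i)\<close>, of the subspace cut out by the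
  constraints.
\<close>

lemma definite_bound_on_constraints:
  assumes "finite I"
    and neg: "\<And>x. \<exists>i\<in>I. x i \<noteq> 0 \<Longrightarrow> \<forall>e\<in>E. (\<Sum>i\<in>I. a e i * x i) = 0 \<Longrightarrow> Re (hform I H x x) < 0"
  obtains m where "m > 0"
    "\<And>x. \<forall>e\<in>E. (\<Sum>i\<in>I. a e i * x i) = 0 \<Longrightarrow> Re (hform I H x x) \<le> - m * (\<Sum>i\<in>I. norm (x i))\<^sup>2"
proof (rule ccontr)
  assume "\<not> thesis"
  then have "\<exists>x. (\<forall>e\<in>E. (\<Sum>i\<in>I. a e i * x i) = 0) \<and>
     Re (hform I H x x) > - inverse (real (Suc k)) * (\<Sum>i\<in>I. norm (x i))\<^sup>2" for k
    using that[of "inverse (real (Suc k))"] by (force simp: not_le)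
  then obtain x where x: "\<And>k. \<forall>e\<in>E. (\<Sum>i\<in>I. a e i * x k i) = 0"
     "\<And>k. Re (hform I H (x k) (x k)) > - inverse (real (Suc k)) * (\<Sum>i\<in>I. norm (x k i))\<^sup>2"
    by metis
  define S where "S k = (\<Sum>i\<in>I. norm (x k i))" for k
  have S: "S k > 0" for k
  proof -
    have "S k \<noteq> 0"
    proof
      assume "S k = 0"
      then have "\<forall>i\<in>I. x k i = 0" using assms(1) by (simp add: S_def sum_nonneg_eq_0_iff)
      then have "hform I H (x k) (x k) = 0" by (simp add: hform_def)
      with x(2)[of k] \<open>S k = 0\<close> show False by (simp add: S_def)
    qed
    moreover have "S k \<ge> 0" by (auto simp: S_def intro: sum_nonneg)
    ultimately show ?thesis by simp
  qed
  define y where "y k i = of_real (inverse (S k)) * x k i" for k i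
  have ysum: "(\<Sum>i\<in>I. norm (y k i)) = 1" for k
    using S[of k] by (simp add: y_def norm_mult norm_inverse sum_distrib_left[symmetric] S_def[symmetric])
  have yle: "norm (y k i) \<le> 1" if "i \<in> I" for k i
    using ysum[of k] member_le_sum[of i I "\<lambda>i. norm (y k i)"] that assms(1) by auto
  have yE: "(\<Sum>i\<in>I. a e i * y k i) = 0" if "e \<in> E" for e k
  proof -
    have "(\<Sum>i\<in>I. a e i * y k i) = of_real (inverse (S k)) * (\<Sum>i\<in>I. a e i * x k i)"
      unfolding sum_distrib_left y_def by (intro sum.cong refl) (simp only: mult_ac)
    with x(1)[of k] that show ?thesis by simp
  qed
  have yH: "Re (hform I H (y k) (y k)) > - inverse (real (Suc k))" for k
  proof -
    have "Re (hform I H (y k) (y k)) = (inverse (S k))\<^sup>2 * Re (hform I H (x k) (x k))"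
      unfolding y_def hform_scale by (simp add: Re_complex_of_real del: of_real_power of_real_inverse)
    moreover have "(inverse (S k))\<^sup>2 * Re (hform I H (x k) (x k)) > (inverse (S k))\<^sup>2 * (- inverse (real (Suc k)) * (S k)\<^sup>2)"
      using x(2)[of k] S[of k] by (intro mult_strict_left_mono) (auto simp: S_def)
    moreover have "(inverse (S k))\<^sup>2 * (- inverse (real (Suc k)) * (S k)\<^sup>2) = - inverse (real (Suc k))"
      using S[of k] by (simp add: power2_eq_square field_simps)
    ultimately show ?thesis by linarith
  qed
  obtain r l where r: "strict_mono r" "\<And>i. i \<in> I \<Longrightarrow> (\<lambda>m. y (r m) i) \<longlonglongrightarrow> l i"
    using bounded_families_subsequence[OF assms(1), of y] yle by blast
  have "(\<lambda>m. \<Sum>i\<in>I. norm (y (r m) i)) \<longlonglongrightarrow> (\<Sum>i\<in>I. norm (l i))"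
    by (intro tendsto_intros r)
  then have "(\<Sum>i\<in>I. norm (l i)) = 1" using ysum by (simp add: LIMSEQ_const_iff)
  then have l0: "\<exists>i\<in>I. l i \<noteq> 0" by (metis norm_zero sum.neutral zero_neq_one)
  have lE: "(\<Sum>i\<in>I. a e i * l i) = 0" if "e \<in> E" for e
  proof -
    have "(\<lambda>m. \<Sum>i\<in>I. a e i * y (r m) i) \<longlonglongrightarrow> (\<Sum>i\<in>I. a e i * l i)"
      by (intro tendsto_intros r)
    then show ?thesis using yE[OF that] by (simp add: LIMSEQ_const_iff)
  qed
  have lim1: "(\<lambda>m. Re (hform I H (y (r m)) (y (r m)))) \<longlonglongrightarrow> Re (hform I H l l)"
    unfolding hform_def by (intro tendsto_intros r)
  have lim2: "(\<lambda>m. - inverse (real (Suc (r m)))) \<longlonglongrightarrow> - 0"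
    using LIMSEQ_subseq_LIMSEQ[OF LIMSEQ_inverse_real_of_nat r(1)] by (intro tendsto_minus) (simp add: o_def)
  have "- 0 \<le> Re (hform I H l l)"
    by (rule LIMSEQ_le[OF lim2 lim1]) (use yH less_imp_le in blast)
  with neg[OF l0] lE show False by force
qed

lemma hform_lin_comb:
  "hform I H (lin_comb n c w) (lin_comb n c w) = hform {..<n} (\<lambda>k l. hform I H (w k) (w l)) c c"
proof -
  have "hform I H (lin_comb n c w) (lin_comb n c w) =
      (\<Sum>i\<in>I. \<Sum>j\<in>I. \<Sum>k<n. \<Sum>l<n. cnj (c k) * (cnj (w k i) * H i j * w l j) * c l)"
    unfolding hform_def lin_comb_def
  proof (intro sum.cong refl)
    fix i j
    have "cnj (\<Sum>k<n. c k * w k i) * H i j * (\<Sum>l<n. c l * w l j) =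
      H i j * ((\<Sum>k<n. cnj (c k * w k i)) * (\<Sum>l<n. c l * w l j))" by simp
    also have "\<dots> = (\<Sum>k<n. \<Sum>l<n. cnj (c k) * (cnj (w k i) * H i j * w l j) * c l)"
      unfolding sum_product unfolding sum_distrib_left by (intro sum.cong refl) simp
    finally show "cnj (\<Sum>k<n. c k * w k i) * H i j * (\<Sum>l<n. c l * w l j) =
      (\<Sum>k<n. \<Sum>l<n. cnj (c k) * (cnj (w k i) * H i j * w l j) * c l)" .
  qed
  also have "\<dots> = (\<Sum>i\<in>I. \<Sum>k<n. \<Sum>j\<in>I. \<Sum>l<n. cnj (c k) * (cnj (w k i) * H i j * w l j) * c l)"
    by (intro sum.cong refl sum.swap)
  also have "\<dots> = (\<Sum>k<n. \<Sum>i\<in>I. \<Sum>j\<in>I. \<Sum>l<n. cnj (c k) * (cnj (w k i) * H i j * w l j) * c l)"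
    by (rule sum.swap)
  also have "\<dots> = (\<Sum>k<n. \<Sum>i\<in>I. \<Sum>l<n. \<Sum>j\<in>I. cnj (c k) * (cnj (w k i) * H i j * w l j) * c l)"
    by (intro sum.cong refl sum.swap)
  also have "\<dots> = (\<Sum>k<n. \<Sum>l<n. \<Sum>i\<in>I. \<Sum>j\<in>I. cnj (c k) * (cnj (w k i) * H i j * w l j) * c l)"
    by (intro sum.cong refl sum.swap)
  also have "\<dots> = hform {..<n} (\<lambda>k l. hform I H (w k) (w l)) c c"
    unfolding hform_def sum_distrib_right sum_distrib_left by simp
  finally show ?thesis .
qed

lemma neg_family_gram:
  "neg_family I H n w \<longleftrightarrow> (\<forall>c. (\<exists>k\<in>{..<n}. c k \<noteq> 0) \<longrightarrow>
     Re (hform {..<n} (\<lambda>k l. hform I H (w k) (w l)) c c) < 0)"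
  unfolding neg_family_def hform_lin_comb by auto

lemma neg_family_mono:
  assumes "neg_family I H n w" "m \<le> n" shows "neg_family I H m w"
  unfolding neg_family_def
proof (intro allI impI)
  fix c :: "nat \<Rightarrow> complex" assume c: "\<exists>k<m. c k \<noteq> 0"
  define c' where "c' k = (if k < m then c k else 0)" for k
  have "lin_comb n c' w = lin_comb m c w"
  proof
    fix i
    have "(\<Sum>k<n. c' k * w k i) = (\<Sum>k<m. c' k * w k i)"
      by (rule sum.mono_neutral_right) (use assms(2) in \<open>auto simp: c'_def\<close>)
    then show "lin_comb n c' w i = lin_comb m c w i" by (simp add: lin_comb_def c'_def)
  qed
  moreover have "\<exists>k<n. c' k \<noteq> 0" using c assms(2) by (auto simp: c'_def)
  ultimately show "Re (hform I H (lin_comb m c w) (lin_comb m c w)) < 0"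
    using assms(1) unfolding neg_family_def by metis
qed

text \<open>The uniform bound for a definite form leaves room for a small change of the matrix.\<close>

lemma neg_family_open:
  fixes H :: "real \<Rightarrow> 'i \<Rightarrow> 'i \<Rightarrow> complex"
  assumes I: "finite I" and t: "t \<in> S"
    and cont: "\<And>i j. i \<in> I \<Longrightarrow> j \<in> I \<Longrightarrow> continuous_on S (\<lambda>t. H t i j)"
    and neg: "neg_family I (H t) n w"
  shows "\<exists>\<delta>>0. \<forall>s\<in>S. \<bar>s - t\<bar> < \<delta> \<longrightarrow> neg_family I (H s) n w"
proof -
  let ?G = "\<lambda>s k l. hform I (H s) (w k) (w l)"
  obtain m where m: "m > 0" "\<And>c. Re (hform {..<n} (?G t) c c) \<le> - m * (\<Sum>k<n. norm (c k))\<^sup>2"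
    using definite_bound_on_constraints[of "{..<n}" "{}::unit set" _ "?G t"] neg
    unfolding neg_family_gram by auto
  have "continuous_on S (\<lambda>s. ?G s k l)" for k l
    unfolding hform_def by (intro continuous_intros cont)
  then have "\<forall>\<^sub>F s in at t within S. \<forall>kl\<in>{..<n} \<times> {..<n}. dist (?G s (fst kl) (snd kl)) (?G t (fst kl) (snd kl)) < m / 2"
    using t m(1) unfolding continuous_on_def by (intro eventually_ball_finite ballI tendstoD) auto
  then obtain \<delta> where \<delta>: "\<delta> > 0" "\<And>s k l. s \<in> S \<Longrightarrow> s \<noteq> t \<Longrightarrow> dist s t < \<delta> \<Longrightarrow> k < n \<Longrightarrow> l < n \<Longrightarrow>
      dist (?G s k l) (?G t k l) < m / 2"
    unfolding eventually_at by force
  have "neg_family I (H s) n w" if s: "s \<in> S" "\<bar>s - t\<bar> < \<delta>" for s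
    unfolding neg_family_gram
  proof (intro allI impI)
    fix c :: "nat \<Rightarrow> complex" assume c: "\<exists>k\<in>{..<n}. c k \<noteq> 0"
    have "norm (?G s k l - ?G t k l) \<le> m / 2" if "k < n" "l < n" for k l
      using \<delta>(2)[OF s(1) _ _ that] s(2) m(1) by (cases "s = t") (auto simp: dist_norm)
    then have "\<bar>Re (hform {..<n} (?G s) c c) - Re (hform {..<n} (?G t) c c)\<bar> \<le> m / 2 * (\<Sum>k<n. norm (c k))\<^sup>2"
      by (intro hform_diff_bound) auto
    moreover have "(\<Sum>k<n. norm (c k)) > 0"
      using c by (auto intro!: sum_pos2)
    then have "m / 2 * (\<Sum>k<n. norm (c k))\<^sup>2 < m * (\<Sum>k<n. norm (c k))\<^sup>2" using m(1) by simp
    ultimately show "Re (hform {..<n} (?G s) c c) < 0" using m(2)[of c] by linarith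
  qed
  with \<delta>(1) show ?thesis by blast
qed


lemma hform_hermitian:
  assumes "\<And>i j. i \<in> I \<Longrightarrow> j \<in> I \<Longrightarrow> H i j = cnj (H j i)"
  shows "hform I H y x = cnj (hform I H x y)"
proof -
  have "cnj (hform I H x y) = (\<Sum>j\<in>I. \<Sum>i\<in>I. x i * cnj (H i j) * cnj (y j))"
    unfolding hform_def by (subst sum.swap) (simp only: cnj_sum complex_cnj_mult complex_cnj_cnj)
  also have "\<dots> = hform I H y x"
    unfolding hform_def
  proof (intro sum.cong refl)
    fix i j assume "i \<in> I" "j \<in> I"
    show "x j * cnj (H j i) * cnj (y i) = cnj (y i) * H i j * x j"
      unfolding assms[OF \<open>i \<in> I\<close> \<open>j \<in> I\<close>] by simp
  qed
  finally show ?thesis ..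
qed

text \<open>
  A vector \<open>x\<close> that is orthogonal to a maximal negative definite family, and on which the form is
  not positive, lies in the kernel: otherwise some \<open>y\<close> pairs nontrivially with \<open>x\<close>, and \<open>y\<close> moved
  far enough along \<open>x\<close> is so negative that its interaction with the family cannot compensate for
  it.
\<close>

lemma neg_family_extend:
  assumes I: "finite I"
    and herm: "\<And>i j. i \<in> I \<Longrightarrow> j \<in> I \<Longrightarrow> H i j = cnj (H j i)"
    and neg: "neg_family I H n w"
    and orth: "\<And>k. k < n \<Longrightarrow> hform I H (w k) x = 0"
    and x: "Re (hform I H x x) \<le> 0" and y: "hform I H y x \<noteq> 0"
  shows "\<exists>w. neg_family I H (Suc n) w"
proof -
  let ?B = "hform I H"
  obtain m where m: "m > 0" "\<And>c. Re (hform {..<n} (\<lambda>k l. ?B (w k) (w l)) c c) \<le> - m * (\<Sum>k<n. norm (c k))\<^sup>2"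
    using definite_bound_on_constraints[of "{..<n}" "{}::unit set" _ "\<lambda>k l. ?B (w k) (w l)"] neg
    unfolding neg_family_gram by auto
  define b where "b = ?B y x"
  define C where "C = (\<Sum>k<n. norm (?B (w k) y))"
  have C: "C \<ge> 0" by (simp add: C_def sum_nonneg)
  obtain r :: real where r: "r > 0" "Re (?B y y) - 2 * r * (norm b)\<^sup>2 < - C\<^sup>2 / m"
  proof -
    have nb: "(norm b)\<^sup>2 > 0" using y by (simp add: b_def)
    define r where "r = max 1 ((Re (?B y y) + C\<^sup>2 / m + 1) / (2 * (norm b)\<^sup>2))"
    have "(Re (?B y y) + C\<^sup>2 / m + 1) / (2 * (norm b)\<^sup>2) \<le> r" by (simp add: r_def)
    then have "Re (?B y y) + C\<^sup>2 / m + 1 \<le> r * (2 * (norm b)\<^sup>2)" using nb by (simp add: pos_divide_le_eq)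
    then show ?thesis by (intro that[of r]) (auto simp: r_def)
  qed
  define v where "v i = y i - of_real r * cnj b * x i" for i
  have lin: "?B u v = ?B u y - of_real r * cnj b * ?B u x" for u
    unfolding hform_def v_def sum_distrib_left sum_subtractf[symmetric]
    by (intro sum.cong refl) (simp add: algebra_simps)
  have lin': "?B v u = ?B y u - of_real r * b * ?B x u" for u
    unfolding hform_def v_def sum_distrib_left sum_subtractf[symmetric]
    by (intro sum.cong refl) (simp add: algebra_simps)
  have xy: "?B x y = cnj b" unfolding b_def by (rule hform_hermitian[OF herm])
  have vv: "Re (?B v v) < - C\<^sup>2 / m"
  proof -
    have "?B v v = ?B y y - 2 * of_real r * (b * cnj b) + of_real r * of_real r * (b * cnj b) * ?B x x"
      unfolding lin lin' b_def[symmetric] xy by (simp add: algebra_simps)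
    then have "?B v v = ?B y y - of_real (2 * r * (norm b)\<^sup>2) + of_real (r\<^sup>2 * (norm b)\<^sup>2) * ?B x x"
      unfolding complex_norm_square[symmetric] by (simp add: power2_eq_square)
    then have "Re (?B v v) = Re (?B y y) - 2 * r * (norm b)\<^sup>2 + r\<^sup>2 * (norm b)\<^sup>2 * Re (?B x x)"
      by (simp only: minus_complex.simps plus_complex.simps times_complex.simps Re_complex_of_real Im_complex_of_real)
    moreover have "r\<^sup>2 * (norm b)\<^sup>2 * Re (?B x x) \<le> 0"
      using x by (simp add: mult_nonneg_nonpos)
    ultimately show ?thesis using r(2) by linarith
  qed
  have wv: "?B (w k) v = ?B (w k) y" if "k < n" for k using lin orth[OF that] by simp
  define w' where "w' = w(n := v)"
  have "neg_family I H (Suc n) w'"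
    unfolding neg_family_def
  proof (intro allI impI)
    fix c :: "nat \<Rightarrow> complex" assume c: "\<exists>k<Suc n. c k \<noteq> 0"
    define u where "u = lin_comb n c w"
    define s where "s = (\<Sum>k<n. norm (c k))"
    define g where "g = norm (c n)"
    have split: "lin_comb (Suc n) c w' = (\<lambda>i. u i + c n * v i)"
      unfolding lin_comb_def u_def w'_def by (auto simp: lin_comb_def fun_eq_iff intro!: sum.cong)
    have "?B (\<lambda>i. u i + c n * v i) (\<lambda>i. u i + c n * v i) =
       ?B u u + (c n * ?B u v + cnj (c n) * ?B v u) + cnj (c n) * c n * ?B v v"
      unfolding hform_def sum_distrib_left sum.distrib[symmetric]
      by (intro sum.cong refl) (simp add: algebra_simps)
    also have "?B v u = cnj (?B u v)" by (rule hform_hermitian[OF herm])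
    finally have "Re (?B (\<lambda>i. u i + c n * v i) (\<lambda>i. u i + c n * v i)) =
       Re (?B u u) + 2 * Re (c n * ?B u v) + g\<^sup>2 * Re (?B v v)"
      unfolding g_def cmod_power2 by (simp add: algebra_simps power2_eq_square)
    moreover have "Re (?B u u) \<le> - m * s\<^sup>2"
      using m(2)[of c] unfolding u_def hform_lin_comb s_def .
    moreover have "Re (c n * ?B u v) \<le> g * (s * C)"
    proof -
      have "?B u v = (\<Sum>k<n. cnj (c k) * ?B (w k) v)"
      proof -
        have "?B u v = (\<Sum>i\<in>I. \<Sum>j\<in>I. \<Sum>k<n. cnj (c k) * (cnj (w k i) * H i j * v j))"
          unfolding hform_def u_def lin_comb_def cnj_sum sum_distrib_right
          by (intro sum.cong refl) simp
        also have "\<dots> = (\<Sum>i\<in>I. \<Sum>k<n. \<Sum>j\<in>I. cnj (c k) * (cnj (w k i) * H i j * v j))"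
          by (intro sum.cong refl sum.swap)
        also have "\<dots> = (\<Sum>k<n. \<Sum>i\<in>I. \<Sum>j\<in>I. cnj (c k) * (cnj (w k i) * H i j * v j))"
          by (rule sum.swap)
        finally show ?thesis unfolding hform_def sum_distrib_left .
      qed
      then have "norm (?B u v) \<le> (\<Sum>k<n. norm (c k) * norm (?B (w k) y))"
        by (auto intro!: sum_norm_le simp: norm_mult wv)
      also have "\<dots> \<le> (\<Sum>k<n. norm (c k) * C)"
        unfolding C_def by (intro sum_mono mult_left_mono member_le_sum) auto
      also have "\<dots> = s * C" by (simp add: s_def sum_distrib_right)
      finally have "norm (c n * ?B u v) \<le> g * (s * C)"
        by (simp add: norm_mult g_def mult_left_mono)
      then show ?thesis using complex_Re_le_cmod order.trans by blast
    qed
    moreover have "- m * s\<^sup>2 + 2 * (g * (s * C)) + g\<^sup>2 * Re (?B v v) < 0"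
    proof (cases "g = 0")
      case True
      then have "\<exists>k<n. c k \<noteq> 0" using c by (auto simp: g_def less_Suc_eq)
      then have "s > 0" by (auto simp: s_def intro!: sum_pos2)
      with True m(1) show ?thesis by simp
    next
      case False
      then have "g\<^sup>2 * Re (?B v v) < g\<^sup>2 * (- C\<^sup>2 / m)" using vv by (intro mult_strict_left_mono) auto
      moreover have "- m * s\<^sup>2 + 2 * (g * (s * C)) + g\<^sup>2 * (- C\<^sup>2 / m) = - m * (s - g * C / m)\<^sup>2"
        using m(1) by (simp add: power2_eq_square field_simps)
      moreover have "- m * (s - g * C / m)\<^sup>2 \<le> 0" using m(1) by simp
      ultimately show ?thesis by linarith
    qed
    ultimately show "Re (hform I H (lin_comb (Suc n) c w') (lin_comb (Suc n) c w')) < 0"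
      unfolding split by linarith
  qed
  then show ?thesis by blast
qed

text \<open>
  On the common zeros of the \<open>n\<close> pairings with a maximal negative family and of \<open>d\<close> functionals
  that separate the kernel, the form is positive definite, and it stays so for nearby parameters.
  A negative definite family of more than \<open>n + d\<close> vectors would contain a nonzero combination in
  this subspace.
\<close>

lemma negative_index_jump:
  fixes H :: "real \<Rightarrow> 'i \<Rightarrow> 'i \<Rightarrow> complex"
  assumes I: "finite I" and t: "t \<in> S"
    and cont: "\<And>i j. i \<in> I \<Longrightarrow> j \<in> I \<Longrightarrow> continuous_on S (\<lambda>t. H t i j)"
    and herm: "\<And>i j. i \<in> I \<Longrightarrow> j \<in> I \<Longrightarrow> H t i j = cnj (H t j i)"
    and sep: "\<And>x. \<forall>i\<in>I. (\<Sum>j\<in>I. H t i j * x j) = 0 \<Longrightarrow>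
        \<forall>k<d. (\<Sum>i\<in>I. D k i * x i) = 0 \<Longrightarrow> \<forall>i\<in>I. x i = 0"
    and neg: "neg_family I (H t) n w" and max: "\<And>w. \<not> neg_family I (H t) (Suc n) w"
  shows "\<exists>\<delta>>0. \<forall>s\<in>S. \<bar>s - t\<bar> < \<delta> \<longrightarrow> (\<forall>w. \<not> neg_family I (H s) (Suc (n + d)) w)"
proof -
  let ?E = "{..<n} <+> {..<d}"
  define a where "a e i = (case e of Inl k \<Rightarrow> (\<Sum>j\<in>I. cnj (w k j) * H t j i) | Inr k \<Rightarrow> D k i)" for e i
  have aL: "(\<Sum>i\<in>I. a (Inl k) i * x i) = hform I (H t) (w k) x" for k x
    unfolding a_def hform_def sum.case sum_distrib_right by (rule sum.swap)
  have pos: "Re (hform I (\<lambda>i j. - H t i j) x x) < 0"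
    if x: "\<exists>i\<in>I. x i \<noteq> 0" "\<forall>e\<in>?E. (\<Sum>i\<in>I. a e i * x i) = 0" for x
  proof (rule ccontr)
    assume "\<not> ?thesis"
    then have "Re (hform I (H t) x x) \<le> 0" by (simp add: hform_def sum_negf)
    moreover have orth: "hform I (H t) (w k) x = 0" if "k < n" for k
      using x(2) that by (auto simp: aL[symmetric])
    ultimately have "hform I (H t) y x = 0" for y
      using neg_family_extend[OF I herm neg orth] max by blast
    then have y0: "(\<Sum>i\<in>I. cnj (y i) * (\<Sum>j\<in>I. H t i j * x j)) = 0" for y
      by (simp add: hform_def sum_distrib_left mult.assoc)
    have "(\<Sum>j\<in>I. H t i j * x j) = 0" if "i \<in> I" for i
    proof -
      have "(\<Sum>i'\<in>I. cnj (if i' = i then 1 else 0) * (\<Sum>j\<in>I. H t i' j * x j)) = (\<Sum>i'\<in>I. if i' = i then (\<Sum>j\<in>I. H t i j * x j) else 0)"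
        by (rule sum.cong) auto
      also have "\<dots> = (\<Sum>j\<in>I. H t i j * x j)" using I that by simp
      finally show ?thesis using y0[of "\<lambda>i'. if i' = i then 1 else 0"] by simp
    qed
    moreover have "\<forall>k<d. (\<Sum>i\<in>I. D k i * x i) = 0"
      using x(2) by (force simp: a_def)
    ultimately show False using sep[of x] x(1) by blast
  qed
  obtain m where m: "m > 0"
    "\<And>x. \<forall>e\<in>?E. (\<Sum>i\<in>I. a e i * x i) = 0 \<Longrightarrow> Re (hform I (\<lambda>i j. - H t i j) x x) \<le> - m * (\<Sum>i\<in>I. norm (x i))\<^sup>2"
    using definite_bound_on_constraints[OF I pos] by blast
  have "\<forall>\<^sub>F s in at t within S. \<forall>ij\<in>I \<times> I. dist (H s (fst ij) (snd ij)) (H t (fst ij) (snd ij)) < m"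
    using t m(1) cont I unfolding continuous_on_def by (intro eventually_ball_finite ballI tendstoD) auto
  then obtain \<delta> where \<delta>: "\<delta> > 0" "\<And>s i j. s \<in> S \<Longrightarrow> s \<noteq> t \<Longrightarrow> dist s t < \<delta> \<Longrightarrow> i \<in> I \<Longrightarrow> j \<in> I \<Longrightarrow>
      dist (H s i j) (H t i j) < m"
    unfolding eventually_at by force
  have False if s: "s \<in> S" "\<bar>s - t\<bar> < \<delta>" and w': "neg_family I (H s) (Suc (n + d)) w'" for s w'
  proof -
    define N where "N = Suc (n + d)"
    have w'N: "neg_family I (H s) N w'" using w' by (simp add: N_def)
    have cd: "card ?E < card {..<N}" by (simp add: card_Plus N_def)
    have fin: "finite ?E" "finite {..<N}" by simp_all
    obtain c where c: "\<exists>k\<in>{..<N}. c k \<noteq> 0"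
      "\<forall>e\<in>?E. (\<Sum>k<N. (\<Sum>i\<in>I. a e i * w' k i) * c k) = 0"
      using underdetermined_system[OF fin cd, of "\<lambda>e k. \<Sum>i\<in>I. a e i * w' k i"] by blast
    define x where "x = lin_comb N c w'"
    have "(\<Sum>i\<in>I. a e i * x i) = 0" if "e \<in> ?E" for e
    proof -
      have "(\<Sum>i\<in>I. a e i * x i) = (\<Sum>i\<in>I. \<Sum>k<N. a e i * w' k i * c k)"
        unfolding x_def lin_comb_def sum_distrib_left by (intro sum.cong refl) (simp only: mult_ac)
      also have "\<dots> = (\<Sum>k<N. (\<Sum>i\<in>I. a e i * w' k i) * c k)"
        unfolding sum_distrib_right by (rule sum.swap)
      finally show ?thesis using c(2) that by simp
    qed
    then have "Re (hform I (\<lambda>i j. - H t i j) x x) \<le> - m * (\<Sum>i\<in>I. norm (x i))\<^sup>2" by (intro m(2) ballI)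
    then have "Re (hform I (H t) x x) \<ge> m * (\<Sum>i\<in>I. norm (x i))\<^sup>2" by (simp add: hform_def sum_negf)
    moreover have "norm (H s i j - H t i j) \<le> m" if "i \<in> I" "j \<in> I" for i j
      using \<delta>(2)[OF s(1) _ _ that] s(2) m(1) by (cases "s = t") (auto simp: dist_norm)
    then have "\<bar>Re (hform I (H s) x x) - Re (hform I (H t) x x)\<bar> \<le> m * (\<Sum>i\<in>I. norm (x i))\<^sup>2"
      by (rule hform_diff_bound[OF I])
    ultimately have "Re (hform I (H s) x x) \<ge> 0" by linarith
    moreover have "Re (hform I (H s) x x) < 0" using w'N c(1) unfolding neg_family_def x_def by blast
    ultimately show False by simp
  qed
  with \<delta>(1) show ?thesis by blast
qed


text \<open>
  The negative index is lower semicontinuous, so it grows only just after a parameter with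
  nontrivial kernel, and by \<open>negative_index_jump\<close> by at most the dimension of that kernel. It is
  \<open>0\<close> at the start of the path, so at the end it is bounded by the sum of the kernel dimensions
  met on the way. Here \<open>d t\<close> bounds the dimension of the kernel at \<open>t\<close> because that many
  functionals \<open>D t k\<close> separate its points.
\<close>

theorem spectral_flow_bound:
  fixes H :: "real \<Rightarrow> 'i \<Rightarrow> 'i \<Rightarrow> complex" and d :: "real \<Rightarrow> nat"
  assumes I: "finite I" and T: "0 \<le> T"
    and cont: "\<And>i j. i \<in> I \<Longrightarrow> j \<in> I \<Longrightarrow> continuous_on {0..T} (\<lambda>t. H t i j)"
    and herm: "\<And>t i j. t \<in> {0..T} \<Longrightarrow> i \<in> I \<Longrightarrow> j \<in> I \<Longrightarrow> H t i j = cnj (H t j i)"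
    and init: "\<And>x. Re (hform I (H 0) x x) \<ge> 0"
    and sep: "\<And>t x. t \<in> {0..<T} \<Longrightarrow> \<forall>i\<in>I. (\<Sum>j\<in>I. H t i j * x j) = 0 \<Longrightarrow>
        \<forall>k<d t. (\<Sum>i\<in>I. D t k i * x i) = 0 \<Longrightarrow> \<forall>i\<in>I. x i = 0"
    and neg: "neg_family I (H T) n w"
  shows "\<exists>S. finite S \<and> S \<subseteq> {0..<T} \<and> n \<le> sum d S"
proof (rule ccontr)
  assume contr: "\<not> ?thesis"
  have small: "sum d S < n" if "finite S" "S \<subseteq> {0..<T}" for S
  proof (rule ccontr)
    assume "\<not> sum d S < n"
    then have "n \<le> sum d S" by simp
    with that contr show False by blast
  qed
  define Z where "Z = {t \<in> {0..<T}. d t > 0}"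
  have Z: "finite Z"
  proof (rule ccontr)
    assume "infinite Z"
    then obtain S where S: "S \<subseteq> Z" "finite S" "card S = n" by (meson infinite_arbitrarily_large)
    then have "n \<le> sum d S" using sum_mono[of S "\<lambda>_. 1" d] by (force simp: Z_def)
    moreover have "sum d S < n" using S by (intro small) (auto simp: Z_def)
    ultimately show False by simp
  qed
  define g where "g t = sum d (Z \<inter> {..<t})" for t
  have g_mono: "g s \<le> g t" if "s \<le> t" for s t
    unfolding g_def using Z that by (intro sum_mono2) auto
  have g_jump: "g t + d t \<le> g s" if "t < s" "t \<in> {0..<T}" for s t
  proof (cases "d t = 0")
    case True
    then show ?thesis using g_mono[of t s] that by simp
  next
    case False
    then have "t \<in> Z" using that by (simp add: Z_def)
    then have "sum d (insert t (Z \<inter> {..<t})) \<le> g s"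
      unfolding g_def using Z that by (intro sum_mono2) auto
    then show ?thesis using Z by (simp add: g_def)
  qed
  \<comment> \<open>If the index ever exceeds the sum \<open>g\<close> of the kernel dimensions passed before, consider
    the infimum of the parameters where it does. By openness the infimum is not in \<open>N\<close>, and
    by the bound on jumps it is not a limit of larger elements.\<close>
  define N where "N = {s \<in> {0..T}. \<exists>w. neg_family I (H s) (Suc (g s)) w}"
  have "N \<noteq> {}"
  proof -
    have "g T < n" unfolding g_def using Z by (intro small) (auto simp: Z_def)
    then have "T \<in> N" using neg_family_mono[OF neg, of "Suc (g T)"] T by (auto simp: N_def)
    then show ?thesis by blast
  qed
  have bdd: "bdd_below N" by (rule bdd_belowI[of _ 0]) (simp add: N_def)
  define \<tau> where "\<tau> = Inf N"
  have "0 \<le> \<tau>" unfolding \<tau>_def by (rule cInf_greatest[OF \<open>N \<noteq> {}\<close>]) (simp add: N_def)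
  moreover obtain s where "s \<in> N" using \<open>N \<noteq> {}\<close> by blast
  then have "\<tau> \<le> s" "s \<le> T" unfolding \<tau>_def by (auto intro: cInf_lower[OF _ bdd]) (simp add: N_def)
  ultimately have \<tau>: "\<tau> \<in> {0..T}" by simp
  have below: "s \<notin> N" if "s < \<tau>" for s
    using cInf_lower[OF _ bdd, of s] that by (auto simp: \<tau>_def)
  show False
  proof (cases "\<tau> \<in> N")
    case True
    then obtain w where w: "neg_family I (H \<tau>) (Suc (g \<tau>)) w" by (auto simp: N_def)
    have "\<tau> \<noteq> 0"
    proof
      assume "\<tau> = 0"
      have "Re (hform I (H \<tau>) (lin_comb (Suc (g \<tau>)) (\<lambda>_. 1) w) (lin_comb (Suc (g \<tau>)) (\<lambda>_. 1) w)) < 0"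
        by (rule w[unfolded neg_family_def, rule_format]) (rule exI[of _ 0], simp)
      with init \<open>\<tau> = 0\<close> show False by (simp add: not_less[symmetric])
    qed
    obtain \<delta> where \<delta>: "\<delta> > 0" "\<And>s. s \<in> {0..T} \<Longrightarrow> \<bar>s - \<tau>\<bar> < \<delta> \<Longrightarrow> neg_family I (H s) (Suc (g \<tau>)) w"
      using neg_family_open[OF I \<tau> cont w] by blast
    define s where "s = max 0 (\<tau> - \<delta> / 2)"
    have s: "s \<in> {0..T}" "\<bar>s - \<tau>\<bar> < \<delta>" "s < \<tau>"
      using \<delta>(1) \<tau> \<open>\<tau> \<noteq> 0\<close> by (auto simp: s_def)
    then have "neg_family I (H s) (Suc (g s)) w"
      using neg_family_mono[OF \<delta>(2)[OF s(1,2)]] g_mono[of s \<tau>] by simp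
    then have "s \<in> N" using s(1) by (auto simp: N_def)
    then show False using below[OF s(3)] by simp
  next
    case False
    define P where "P k \<longleftrightarrow> (\<exists>w. neg_family I (H \<tau>) k w)" for k
    have "P 0" by (simp add: P_def neg_family_def)
    have "\<not> P (Suc (g \<tau>))" using False \<tau> by (auto simp: P_def N_def)
    then obtain k where k: "k < Suc (g \<tau>)" "P k" "\<not> P (Suc k)"
    proof -
      define m where "m = (LEAST k. \<not> P k)"
      have m: "\<not> P m" "m \<le> Suc (g \<tau>)"
        using LeastI[of "\<lambda>k. \<not> P k", OF \<open>\<not> P (Suc (g \<tau>))\<close>] Least_le[of "\<lambda>k. \<not> P k", OF \<open>\<not> P (Suc (g \<tau>))\<close>]
        by (auto simp: m_def)
      with \<open>P 0\<close> obtain k where k: "m = Suc k" by (cases m) auto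
      have "P k" using not_less_Least[of k "\<lambda>k. \<not> P k"] k by (auto simp: m_def)
      with m k show ?thesis by (intro that[of k]) auto
    qed
    then obtain w where w: "neg_family I (H \<tau>) k w" "\<And>w. \<not> neg_family I (H \<tau>) (Suc k) w"
      by (auto simp: P_def)
    have "\<tau> < T"
    proof (rule ccontr)
      assume "\<not> \<tau> < T"
      then have "N \<subseteq> {\<tau>}" using below \<tau> by (force simp: N_def)
      with \<open>N \<noteq> {}\<close> False show False by blast
    qed
    with \<tau> have \<tau>': "\<tau> \<in> {0..<T}" by simp
    obtain \<delta> where \<delta>: "\<delta> > 0" "\<And>s w. s \<in> {0..T} \<Longrightarrow> \<bar>s - \<tau>\<bar> < \<delta> \<Longrightarrow> \<not> neg_family I (H s) (Suc (k + d \<tau>)) w"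
      using negative_index_jump[where H = H and d = "d \<tau>" and D = "D \<tau>", OF I \<tau> cont herm[OF \<tau>] sep[OF \<tau>'] w] by metis
    obtain s where s: "s \<in> N" "s < \<tau> + \<delta>"
      using cInf_lessD[OF \<open>N \<noteq> {}\<close>, of "\<tau> + \<delta>"] \<delta>(1) by (auto simp: \<tau>_def)
    have "s > \<tau>" using below[of s] s(1) False by (cases s \<tau> rule: linorder_cases) auto
    from s(1) obtain w' where w': "s \<in> {0..T}" "neg_family I (H s) (Suc (g s)) w'" by (auto simp: N_def)
    have "Suc (k + d \<tau>) \<le> Suc (g s)" using g_jump[OF \<open>s > \<tau>\<close> \<tau>'] k(1) by simp
    then have "neg_family I (H s) (Suc (k + d \<tau>)) w'" by (rule neg_family_mono[OF w'(2)])
    moreover have "\<bar>s - \<tau>\<bar> < \<delta>" using s(2) \<open>s > \<tau>\<close> by simp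
    ultimately show False using \<delta>(2)[OF w'(1)] by blast
  qed
qed

section \<open>Eigenfunctions as solutions of a first order system\<close>

text \<open>
  The arguments are the values at the source ends and at the target ends of the edges. For \<open>a = b\<close>
  this says that the edge vector is a cycle, or equivalently that the 1-form with these constant
  coefficients satisfies the Kirchhoff condition.
\<close>

definition flow_balanced :: "('v, 'e::finite) qgraph \<Rightarrow> ('e \<Rightarrow> 'a::ab_group_add) \<Rightarrow> ('e \<Rightarrow> 'a) \<Rightarrow> bool" where
  "flow_balanced G a b \<longleftrightarrow> (\<forall>v\<in>verts G. (\<Sum>e\<in>{e \<in> edges G. tgt G e = v}. b e) = (\<Sum>e\<in>{e \<in> edges G. src G e = v}. a e))"

text \<open>
  The second component is the covariant derivative \<open>D = f' + 2 \<pi> i c f\<close>. As a first order system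
  for \<open>(f, D)\<close> the equation \<open>\<Delta> f = z f\<close> has classical derivatives everywhere, and as the
  coefficients \<open>c\<close> are balanced, the boundary conditions become continuity of \<open>f\<close> and balance of
  \<open>D\<close>.
\<close>

definition bloch_pair :: "('v, 'e::finite) qgraph \<Rightarrow> real ^ 'e \<Rightarrow> complex \<Rightarrow>
    ('e \<Rightarrow> real \<Rightarrow> complex) \<Rightarrow> ('e \<Rightarrow> real \<Rightarrow> complex) \<Rightarrow> bool" where
  "bloch_pair G c z f D \<longleftrightarrow> supported G f \<and>
     (\<forall>e\<in>edges G. \<forall>x\<in>{0..len G e}.
        (f e has_vector_derivative D e x - 2 * of_real pi * \<i> * f e x * of_real (c $ e)) (at x within {0..len G e}) \<and>
        (D e has_vector_derivative - z * f e x - 2 * of_real pi * \<i> * D e x * of_real (c $ e)) (at x within {0..len G e})) \<and>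
     (\<exists>val. \<forall>e\<in>edges G. f e 0 = val (src G e) \<and> f e (len G e) = val (tgt G e)) \<and>
     flow_balanced G (\<lambda>e. D e 0) (\<lambda>e. D e (len G e))"

lemma quantum_graphD:
  assumes "quantum_graph G" "e \<in> edges G"
  shows "src G e \<in> verts G" "tgt G e \<in> verts G" "0 < len G e" "0 \<le> len G e"
  using assms by (auto simp: quantum_graph_def)

text \<open>
  Grouped by vertices, each vertex contributes its value of \<open>\<phi>\<close> times its net flow.
\<close>

lemma flow_balanced_sum_potential:
  fixes \<phi> :: "'v \<Rightarrow> 'a::comm_ring"
  assumes G: "quantum_graph G" and b: "flow_balanced G a b"
  shows "(\<Sum>e\<in>edges G. b e * \<phi> (tgt G e) - a e * \<phi> (src G e)) = 0"
proof -
  have fin: "finite (verts G)" "finite (edges G)" using G by (auto simp: quantum_graph_def)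
  have 1: "(\<Sum>e\<in>edges G. g e * \<phi> (p e)) = (\<Sum>v\<in>verts G. (\<Sum>e\<in>{e \<in> edges G. p e = v}. g e) * \<phi> v)"
    if "\<And>e. e \<in> edges G \<Longrightarrow> p e \<in> verts G" for g p
  proof -
    have "(\<Sum>e\<in>edges G. g e * \<phi> (p e)) = (\<Sum>v\<in>verts G. \<Sum>e\<in>{e \<in> edges G. p e = v}. g e * \<phi> (p e))"
      using fin that by (intro sum.group[symmetric]) auto
    also have "\<dots> = (\<Sum>v\<in>verts G. (\<Sum>e\<in>{e \<in> edges G. p e = v}. g e) * \<phi> v)"
      unfolding sum_distrib_right by (intro sum.cong) auto
    finally show ?thesis .
  qed
  show ?thesis
    unfolding sum_subtractf using 1[of "tgt G" b] 1[of "src G" a] b quantum_graphD[OF G]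
    by (simp add: flow_balanced_def)
qed

lemma constant_form_in_harmonic_iff:
  assumes G: "quantum_graph G"
  shows "constant_form G c \<in> harmonic_forms G \<longleftrightarrow> flow_balanced G (\<lambda>e. c $ e) (\<lambda>e. c $ e)"
proof -
  have [simp]: "on_graph G e 0" "on_graph G e (len G e)" if "e \<in> edges G" for e
    using quantum_graphD[OF G that] that by (auto simp: on_graph_def)
  have "smooth_interval (len G e) (constant_form G c e)" if "e \<in> edges G" for e
    unfolding smooth_interval_def
  proof (intro exI[of _ "\<lambda>n. if n = 0 then constant_form G c e else (\<lambda>_. 0)"] conjI allI ballI)
    fix n x assume "x \<in> {0..len G e}"
    then show "((if n = 0 then constant_form G c e else (\<lambda>_. 0)) has_vector_derivative
          (if Suc n = 0 then constant_form G c e else (\<lambda>_. 0)) x) (at x within {0..len G e})"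
      using that by (auto intro!: has_vector_derivative_transform[OF _ _ has_vector_derivative_const[of "c $ e"]]
          simp: constant_form_def on_graph_def)
  qed simp
  moreover have "supported G (constant_form G c)" by (simp add: supported_def constant_form_def)
  moreover have "\<forall>e\<in>edges G. \<exists>k. \<forall>x\<in>{0..len G e}. constant_form G c e x = k"
    by (auto simp: constant_form_def on_graph_def)
  moreover have "normal_sum G (constant_form G c) v = (\<Sum>e\<in>{e \<in> edges G. tgt G e = v}. c $ e) - (\<Sum>e\<in>{e \<in> edges G. src G e = v}. c $ e)" for v
    unfolding normal_sum_def constant_form_def by (simp add: sum_negf)
  ultimately show ?thesis
    by (auto simp: harmonic_forms_def one_forms_def flow_balanced_def)
qed

lemma harmonic_coords_eq_H1_real:
  assumes "quantum_graph G" shows "harmonic_coords G = H1_real G"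
  unfolding harmonic_coords_def H1_real_def constant_form_in_harmonic_iff[OF assms] flow_balanced_def by blast

lemma H1_realD: "c \<in> H1_real G \<Longrightarrow> flow_balanced G (\<lambda>e. c $ e) (\<lambda>e. c $ e)"
  by (simp add: H1_real_def flow_balanced_def)

lemma square_integrable_imp_integrable:
  assumes "square_integrable L h" shows "integrable (lebesgue_on {0..L}) h"
proof -
  have m: "h \<in> borel_measurable (lebesgue_on {0..L})" and i: "integrable (lebesgue_on {0..L}) (\<lambda>x. (cmod (h x))\<^sup>2)"
    using assms by (auto simp: square_integrable_def)
  have one: "integrable (lebesgue_on {0..L}) (\<lambda>x. 1::real)" by (intro continuous_imp_integrable_real continuous_intros)
  show ?thesis
  proof (rule Bochner_Integration.integrable_bound[OF Bochner_Integration.integrable_add[OF one i] m])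
    have "cmod w \<le> 1 + (cmod w)\<^sup>2" for w
      using sum_power2_ge_zero[of "cmod w - 1/2" 0] by (simp add: power2_eq_square algebra_simps)
    then show "AE x in lebesgue_on {0..L}. norm (h x) \<le> norm (1 + (cmod (h x))\<^sup>2)" by auto
  qed
qed

text \<open>
  A priori \<open>f'\<close> has only a square integrable density \<open>h\<close>. Almost everywhere \<open>f'\<close> is differentiable
  with derivative \<open>h\<close>, so there the eigenvalue equation expresses \<open>h\<close> by the continuous function
  \<open>\<phi>\<close>; hence \<open>f'\<close> is an indefinite integral of \<open>\<phi>\<close> and continuously differentiable.
\<close>

lemma bloch_pair_if_eigenfunction:
  fixes G :: "('v, 'e::finite) qgraph"
  assumes G: "quantum_graph G" and c: "c \<in> H1_real G"
    and f: "f \<in> eigenspace G (constant_form G c) z"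
  shows "bloch_pair G c z f (magnetic_deriv G (constant_form G c) f)"
proof -
  define a where "a = constant_form G c"
  define D where "D = magnetic_deriv G a f"
  have f': "supported G f" "continuous_graph G f" "\<And>e. e \<in> edges G \<Longrightarrow> sobolev2 (len G e) (f e)" "kirchhoff G f"
    and eq: "\<And>e. e \<in> edges G \<Longrightarrow> AE x in lebesgue_on {0..len G e}. shifted_laplacian G a z f e x = 0"
    using f by (auto simp: eigenspace_def laplacian_domain_def a_def L2_eq_def)
  have a: "a e x = c $ e" if "e \<in> edges G" "x \<in> {0..len G e}" for e x
    using that by (simp add: a_def constant_form_def on_graph_def)
  have edge: "(\<forall>x\<in>{0..len G e}. (f e has_vector_derivative D e x - 2 * of_real pi * \<i> * f e x * of_real (c $ e)) (at x within {0..len G e})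
     \<and> (D e has_vector_derivative - z * f e x - 2 * of_real pi * \<i> * D e x * of_real (c $ e)) (at x within {0..len G e}))"
    if e: "e \<in> edges G" for e
  proof -
    define L where "L = len G e"
    define \<omega> where "\<omega> = 2 * complex_of_real pi * \<i> * of_real (c $ e)"
    have L: "0 < L" using quantum_graphD[OF G e] by (simp add: L_def)
    obtain g h where g: "\<And>x. x \<in> {0..L} \<Longrightarrow> (f e has_vector_derivative g x) (at x within {0..L})"
      and h: "square_integrable L h"
      and gh: "\<And>x. x \<in> {0..L} \<Longrightarrow> g x = g 0 + (LINT t|lebesgue_on {0..x}. h t)"
      using f'(3)[OF e] unfolding sobolev2_def L_def by blast
    have Dg: "D e x = g x + \<omega> * f e x" if "x \<in> {0..L}" for x
      using vector_derivative_within_closed_interval[OF L that g[OF that]] that e a[OF e]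
      by (simp add: D_def magnetic_deriv_def edge_deriv_def on_graph_def L_def \<omega>_def algebra_simps)
    have hint: "integrable (lebesgue_on {0..L}) h" by (rule square_integrable_imp_integrable[OF h])
    have hHK: "h integrable_on {0..L}"
      using has_integral_integral_lebesgue_on[OF hint] by auto
    have gi: "g x = g 0 + integral {0..x} h" if "x \<in> {0..L}" for x
    proof -
      have "integrable (lebesgue_on {0..x}) h"
        using that by (intro integrable_subinterval[OF hint]) auto
      then show ?thesis using gh[OF that] lebesgue_integral_eq_integral[of "{0..x}" h] by simp
    qed
    define \<phi> where "\<phi> x = - z * f e x - \<omega> * D e x - \<omega> * g x" for x
    obtain N where N: "negligible N"
      "\<And>x. x \<in> {0..L} - N \<Longrightarrow> ((\<lambda>x. integral {0..x} h) has_vector_derivative h x) (at x within {0..L})"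
      using indefinite_integral_has_derivative_ae[OF hHK] by blast
    obtain M where M: "negligible M" "\<And>x. x \<in> {0..L} - M \<Longrightarrow> shifted_laplacian G a z f e x = 0"
    proof -
      have "AE x in lebesgue. x \<in> {0..L} \<longrightarrow> shifted_laplacian G a z f e x = 0"
        using eq[OF e] by (simp add: AE_restrict_space_iff L_def)
      then obtain M where "{x \<in> space lebesgue. \<not> (x \<in> {0..L} \<longrightarrow> shifted_laplacian G a z f e x = 0)} \<subseteq> M" "M \<in> null_sets lebesgue"
        by (rule AE_E) (simp add: null_sets_def)
      then show ?thesis by (intro that[of M]) (auto simp: negligible_iff_null_sets)
    qed
    have h\<phi>: "h x = \<phi> x" if x: "x \<in> {0..L} - (N \<union> M)" for x
    proof -
      have x0: "x \<in> {0..L}" using x by simp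
      have "((\<lambda>y. g 0 + integral {0..y} h) has_vector_derivative 0 + h x) (at x within {0..L})"
        using x by (intro has_vector_derivative_add has_vector_derivative_const N(2)) auto
      then have "(g has_vector_derivative h x) (at x within {0..L})"
        unfolding add_0_left by (rule has_vector_derivative_transform[OF x0, rotated]) (erule gi)
      then have "((\<lambda>y. g y + \<omega> * f e y) has_vector_derivative h x + \<omega> * g x) (at x within {0..L})"
        by (intro has_vector_derivative_add has_vector_derivative_mult_right g x0)
      then have "(D e has_vector_derivative h x + \<omega> * g x) (at x within {0..L})"
        by (rule has_vector_derivative_transform[OF x0, rotated]) (erule Dg)
      then have "edge_deriv G D e x = h x + \<omega> * g x"
        using vector_derivative_within_closed_interval[OF L x0] x0 e by (simp add: edge_deriv_def on_graph_def L_def)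
      then have "magnetic_laplacian G a f e x = - (h x + \<omega> * g x + \<omega> * D e x)"
        using a[OF e] x0 unfolding magnetic_laplacian_def D_def[symmetric]
        by (subst magnetic_deriv_def) (simp add: L_def \<omega>_def algebra_simps)
      moreover have "shifted_laplacian G a z f e x = 0" using x by (intro M(2)) auto
      ultimately have "- (h x + \<omega> * g x + \<omega> * D e x) - z * f e x = 0" by (simp add: shifted_laplacian_def)
      then show ?thesis unfolding \<phi>_def by algebra
    qed
    have cf: "continuous_on {0..L} (f e)"
      by (rule continuous_on_vector_derivative[OF g])
    have cg: "continuous_on {0..L} g"
      using indefinite_integral_continuous_1[OF hHK] gi
      by (subst continuous_on_cong[OF refl gi]) (auto intro!: continuous_intros)
    have "continuous_on {0..L} (D e)"
      by (subst continuous_on_cong[OF refl Dg]) (auto intro!: continuous_intros cf cg)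
    then have c\<phi>: "continuous_on {0..L} \<phi>" unfolding \<phi>_def by (intro continuous_intros cf cg)
    have gi': "g x = g 0 + integral {0..x} \<phi>" if "x \<in> {0..L}" for x
    proof -
      have "integral {0..x} h = integral {0..x} \<phi>"
        by (rule integral_spike[of "N \<union> M"]) (use N M h\<phi> that in auto)
      then show ?thesis using gi[OF that] by simp
    qed
    have gd: "(g has_vector_derivative \<phi> x) (at x within {0..L})" if "x \<in> {0..L}" for x
    proof -
      have "((\<lambda>y. g 0 + integral {0..y} \<phi>) has_vector_derivative 0 + \<phi> x) (at x within {0..L})"
        by (intro has_vector_derivative_add has_vector_derivative_const integral_has_vector_derivative c\<phi> that)
      then show ?thesis unfolding add_0_left by (rule has_vector_derivative_transform[OF that, rotated]) (erule gi')
    qed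
    show ?thesis
    proof (intro ballI conjI)
      fix x assume "x \<in> {0..len G e}"
      then have x: "x \<in> {0..L}" by (simp add: L_def)
      show "(f e has_vector_derivative D e x - 2 * of_real pi * \<i> * f e x * of_real (c $ e)) (at x within {0..len G e})"
        using g[OF x] Dg[OF x] by (simp add: L_def \<omega>_def algebra_simps)
      have "((\<lambda>y. g y + \<omega> * f e y) has_vector_derivative \<phi> x + \<omega> * g x) (at x within {0..L})"
        by (intro has_vector_derivative_add has_vector_derivative_mult_right g gd x)
      then have "(D e has_vector_derivative \<phi> x + \<omega> * g x) (at x within {0..L})"
        by (rule has_vector_derivative_transform[OF x, rotated]) (erule Dg)
      then show "(D e has_vector_derivative - z * f e x - 2 * of_real pi * \<i> * D e x * of_real (c $ e)) (at x within {0..len G e})"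
        by (simp add: L_def \<omega>_def \<phi>_def algebra_simps)
    qed
  qed
  obtain val where val: "\<And>e. e \<in> edges G \<Longrightarrow> f e 0 = val (src G e) \<and> f e (len G e) = val (tgt G e)"
    using f'(2) unfolding continuous_graph_def by blast
  have "flow_balanced G (\<lambda>e. D e 0) (\<lambda>e. D e (len G e))"
    unfolding flow_balanced_def
  proof
    fix v assume v: "v \<in> verts G"
    let ?k = "2 * complex_of_real pi * \<i> * val v"
    have on: "0 \<in> {0..len G e}" "len G e \<in> {0..len G e}" if "e \<in> edges G" for e
      using quantum_graphD[OF G that] by auto
    have end_simps: "D e 0 = edge_deriv G f e 0 + 2 * complex_of_real pi * \<i> * val (src G e) * of_real (c $ e)"
      "D e (len G e) = edge_deriv G f e (len G e) + 2 * complex_of_real pi * \<i> * val (tgt G e) * of_real (c $ e)" if "e \<in> edges G" for e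
      using val[OF that] a[OF that on(1)[OF that]] a[OF that on(2)[OF that]] by (simp_all add: D_def magnetic_deriv_def)
    have "(\<Sum>e\<in>{e \<in> edges G. tgt G e = v}. D e (len G e)) = (\<Sum>e\<in>{e \<in> edges G. tgt G e = v}. edge_deriv G f e (len G e)) + ?k * of_real (\<Sum>e\<in>{e \<in> edges G. tgt G e = v}. c $ e)"
      unfolding of_real_sum sum_distrib_left sum.distrib[symmetric]
      by (intro sum.cong) (auto simp: end_simps)
    moreover have "(\<Sum>e\<in>{e \<in> edges G. src G e = v}. D e 0) = (\<Sum>e\<in>{e \<in> edges G. src G e = v}. edge_deriv G f e 0) + ?k * of_real (\<Sum>e\<in>{e \<in> edges G. src G e = v}. c $ e)"
      unfolding of_real_sum sum_distrib_left sum.distrib[symmetric]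
      by (intro sum.cong) (auto simp: end_simps)
    moreover have "(\<Sum>e\<in>{e \<in> edges G. tgt G e = v}. edge_deriv G f e (len G e)) = (\<Sum>e\<in>{e \<in> edges G. src G e = v}. edge_deriv G f e 0)"
      using f'(4) v by (simp add: kirchhoff_def normal_sum_def sum_negf)
    ultimately show "(\<Sum>e\<in>{e \<in> edges G. tgt G e = v}. D e (len G e)) = (\<Sum>e\<in>{e \<in> edges G. src G e = v}. D e 0)"
      using H1_realD[OF c] v unfolding flow_balanced_def by simp
  qed
  then show ?thesis
    unfolding bloch_pair_def a_def[symmetric] D_def[symmetric] using f'(1) edge val by blast
qed

lemma eigenfunction_if_bloch_pair:
  fixes G :: "('v, 'e::finite) qgraph"
  assumes G: "quantum_graph G" and c: "c \<in> H1_real G" and bp: "bloch_pair G c z f D"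
  shows "f \<in> eigenspace G (constant_form G c) z"
proof -
  define a where "a = constant_form G c"
  have a: "a e x = c $ e" if "e \<in> edges G" "x \<in> {0..len G e}" for e x
    using that by (simp add: a_def constant_form_def on_graph_def)
  have sup: "supported G f" and bal: "flow_balanced G (\<lambda>e. D e 0) (\<lambda>e. D e (len G e))"
    using bp by (auto simp: bloch_pair_def)
  obtain val where val: "\<And>e. e \<in> edges G \<Longrightarrow> f e 0 = val (src G e) \<and> f e (len G e) = val (tgt G e)"
    using bp unfolding bloch_pair_def by blast
  define \<omega> where "\<omega> e = 2 * complex_of_real pi * \<i> * of_real (c $ e)" for e
  define g where "g e x = D e x - \<omega> e * f e x" for e x
  have fd: "(f e has_vector_derivative g e x) (at x within {0..len G e})"
    and Dd: "(D e has_vector_derivative - z * f e x - \<omega> e * D e x) (at x within {0..len G e})"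
    if "e \<in> edges G" "x \<in> {0..len G e}" for e x
    using bp that unfolding bloch_pair_def by (simp_all add: g_def \<omega>_def algebra_simps)
  define h where "h e x = - z * f e x - \<omega> e * D e x - \<omega> e * g e x" for e x
  have gd: "(g e has_vector_derivative h e x) (at x within {0..len G e})" if "e \<in> edges G" "x \<in> {0..len G e}" for e x
  proof -
    have "((\<lambda>y. D e y - \<omega> e * f e y) has_vector_derivative (- z * f e x - \<omega> e * D e x) - \<omega> e * g e x) (at x within {0..len G e})"
      by (intro has_vector_derivative_diff has_vector_derivative_mult_right fd Dd that)
    moreover have "(\<lambda>y. D e y - \<omega> e * f e y) = g e" by (simp add: g_def fun_eq_iff)
    ultimately show ?thesis by (simp add: h_def)
  qed
  have cont: "continuous_on {0..len G e} (f e)" "continuous_on {0..len G e} (D e)" "continuous_on {0..len G e} (g e)" if "e \<in> edges G" for e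
    using continuous_on_vector_derivative[OF fd[OF that]] continuous_on_vector_derivative[OF Dd[OF that]]
      continuous_on_vector_derivative[OF gd[OF that]] by blast+
  have ch: "continuous_on {0..len G e} (h e)" if "e \<in> edges G" for e
    unfolding h_def by (intro continuous_intros cont that)
  have ed: "edge_deriv G f e x = g e x" if "e \<in> edges G" "x \<in> {0..len G e}" for e x
    using vector_derivative_within_closed_interval[OF quantum_graphD(3)[OF G that(1)] that(2) fd[OF that]] that
    by (simp add: edge_deriv_def on_graph_def)
  have md: "magnetic_deriv G a f e x = D e x" if "e \<in> edges G" "x \<in> {0..len G e}" for e x
    using ed[OF that] a[OF that] by (simp add: magnetic_deriv_def g_def \<omega>_def)
  have "sobolev2 (len G e) (f e)" if e: "e \<in> edges G" for e
    unfolding sobolev2_def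
  proof (rule exI[of _ "g e"], rule exI[of _ "h e"], intro conjI ballI)
    show "square_integrable (len G e) (h e)"
      unfolding square_integrable_def
      by (intro conjI continuous_imp_integrable_real continuous_intros ch e
          borel_measurable_integrable)
    fix x assume x: "x \<in> {0..len G e}"
    show "(f e has_vector_derivative g e x) (at x within {0..len G e})" using fd[OF e x] .
    have "(h e has_integral (g e x - g e 0)) {0..x}"
      using x by (intro fundamental_theorem_of_calculus)
        (auto intro!: has_vector_derivative_within_subset[OF gd[OF e]])
    moreover have "integrable (lebesgue_on {0..x}) (h e)"
      using x by (intro continuous_imp_integrable_real continuous_on_subset[OF ch[OF e]]) auto
    ultimately show "g e x = g e 0 + (LINT t|lebesgue_on {0..x}. h e t)"
      by (simp add: lebesgue_integral_eq_integral integral_unique)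
  qed
  moreover have "continuous_graph G f"
    unfolding continuous_graph_def using cont val by blast
  moreover have "kirchhoff G f"
    unfolding kirchhoff_def
  proof
    fix v assume v: "v \<in> verts G"
    let ?k = "2 * complex_of_real pi * \<i> * val v"
    have on: "0 \<in> {0..len G e}" "len G e \<in> {0..len G e}" if "e \<in> edges G" for e
      using quantum_graphD[OF G that] by auto
    have end_simps: "edge_deriv G f e 0 = D e 0 - \<omega> e * val (src G e)"
      "edge_deriv G f e (len G e) = D e (len G e) - \<omega> e * val (tgt G e)" if "e \<in> edges G" for e
      using ed[OF that on(1)[OF that]] ed[OF that on(2)[OF that]] val[OF that] by (simp_all add: g_def)
    have "(\<Sum>e\<in>{e \<in> edges G. tgt G e = v}. edge_deriv G f e (len G e)) = (\<Sum>e\<in>{e \<in> edges G. tgt G e = v}. D e (len G e)) - ?k * of_real (\<Sum>e\<in>{e \<in> edges G. tgt G e = v}. c $ e)"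
      unfolding of_real_sum sum_distrib_left sum_subtractf[symmetric]
      by (intro sum.cong) (auto simp: end_simps \<omega>_def)
    moreover have "(\<Sum>e\<in>{e \<in> edges G. src G e = v}. edge_deriv G f e 0) = (\<Sum>e\<in>{e \<in> edges G. src G e = v}. D e 0) - ?k * of_real (\<Sum>e\<in>{e \<in> edges G. src G e = v}. c $ e)"
      unfolding of_real_sum sum_distrib_left sum_subtractf[symmetric]
      by (intro sum.cong) (auto simp: end_simps \<omega>_def)
    ultimately show "normal_sum G (edge_deriv G f) v = 0"
      using H1_realD[OF c] v bal unfolding flow_balanced_def by (simp add: normal_sum_def sum_negf)
  qed
  moreover have "L2_eq G (shifted_laplacian G a z f) (\<lambda>e x. 0)"
    unfolding L2_eq_def
  proof
    fix e assume e: "e \<in> edges G"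
    have "shifted_laplacian G a z f e x = 0" if x: "x \<in> {0..len G e}" for x
    proof -
      have "(magnetic_deriv G a f e has_vector_derivative - z * f e x - \<omega> e * D e x) (at x within {0..len G e})"
        by (rule has_vector_derivative_transform[OF _ _ Dd[OF e x]]) (use x md e in auto)
      then have "edge_deriv G (magnetic_deriv G a f) e x = - z * f e x - \<omega> e * D e x"
        using vector_derivative_within_closed_interval[OF quantum_graphD(3)[OF G e] x] e x
        by (simp add: edge_deriv_def on_graph_def)
      then show ?thesis
        unfolding shifted_laplacian_def magnetic_laplacian_def magnetic_deriv_def[of G a "magnetic_deriv G a f"]
        by (simp add: md[OF e x] a[OF e x] \<omega>_def)
    qed
    then show "AE x in lebesgue_on {0..len G e}. shifted_laplacian G a z f e x = 0"
      by (intro AE_I2) simp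
  qed
  ultimately show ?thesis using sup by (simp add: eigenspace_def laplacian_domain_def a_def)
qed


section \<open>Green's formula and the upper bound for the eigenvalue counting function\<close>

definition inner_L2 :: "('v, 'e) qgraph \<Rightarrow> ('e \<Rightarrow> real \<Rightarrow> complex) \<Rightarrow> ('e \<Rightarrow> real \<Rightarrow> complex) \<Rightarrow> complex" where
  "inner_L2 G f h = (\<Sum>e\<in>edges G. integral {0..len G e} (\<lambda>x. f e x * cnj (h e x)))"

definition norm_sq :: "('v, 'e) qgraph \<Rightarrow> ('e \<Rightarrow> real \<Rightarrow> complex) \<Rightarrow> real" where
  "norm_sq G f = (\<Sum>e\<in>edges G. integral {0..len G e} (\<lambda>x. (cmod (f e x))\<^sup>2))"

definition edge_continuous :: "('v, 'e) qgraph \<Rightarrow> ('e \<Rightarrow> real \<Rightarrow> complex) \<Rightarrow> bool" where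
  "edge_continuous G f \<longleftrightarrow> (\<forall>e\<in>edges G. continuous_on {0..len G e} (f e))"

lemma bloch_pair_derivs:
  assumes "bloch_pair G c z f D" "e \<in> edges G" "x \<in> {0..len G e}"
  shows "(f e has_vector_derivative D e x - 2 * of_real pi * \<i> * f e x * of_real (c $ e)) (at x within {0..len G e})"
    "(D e has_vector_derivative - z * f e x - 2 * of_real pi * \<i> * D e x * of_real (c $ e)) (at x within {0..len G e})"
  using assms unfolding bloch_pair_def by blast+

lemma bloch_pair_edge_continuous:
  assumes "bloch_pair G c z f D" shows "edge_continuous G f" "edge_continuous G D"
  unfolding edge_continuous_def
  using continuous_on_vector_derivative[OF bloch_pair_derivs(1)[OF assms]]
    continuous_on_vector_derivative[OF bloch_pair_derivs(2)[OF assms]] by blast+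

lemma bloch_pair_zero: "bloch_pair G c z 0 0"
  by (auto simp: bloch_pair_def supported_def flow_balanced_def zero_fun_def)

lemma bloch_pair_add:
  assumes 1: "bloch_pair G c z f D" and 2: "bloch_pair G c z f' D'"
  shows "bloch_pair G c z (f + f') (D + D')"
  unfolding bloch_pair_def
proof (intro conjI ballI)
  fix e x assume ex: "e \<in> edges G" "x \<in> {0..len G e}"
  have "(f + f') e = (\<lambda>y. f e y + f' e y)" "(D + D') e = (\<lambda>y. D e y + D' e y)" by auto
  then show "((f + f') e has_vector_derivative (D + D') e x - 2 * of_real pi * \<i> * (f + f') e x * of_real (c $ e)) (at x within {0..len G e})"
    "((D + D') e has_vector_derivative - z * (f + f') e x - 2 * of_real pi * \<i> * (D + D') e x * of_real (c $ e)) (at x within {0..len G e})"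
    using has_vector_derivative_add[OF bloch_pair_derivs(1)[OF 1 ex] bloch_pair_derivs(1)[OF 2 ex]]
      has_vector_derivative_add[OF bloch_pair_derivs(2)[OF 1 ex] bloch_pair_derivs(2)[OF 2 ex]]
    by (simp_all add: algebra_simps)
next
  obtain v v' where "\<forall>e\<in>edges G. f e 0 = v (src G e) \<and> f e (len G e) = v (tgt G e)"
    "\<forall>e\<in>edges G. f' e 0 = v' (src G e) \<and> f' e (len G e) = v' (tgt G e)"
    using 1 2 unfolding bloch_pair_def by blast
  then show "\<exists>val. \<forall>e\<in>edges G. (f + f') e 0 = val (src G e) \<and> (f + f') e (len G e) = val (tgt G e)"
    by (intro exI[of _ "\<lambda>u. v u + v' u"]) auto
qed (use 1 2 in \<open>auto simp: bloch_pair_def supported_def flow_balanced_def sum.distrib\<close>)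

lemma bloch_pair_scale:
  assumes 1: "bloch_pair G c z f D"
  shows "bloch_pair G c z (cscale k f) (cscale k D)"
  unfolding bloch_pair_def
proof (intro conjI ballI)
  fix e x assume ex: "e \<in> edges G" "x \<in> {0..len G e}"
  have "cscale k f e = (\<lambda>y. k * f e y)" "cscale k D e = (\<lambda>y. k * D e y)" by (auto simp: cscale_def)
  then show "(cscale k f e has_vector_derivative cscale k D e x - 2 * of_real pi * \<i> * cscale k f e x * of_real (c $ e)) (at x within {0..len G e})"
    "(cscale k D e has_vector_derivative - z * cscale k f e x - 2 * of_real pi * \<i> * cscale k D e x * of_real (c $ e)) (at x within {0..len G e})"
    using has_vector_derivative_mult_right[OF bloch_pair_derivs(1)[OF 1 ex], of k]
      has_vector_derivative_mult_right[OF bloch_pair_derivs(2)[OF 1 ex], of k]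
    by (simp_all add: algebra_simps)
next
  obtain v where "\<forall>e\<in>edges G. f e 0 = v (src G e) \<and> f e (len G e) = v (tgt G e)"
    using 1 unfolding bloch_pair_def by blast
  then show "\<exists>val. \<forall>e\<in>edges G. cscale k f e 0 = val (src G e) \<and> cscale k f e (len G e) = val (tgt G e)"
    by (intro exI[of _ "\<lambda>u. k * v u"]) (auto simp: cscale_def)
qed (use 1 in \<open>auto simp: bloch_pair_def supported_def flow_balanced_def cscale_def sum_distrib_left[symmetric]\<close>)

lemma bloch_pair_sum:
  assumes "finite J" "\<And>j. j \<in> J \<Longrightarrow> bloch_pair G c z (f j) (D j)"
  shows "bloch_pair G c z (\<Sum>j\<in>J. cscale (t j) (f j)) (\<Sum>j\<in>J. cscale (t j) (D j))"
  using assms by (induction J rule: finite_induct) (simp_all add: bloch_pair_zero bloch_pair_add bloch_pair_scale)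

lemma integrable_on_graph:
  assumes "edge_continuous G f" "edge_continuous G h" "e \<in> edges G"
  shows "(\<lambda>x. f e x * cnj (h e x)) integrable_on {0..len G e}"
    "(\<lambda>x. (cmod (f e x))\<^sup>2) integrable_on {0..len G e}"
  using assms unfolding edge_continuous_def
  by (intro integrable_continuous_interval continuous_intros; blast)+

lemma inner_L2_self:
  assumes "edge_continuous G f"
  shows "inner_L2 G f f = of_real (norm_sq G f)"
proof -
  have "integral {0..len G e} (\<lambda>x. f e x * cnj (f e x)) = of_real (integral {0..len G e} (\<lambda>x. (cmod (f e x))\<^sup>2))"
    if "e \<in> edges G" for e
    using integral_linear[OF integrable_on_graph(2)[OF assms assms that] bounded_linear_of_real[where 'a = complex]]
    by (simp add: o_def complex_norm_square[symmetric])
  then show ?thesis by (simp add: inner_L2_def norm_sq_def)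
qed

lemma inner_L2_cnj: "edge_continuous G f \<Longrightarrow> edge_continuous G h \<Longrightarrow> inner_L2 G h f = cnj (inner_L2 G f h)"
  unfolding inner_L2_def cnj_sum
  by (intro sum.cong refl) (simp add: integral_cnj mult.commute)

lemma inner_L2_add:
  assumes "edge_continuous G f" "edge_continuous G f'" "edge_continuous G h"
  shows "inner_L2 G (f + f') h = inner_L2 G f h + inner_L2 G f' h"
  unfolding inner_L2_def sum.distrib[symmetric]
  using Henstock_Kurzweil_Integration.integral_add[OF integrable_on_graph(1)[OF assms(1,3)] integrable_on_graph(1)[OF assms(2,3)]]
  by (intro sum.cong refl) (simp add: algebra_simps)

lemma edge_continuous_add: "edge_continuous G f \<Longrightarrow> edge_continuous G h \<Longrightarrow> edge_continuous G (f + h)"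
  unfolding edge_continuous_def by (simp add: plus_fun_def continuous_on_add)

lemma norm_sq_nonneg: "edge_continuous G f \<Longrightarrow> norm_sq G f \<ge> 0"
  unfolding norm_sq_def
  by (intro sum_nonneg Henstock_Kurzweil_Integration.integral_nonneg integrable_on_graph(2)[of G f f]) auto

lemma norm_sq_eq_0:
  assumes G: "quantum_graph G" and f: "edge_continuous G f" "supported G f" and 0: "norm_sq G f \<le> 0"
  shows "f = 0"
proof -
  have nn: "integral {0..len G e} (\<lambda>x. (cmod (f e x))\<^sup>2) \<ge> 0" if "e \<in> edges G" for e
    by (rule Henstock_Kurzweil_Integration.integral_nonneg[OF integrable_on_graph(2)[OF f(1) f(1) that]]) simp
  have "f e x = 0" for e x
  proof (cases "on_graph G e x")
    case True
    then have e: "e \<in> edges G" "x \<in> {0..len G e}" by (auto simp: on_graph_def)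
    have "integral {0..len G e} (\<lambda>x. (cmod (f e x))\<^sup>2) \<le> norm_sq G f"
      unfolding norm_sq_def by (rule member_le_sum) (use e nn G in \<open>auto simp: quantum_graph_def\<close>)
    then have "integral {0..len G e} (\<lambda>x. (cmod (f e x))\<^sup>2) = 0" using 0 nn[OF e(1)] by simp
    moreover have "continuous_on {0..len G e} (\<lambda>x. (cmod (f e x))\<^sup>2)"
      using f(1) e(1) unfolding edge_continuous_def by (intro continuous_intros) auto
    ultimately show ?thesis
      using integral_eq_0_iff[of 0 "len G e" "\<lambda>x. (cmod (f e x))\<^sup>2"] e quantum_graphD(3)[OF G e(1)] by simp
  next
    case False
    then show ?thesis using f(2) by (simp add: supported_def)
  qed
  then show ?thesis by (simp add: fun_eq_iff)
qed

text \<open>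
  The derivative of \<open>D * cnj h\<close> is \<open>D * cnj Dh - z * f * cnj h\<close>, because the terms with \<open>c\<close> cancel
  (\<open>2 \<pi> i c\<close> is imaginary), and the boundary terms add up to zero by the balance of \<open>D\<close> at the
  vertices.
\<close>

lemma green_formula:
  assumes G: "quantum_graph G" and bp: "bloch_pair G c z f D"
    and h: "\<And>e x. e \<in> edges G \<Longrightarrow> x \<in> {0..len G e} \<Longrightarrow>
        (h e has_vector_derivative Dh e x - 2 * of_real pi * \<i> * h e x * of_real (c $ e)) (at x within {0..len G e})"
    and Dh: "edge_continuous G Dh"
    and val: "\<And>e. e \<in> edges G \<Longrightarrow> h e 0 = val (src G e) \<and> h e (len G e) = val (tgt G e)"
  shows "inner_L2 G D Dh = z * inner_L2 G f h"
proof -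
  have ch: "edge_continuous G h"
    unfolding edge_continuous_def using continuous_on_vector_derivative[OF h] by blast
  have "integral {0..len G e} (\<lambda>x. D e x * cnj (Dh e x)) - z * integral {0..len G e} (\<lambda>x. f e x * cnj (h e x))
      = D e (len G e) * cnj (val (tgt G e)) - D e 0 * cnj (val (src G e))" if e: "e \<in> edges G" for e
  proof -
    have "((\<lambda>x. D e x * cnj (h e x)) has_vector_derivative D e x * cnj (Dh e x) - z * (f e x * cnj (h e x))) (at x within {0..len G e})"
      if x: "x \<in> {0..len G e}" for x
    proof -
      have "((\<lambda>x. cnj (h e x)) has_vector_derivative cnj (Dh e x - 2 * of_real pi * \<i> * h e x * of_real (c $ e))) (at x within {0..len G e})"
        by (rule has_vector_derivative_cnj[OF h[OF e x]])
      from has_vector_derivative_mult[OF bloch_pair_derivs(2)[OF bp e x] this]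
      show ?thesis by (simp add: algebra_simps)
    qed
    then have "((\<lambda>x. D e x * cnj (Dh e x) - z * (f e x * cnj (h e x))) has_integral
        (D e (len G e) * cnj (h e (len G e)) - D e 0 * cnj (h e 0))) {0..len G e}"
      by (intro fundamental_theorem_of_calculus) (use quantum_graphD[OF G e] in auto)
    then have "integral {0..len G e} (\<lambda>x. D e x * cnj (Dh e x) - z * (f e x * cnj (h e x))) = D e (len G e) * cnj (val (tgt G e)) - D e 0 * cnj (val (src G e))"
      using val[OF e] by (simp add: integral_unique)
    moreover have "integral {0..len G e} (\<lambda>x. D e x * cnj (Dh e x) - z * (f e x * cnj (h e x))) =
       integral {0..len G e} (\<lambda>x. D e x * cnj (Dh e x)) - integral {0..len G e} (\<lambda>x. z * (f e x * cnj (h e x)))"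
      using integrable_on_graph(1)[OF bloch_pair_edge_continuous(2)[OF bp] Dh e]
        integrable_on_mult_right[OF integrable_on_graph(1)[OF bloch_pair_edge_continuous(1)[OF bp] ch e], of z]
      by (rule Henstock_Kurzweil_Integration.integral_diff)
    ultimately show ?thesis by simp
  qed
  then have "inner_L2 G D Dh - z * inner_L2 G f h = (\<Sum>e\<in>edges G. D e (len G e) * cnj (val (tgt G e)) - D e 0 * cnj (val (src G e)))"
    unfolding inner_L2_def sum_distrib_left sum_subtractf[symmetric] by simp
  also have "\<dots> = 0"
    using flow_balanced_sum_potential[OF G, of "\<lambda>e. D e 0" "\<lambda>e. D e (len G e)" "\<lambda>u. cnj (val u)"] bp
    unfolding bloch_pair_def by blast
  finally show ?thesis by simp
qed

lemma green_formula_bloch_pair: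
  assumes G: "quantum_graph G" and bp: "bloch_pair G c z f D" and bp': "bloch_pair G c z' f' D'"
  shows "inner_L2 G D D' = z * inner_L2 G f f'"
proof -
  obtain val where "\<And>e. e \<in> edges G \<Longrightarrow> f' e 0 = val (src G e) \<and> f' e (len G e) = val (tgt G e)"
    using bp' unfolding bloch_pair_def by blast
  then show ?thesis
    by (intro green_formula[OF G bp bloch_pair_derivs(1)[OF bp'] bloch_pair_edge_continuous(2)[OF bp']])
qed

lemma bloch_pair_orthogonal:
  assumes G: "quantum_graph G" and bp: "bloch_pair G c (of_real z) f D" and bp': "bloch_pair G c (of_real z') f' D'"
    and "z \<noteq> z'"
  shows "inner_L2 G f f' = 0" "inner_L2 G D D' = 0"
proof -
  have "of_real z * inner_L2 G f f' = cnj (inner_L2 G D' D)"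
    using green_formula_bloch_pair[OF G bp bp'] inner_L2_cnj bloch_pair_edge_continuous bp bp' by metis
  also have "\<dots> = cnj (of_real z' * inner_L2 G f' f)" using green_formula_bloch_pair[OF G bp' bp] by simp
  also have "\<dots> = of_real z' * inner_L2 G f f'"
    using inner_L2_cnj[of G f' f] bloch_pair_edge_continuous[OF bp] bloch_pair_edge_continuous[OF bp'] by simp
  finally show "inner_L2 G f f' = 0" using assms(4) by simp
  then show "inner_L2 G D D' = 0" using green_formula_bloch_pair[OF G bp bp'] by simp
qed

lemma bloch_pair_energy:
  assumes G: "quantum_graph G" and bp: "bloch_pair G c z f D"
  shows "of_real (norm_sq G D) = z * of_real (norm_sq G f)"
  using green_formula_bloch_pair[OF G bp bp] inner_L2_self bloch_pair_edge_continuous[OF bp] by metis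


text \<open>
  Let \<open>m\<close> be the midpoint. The function \<open>t = K tan (K (x - m))\<close> is finite on \<open>{a..b}\<close> because
  \<open>K (b - a) < \<pi>\<close>, and it satisfies \<open>t' = K\<^sup>2 + t\<^sup>2\<close>. So
  \<open>|D + t F|\<^sup>2 = |D|\<^sup>2 - K\<^sup>2 |F|\<^sup>2 + (t |F|\<^sup>2)'\<close>, and the last term integrates to zero.
\<close>

lemma wirtinger_inequality:
  fixes F D :: "real \<Rightarrow> complex"
  assumes "a \<le> b" "0 \<le> K" "K * (b - a) < pi"
    and F: "\<And>x. x \<in> {a..b} \<Longrightarrow> (F has_vector_derivative D x - \<i> * of_real \<omega> * F x) (at x within {a..b})"
    and D: "continuous_on {a..b} D"
    and ends: "F a = 0" "F b = 0"
  shows "K\<^sup>2 * integral {a..b} (\<lambda>x. (cmod (F x))\<^sup>2) \<le> integral {a..b} (\<lambda>x. (cmod (D x))\<^sup>2)"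
proof -
  define m where "m = (a + b) / 2"
  define t where "t x = K * tan (K * (x - m))" for x
  have cF: "continuous_on {a..b} F" by (rule continuous_on_vector_derivative[OF F])
  have cos0: "cos (K * (x - m)) \<noteq> 0" if "x \<in> {a..b}" for x
  proof -
    have "\<bar>x - m\<bar> \<le> (b - a) / 2" using that by (auto simp: m_def abs_le_iff field_simps)
    then have "K * \<bar>x - m\<bar> \<le> K * ((b - a) / 2)" using assms(2) by (rule mult_left_mono)
    then have "\<bar>K * (x - m)\<bar> \<le> K * ((b - a) / 2)" using assms(2) by (simp add: abs_mult)
    also have "\<dots> < pi / 2" using assms(3) by simp
    finally have "cos (K * (x - m)) > 0" by (intro cos_gt_zero_pi) auto
    then show ?thesis by simp
  qed
  have t': "(t has_vector_derivative K\<^sup>2 + (t x)\<^sup>2) (at x within {a..b})" if x: "x \<in> {a..b}" for x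
  proof -
    have "(t has_real_derivative K * (inverse ((cos (K * (x - m)))\<^sup>2) * K)) (at x within {a..b})"
      unfolding t_def by (rule derivative_eq_intros refl cos0[OF x] | simp add: cos0[OF x])+
    moreover have "K * (inverse ((cos (K * (x - m)))\<^sup>2) * K) = K\<^sup>2 + (t x)\<^sup>2"
    proof -
      have "inverse ((cos (K * (x - m)))\<^sup>2) = 1 + (tan (K * (x - m)))\<^sup>2"
        using tan_sec[OF cos0[OF x]] by (simp add: power_inverse)
      moreover have "K * ((1 + u\<^sup>2) * K) = K\<^sup>2 + (K * u)\<^sup>2" for u
        by (simp add: power2_eq_square algebra_simps)
      ultimately show ?thesis unfolding t_def by simp
    qed
    ultimately show ?thesis by (simp add: has_real_derivative_iff_has_vector_derivative)
  qed
  have ct: "continuous_on {a..b} t" by (rule continuous_on_vector_derivative[OF t'])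
  have n': "((\<lambda>x. (cmod (F x))\<^sup>2) has_vector_derivative 2 * Re (D x * cnj (F x))) (at x within {a..b})" if x: "x \<in> {a..b}" for x
  proof -
    have "((\<lambda>x. F x * cnj (F x)) has_vector_derivative
        F x * cnj (D x - \<i> * of_real \<omega> * F x) + (D x - \<i> * of_real \<omega> * F x) * cnj (F x)) (at x within {a..b})"
      by (intro has_vector_derivative_mult has_vector_derivative_cnj F x)
    then have "((\<lambda>x. Re (F x * cnj (F x))) has_vector_derivative
        Re (F x * cnj (D x - \<i> * of_real \<omega> * F x) + (D x - \<i> * of_real \<omega> * F x) * cnj (F x))) (at x within {a..b})"
      by (rule bounded_linear.has_vector_derivative[OF bounded_linear_Re])
    then show ?thesis
      by (simp add: complex_norm_square[symmetric] del: times_complex.sel) (simp add: algebra_simps)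
  qed
  have "((\<lambda>x. t x * (cmod (F x))\<^sup>2) has_vector_derivative
      t x * (2 * Re (D x * cnj (F x))) + (K\<^sup>2 + (t x)\<^sup>2) * (cmod (F x))\<^sup>2) (at x within {a..b})" if "x \<in> {a..b}" for x
    by (intro has_vector_derivative_mult t' n' that)
  then have "((\<lambda>x. t x * (2 * Re (D x * cnj (F x))) + (K\<^sup>2 + (t x)\<^sup>2) * (cmod (F x))\<^sup>2) has_integral
      (t b * (cmod (F b))\<^sup>2 - t a * (cmod (F a))\<^sup>2)) {a..b}"
    by (intro fundamental_theorem_of_calculus assms)
  then have I1: "((\<lambda>x. t x * (2 * Re (D x * cnj (F x))) + (K\<^sup>2 + (t x)\<^sup>2) * (cmod (F x))\<^sup>2) has_integral 0) {a..b}"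
    using ends by simp
  have iD: "(\<lambda>x. (cmod (D x))\<^sup>2) integrable_on {a..b}" "(\<lambda>x. (cmod (F x))\<^sup>2) integrable_on {a..b}"
    by (intro integrable_continuous_interval continuous_intros D cF)+
  have sq: "(cmod (D x + of_real (t x) * F x))\<^sup>2 =
     (cmod (D x))\<^sup>2 - K\<^sup>2 * (cmod (F x))\<^sup>2 + (t x * (2 * Re (D x * cnj (F x))) + (K\<^sup>2 + (t x)\<^sup>2) * (cmod (F x))\<^sup>2)" for x
    unfolding cmod_power2 by (simp add: power2_eq_square algebra_simps)
  have "((\<lambda>x. (cmod (D x + of_real (t x) * F x))\<^sup>2) has_integral
     (integral {a..b} (\<lambda>x. (cmod (D x))\<^sup>2) - K\<^sup>2 * integral {a..b} (\<lambda>x. (cmod (F x))\<^sup>2) + 0)) {a..b}"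
    unfolding sq
    by (intro has_integral_add has_integral_diff has_integral_mult_right integrable_integral iD I1)
  then have "0 \<le> integral {a..b} (\<lambda>x. (cmod (D x))\<^sup>2) - K\<^sup>2 * integral {a..b} (\<lambda>x. (cmod (F x))\<^sup>2) + 0"
    by (rule has_integral_nonneg) simp
  then show ?thesis by simp
qed

lemma wirtinger_inequality_nodes:
  fixes F D :: "real \<Rightarrow> complex"
  assumes "0 \<le> h" "0 \<le> K" "K * h < pi"
    and F: "\<And>x. x \<in> {0..real N * h} \<Longrightarrow> (F has_vector_derivative D x - \<i> * of_real \<omega> * F x) (at x within {0..real N * h})"
    and D: "continuous_on {0..real N * h} D"
    and nodes: "\<And>j. j \<le> N \<Longrightarrow> F (real j * h) = 0"
  shows "K\<^sup>2 * integral {0..real N * h} (\<lambda>x. (cmod (F x))\<^sup>2) \<le> integral {0..real N * h} (\<lambda>x. (cmod (D x))\<^sup>2)"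
  using F D nodes
proof (induction N)
  case (Suc N)
  let ?p = "real N * h" and ?q = "real (Suc N) * h"
  have pq: "0 \<le> ?p" "?p \<le> ?q" using assms(1) by (auto simp: algebra_simps)
  have cF: "continuous_on {0..?q} F" by (rule continuous_on_vector_derivative[OF Suc.prems(1)])
  have split: "integral {0..?q} g = integral {0..?p} g + integral {?p..?q} g" if "g integrable_on {0..?q}" for g :: "real \<Rightarrow> real"
    using Henstock_Kurzweil_Integration.integral_combine[OF pq that] by simp
  have "K\<^sup>2 * integral {0..?p} (\<lambda>x. (cmod (F x))\<^sup>2) \<le> integral {0..?p} (\<lambda>x. (cmod (D x))\<^sup>2)"
  proof (rule Suc.IH)
    show "(F has_vector_derivative D x - \<i> * of_real \<omega> * F x) (at x within {0..?p})" if "x \<in> {0..?p}" for x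
      by (rule has_vector_derivative_within_subset[OF Suc.prems(1)]) (use that pq in auto)
    show "continuous_on {0..?p} D" by (rule continuous_on_subset[OF Suc.prems(2)]) (use pq in auto)
  qed (use Suc.prems(3) in auto)
  moreover have "K\<^sup>2 * integral {?p..?q} (\<lambda>x. (cmod (F x))\<^sup>2) \<le> integral {?p..?q} (\<lambda>x. (cmod (D x))\<^sup>2)"
  proof (rule wirtinger_inequality[OF pq(2) assms(2)])
    show "K * (?q - ?p) < pi" using assms(3) by (simp add: algebra_simps)
    show "(F has_vector_derivative D x - \<i> * of_real \<omega> * F x) (at x within {?p..?q})" if "x \<in> {?p..?q}" for x
      by (rule has_vector_derivative_within_subset[OF Suc.prems(1)]) (use that pq in auto)
    show "continuous_on {?p..?q} D" by (rule continuous_on_subset[OF Suc.prems(2)]) (use pq in auto)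
  qed (use Suc.prems(3)[of N] Suc.prems(3)[of "Suc N"] in auto)
  moreover have "(\<lambda>x. (cmod (F x))\<^sup>2) integrable_on {0..?q}" "(\<lambda>x. (cmod (D x))\<^sup>2) integrable_on {0..?q}"
    by (intro integrable_continuous_interval continuous_intros Suc.prems(2) cF)+
  ultimately show ?case by (simp only: split distrib_left)
qed simp

interpretation CV: vector_space cscale by (rule vector_space_cscale)

lemma sum_fun_apply2: "(\<Sum>j\<in>J. F j) e x = (\<Sum>j\<in>J. F j e x)" for F :: "'j \<Rightarrow> 'e \<Rightarrow> real \<Rightarrow> complex"
  by (induction J rule: infinite_finite_induct) auto

lemma norm_sq_orthogonal_sum:
  assumes "finite S" "\<And>k. k \<in> S \<Longrightarrow> edge_continuous G (f k)"
    "\<And>k l. k \<in> S \<Longrightarrow> l \<in> S \<Longrightarrow> k \<noteq> l \<Longrightarrow> inner_L2 G (f k) (f l) = 0"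
  shows "norm_sq G (\<Sum>k\<in>S. f k) = (\<Sum>k\<in>S. norm_sq G (f k)) \<and> edge_continuous G (\<Sum>k\<in>S. f k)"
proof -
  have ec: "edge_continuous G (\<Sum>k\<in>T. f k)" if "T \<subseteq> S" for T
    using finite_subset[OF that assms(1)] that
    by (induction T rule: finite_induct)
      (auto intro!: edge_continuous_add assms(2), simp add: edge_continuous_def zero_fun_def)
  have lin: "inner_L2 G (\<Sum>k\<in>T. f k) h = (\<Sum>k\<in>T. inner_L2 G (f k) h)" if "T \<subseteq> S" "edge_continuous G h" for T h
    using finite_subset[OF that(1) assms(1)] that(1)
  proof (induction T rule: finite_induct)
    case empty
    then show ?case by (simp add: inner_L2_def)
  next
    case (insert k T)
    then have "k \<in> S" "T \<subseteq> S" by auto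
    then show ?case
      using inner_L2_add[OF assms(2)[OF \<open>k \<in> S\<close>] ec[OF \<open>T \<subseteq> S\<close>] that(2)] insert.IH[OF \<open>T \<subseteq> S\<close>]
      by (simp only: sum.insert[OF insert.hyps])
  qed
  let ?F = "\<Sum>k\<in>S. f k"
  have 1: "inner_L2 G (f k) ?F = of_real (norm_sq G (f k))" if k: "k \<in> S" for k
  proof -
    have "inner_L2 G ?F (f k) = (\<Sum>l\<in>S. inner_L2 G (f l) (f k))" by (rule lin) (use k assms(2) in auto)
    also have "\<dots> = (\<Sum>l\<in>S. if l = k then of_real (norm_sq G (f k)) else 0)"
      using assms(3) k inner_L2_self[OF assms(2)] by (intro sum.cong) auto
    also have "\<dots> = of_real (norm_sq G (f k))" using k assms(1) by simp
    finally show ?thesis using inner_L2_cnj[OF ec[OF order.refl] assms(2)[OF k]] by simp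
  qed
  have "of_real (norm_sq G ?F) = inner_L2 G ?F ?F" using inner_L2_self[OF ec] by simp
  also have "\<dots> = (\<Sum>k\<in>S. inner_L2 G (f k) ?F)" by (rule lin) (use ec in auto)
  also have "\<dots> = of_real (\<Sum>k\<in>S. norm_sq G (f k))" using 1 by simp
  finally have "norm_sq G ?F = (\<Sum>k\<in>S. norm_sq G (f k))" by (simp only: of_real_eq_iff)
  then show ?thesis using ec by blast
qed

abbreviation eig_space :: "('v, 'e::finite) qgraph \<Rightarrow> real ^ 'e \<Rightarrow> real \<Rightarrow> ('e \<Rightarrow> real \<Rightarrow> complex) set" where
  "eig_space G c k \<equiv> eigenspace G (constant_form G c) (of_real (k\<^sup>2))"

abbreviation eig_mult :: "('v, 'e::finite) qgraph \<Rightarrow> real ^ 'e \<Rightarrow> real \<Rightarrow> nat" where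
  "eig_mult G c k \<equiv> eigen_multiplicity G (constant_form G c) (of_real (k\<^sup>2))"

text \<open>
  If there were more eigenfunctions than subdivision points, a nontrivial combination would vanish
  at all these points. By Wirtinger's inequality its energy would be at least \<open>K\<^sup>2\<close> times its
  squared norm, but as eigenfunctions for different eigenvalues are orthogonal, the energy is a
  combination of the squared norms with factors \<open>k\<^sup>2 < K\<^sup>2\<close>.
\<close>

theorem eigenvalue_count_upper_bound:
  fixes G :: "('v, 'e::finite) qgraph"
  assumes G: "quantum_graph G" and c: "c \<in> H1_real G"
    and S: "finite S" "S \<subseteq> {0..<K}"
    and B: "\<And>k. k \<in> S \<Longrightarrow> finite (B k)" "\<And>k. k \<in> S \<Longrightarrow> B k \<subseteq> eig_space G c k"
      "\<And>k. k \<in> S \<Longrightarrow> CV.independent (B k)"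
    and N: "\<And>e. e \<in> edges G \<Longrightarrow> 0 < N e" "\<And>e. e \<in> edges G \<Longrightarrow> K * len G e < pi * real (N e)"
  shows "(\<Sum>k\<in>S. card (B k)) \<le> (\<Sum>e\<in>edges G. N e + 1)"
proof (rule ccontr)
  assume contr: "\<not> ?thesis"
  let ?D = "magnetic_deriv G (constant_form G c)"
  let ?J = "Sigma S B" and ?E = "SIGMA e:edges G. {..N e}"
  define h where "h e = len G e / real (N e)" for e
  have finE: "finite (edges G)" using G by (simp add: quantum_graph_def)
  have "card ?E < card ?J" using contr S B(1) finE by simp
  moreover have "finite ?E" "finite ?J" using S B(1) finE by auto
  ultimately obtain t where t: "\<exists>j\<in>?J. t j \<noteq> 0"
    "\<forall>p\<in>?E. (\<Sum>j\<in>?J. snd j (fst p) (real (snd p) * h (fst p)) * t j) = 0"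
    using underdetermined_system[of ?E ?J "\<lambda>p j. snd j (fst p) (real (snd p) * h (fst p))"] by blast
  define f where "f k = (\<Sum>b\<in>B k. cscale (t (k, b)) b)" for k
  define D where "D k = (\<Sum>b\<in>B k. cscale (t (k, b)) (?D b))" for k
  have bp: "bloch_pair G c (of_real (k\<^sup>2)) (f k) (D k)" if "k \<in> S" for k
    unfolding f_def D_def
    by (rule bloch_pair_sum[OF B(1)[OF that]]) (use bloch_pair_if_eigenfunction[OF G c] B(2)[OF that] in blast)
  have ec: "edge_continuous G (f k)" "edge_continuous G (D k)" if "k \<in> S" for k
    using bloch_pair_edge_continuous[OF bp[OF that]] .
  have neq: "k\<^sup>2 \<noteq> l\<^sup>2" if "k \<in> S" "l \<in> S" "k \<noteq> l" for k l
    using that S(2) by (metis atLeastLessThan_iff power2_eq_imp_eq subsetD)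
  define F where "F = (\<Sum>k\<in>S. f k)"
  define DF where "DF = (\<Sum>k\<in>S. D k)"
  have nF: "norm_sq G F = (\<Sum>k\<in>S. norm_sq G (f k))" "edge_continuous G F"
    unfolding F_def using norm_sq_orthogonal_sum[OF S(1) ec(1) bloch_pair_orthogonal(1)[OF G bp bp neq]] by auto
  have nD: "norm_sq G DF = (\<Sum>k\<in>S. norm_sq G (D k))" "edge_continuous G DF"
    unfolding DF_def using norm_sq_orthogonal_sum[OF S(1) ec(2) bloch_pair_orthogonal(2)[OF G bp bp neq]] by auto
  have energy: "norm_sq G (D k) = k\<^sup>2 * norm_sq G (f k)" if "k \<in> S" for k
    using bloch_pair_energy[OF G bp[OF that]] by (simp only: of_real_mult[symmetric] of_real_eq_iff)
  have nodes: "F e (real j * h e) = 0" if "e \<in> edges G" "j \<le> N e" for e j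
  proof -
    have "F e (real j * h e) = (\<Sum>k\<in>S. \<Sum>b\<in>B k. b e (real j * h e) * t (k, b))"
      unfolding F_def f_def sum_fun_apply2 cscale_def by (simp add: mult.commute)
    also have "\<dots> = (\<Sum>(k, b)\<in>?J. b e (real j * h e) * t (k, b))"
      by (rule sum.Sigma) (use S B(1) in auto)
    also have "\<dots> = 0" using t(2)[rule_format, of "(e, j)"] that by (simp add: case_prod_unfold)
    finally show ?thesis .
  qed
  have F': "(F e has_vector_derivative DF e x - \<i> * of_real (2 * pi * c $ e) * F e x) (at x within {0..len G e})"
    if ex: "e \<in> edges G" "x \<in> {0..len G e}" for e x
  proof -
    have "((\<lambda>y. \<Sum>k\<in>S. f k e y) has_vector_derivative (\<Sum>k\<in>S. D k e x - 2 * of_real pi * \<i> * f k e x * of_real (c $ e))) (at x within {0..len G e})"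
      by (intro has_vector_derivative_sum bloch_pair_derivs(1)[OF bp ex])
    moreover have "(\<lambda>y. \<Sum>k\<in>S. f k e y) = F e" by (simp add: F_def sum_fun_apply2 fun_eq_iff)
    moreover have "(\<Sum>k\<in>S. D k e x - 2 * of_real pi * \<i> * f k e x * of_real (c $ e)) = DF e x - \<i> * of_real (2 * pi * c $ e) * F e x"
      by (simp add: F_def DF_def sum_fun_apply2 sum_subtractf sum_distrib_left sum_distrib_right mult_ac)
    ultimately show ?thesis by simp
  qed
  have "K\<^sup>2 * norm_sq G F \<le> norm_sq G DF"
    unfolding norm_sq_def sum_distrib_left
  proof (rule sum_mono)
    fix e assume e: "e \<in> edges G"
    have Nh: "real (N e) * h e = len G e" using N(1)[OF e] by (simp add: h_def)
    have "0 \<le> K"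
    proof (cases "S = {}")
      case True
      with contr show ?thesis by simp
    qed (use S(2) in force)
    show "K\<^sup>2 * integral {0..len G e} (\<lambda>x. (cmod (F e x))\<^sup>2) \<le> integral {0..len G e} (\<lambda>x. (cmod (DF e x))\<^sup>2)"
    proof (rule wirtinger_inequality_nodes[where N = "N e" and h = "h e", unfolded Nh])
      show "0 \<le> h e" using quantum_graphD(4)[OF G e] by (simp add: h_def)
      show "K * h e < pi" using N[OF e] by (simp add: h_def field_simps)
      show "(F e has_vector_derivative DF e x - \<i> * of_real (2 * pi * c $ e) * F e x) (at x within {0..len G e})"
        if "x \<in> {0..len G e}" for x by (rule F'[OF e that])
      show "continuous_on {0..len G e} (DF e)" using nD(2) e by (simp add: edge_continuous_def)
      show "F e (real j * h e) = 0" if "j \<le> N e" for j by (rule nodes[OF e that])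
    qed fact
  qed
  then have "(\<Sum>k\<in>S. (K\<^sup>2 - k\<^sup>2) * norm_sq G (f k)) \<le> 0"
    unfolding nF(1) nD(1) by (simp add: energy sum_distrib_left left_diff_distrib sum_subtractf)
  moreover have pos: "(K\<^sup>2 - k\<^sup>2) * norm_sq G (f k) \<ge> 0" and lt: "k\<^sup>2 < K\<^sup>2" if "k \<in> S" for k
  proof -
    show "k\<^sup>2 < K\<^sup>2" using that S(2) by (intro power_strict_mono) auto
    then show "(K\<^sup>2 - k\<^sup>2) * norm_sq G (f k) \<ge> 0" using norm_sq_nonneg[OF ec(1)[OF that]] by simp
  qed
  ultimately have "\<forall>k\<in>S. (K\<^sup>2 - k\<^sup>2) * norm_sq G (f k) = 0"
    using sum_nonneg_eq_0_iff[OF S(1), of "\<lambda>k. (K\<^sup>2 - k\<^sup>2) * norm_sq G (f k)"] sum_nonneg[of S "\<lambda>k. (K\<^sup>2 - k\<^sup>2) * norm_sq G (f k)"] by force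
  then have "f k = 0" if "k \<in> S" for k
    using lt[OF that] that bp[OF that] by (intro norm_sq_eq_0[OF G ec(1)]) (auto simp: bloch_pair_def)
  then have "t (k, b) = 0" if "k \<in> S" "b \<in> B k" for k b
    using CV.dependent_finite[OF B(1)[OF that(1)]] B(3)[OF that(1)] that unfolding f_def by force
  with t(1) show False by auto
qed

section \<open>Discretised quadratic forms and the lower bound for the eigenvalue counting function\<close>

text \<open>
  The value at \<open>k = 0\<close> is the limit of the quotient, so the path of matrices below can start at
  \<open>k = 0\<close>.
\<close>

definition sinq :: "real \<Rightarrow> real \<Rightarrow> real" where
  "sinq k x = (if k = 0 then x else sin (k * x) / k)"

lemma sinq_derivs:
  "((\<lambda>x. sinq k x) has_real_derivative cos (k * x)) (at x within A)"
  "((\<lambda>x. cos (k * x)) has_real_derivative - k\<^sup>2 * sinq k x) (at x within A)"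
  by (cases "k = 0"; auto intro!: derivative_eq_intros simp: sinq_def[abs_def] power2_eq_square)+

lemma sinq_add: "sinq k (x + y) = sinq k x * cos (k * y) + cos (k * x) * sinq k y"
  by (auto simp: sinq_def distrib_left sin_add add_divide_distrib)

lemma sinq_diff: "sinq k (x - y) = sinq k x * cos (k * y) - cos (k * x) * sinq k y"
  by (auto simp: sinq_def right_diff_distrib sin_diff diff_divide_distrib)

lemma cos_diff_sinq: "cos (k * (x - y)) = cos (k * x) * cos (k * y) + k\<^sup>2 * sinq k x * sinq k y"
  by (auto simp: sinq_def right_diff_distrib cos_diff power2_eq_square)

lemma cos_add_sinq: "cos (k * (x + y)) = cos (k * x) * cos (k * y) - k\<^sup>2 * sinq k x * sinq k y"
  by (auto simp: sinq_def distrib_left cos_add power2_eq_square)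

lemma sinq_0 [simp]: "sinq k 0 = 0" by (simp add: sinq_def)

lemma sinq_pos: assumes "0 \<le> k" "0 < h" "k * h < pi" shows "0 < sinq k h"
  using assms by (cases "k = 0") (auto simp: sinq_def intro!: divide_pos_pos sin_gt_zero)

lemma continuous_sinq:
  assumes "0 < h" shows "continuous_on A (\<lambda>k. sinq k h)"
proof -
  have 1: "isCont (\<lambda>k. sinq k h) k" for k
  proof (cases "k = 0")
    case True
    have "((\<lambda>k. sin (k * h)) has_real_derivative h) (at 0)"
      by (auto intro!: derivative_eq_intros)
    then have "(\<lambda>k. sin (k * h) / k) \<midarrow>0\<rightarrow> h"
      by (simp add: DERIV_def)
    then have "(\<lambda>k. sinq k h) \<midarrow>0\<rightarrow> h"
      by (rule Lim_transform_eventually) (auto simp: eventually_at_filter sinq_def)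
    then show ?thesis using True by (simp add: isCont_def sinq_def)
  next
    case False
    have "isCont (\<lambda>k. sin (k * h) / k) k" using False by (intro continuous_intros) auto
    moreover have "\<forall>\<^sub>F x in nhds k. sin (x * h) / x = sinq x h"
    proof (rule eventually_mono)
      show "\<forall>\<^sub>F x in nhds k. x \<in> - {0}" using False by (intro eventually_nhds_in_open) auto
    qed (simp add: sinq_def)
    ultimately show ?thesis by (simp add: isCont_cong)
  qed
  show ?thesis using 1 by (simp add: continuous_at_imp_continuous_on)
qed

text \<open>
  The points \<open>0\<close> and \<open>N e\<close> of a subdivided edge are its end vertices, which it shares with other
  edges.
\<close>

definition node :: "('v, 'e) qgraph \<Rightarrow> ('e \<Rightarrow> nat) \<Rightarrow> 'e \<Rightarrow> nat \<Rightarrow> 'v + 'e \<times> nat" where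
  "node G N e j = (if j = 0 then Inl (src G e) else if j = N e then Inl (tgt G e) else Inr (e, j))"

definition nodes :: "('v, 'e) qgraph \<Rightarrow> ('e \<Rightarrow> nat) \<Rightarrow> ('v + 'e \<times> nat) set" where
  "nodes G N = (\<Union>e\<in>edges G. node G N e ` {..N e})"

definition mesh :: "('v, 'e) qgraph \<Rightarrow> ('e \<Rightarrow> nat) \<Rightarrow> 'e \<Rightarrow> real" where
  "mesh G N e = len G e / real (N e)"

text \<open>The holonomy of the connection along one piece of the edge, as an angle.\<close>

definition phase :: "('v, 'e::finite) qgraph \<Rightarrow> real ^ 'e \<Rightarrow> ('e \<Rightarrow> nat) \<Rightarrow> 'e \<Rightarrow> real" where
  "phase G c N e = 2 * pi * c $ e * mesh G N e"

definition unit_at :: "'i \<Rightarrow> 'i \<Rightarrow> complex" where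
  "unit_at p i = (if i = p then 1 else 0)"

text \<open>
  The solution of \<open>u'' = - k\<^sup>2 u\<close> on an interval of length \<open>h\<close> with boundary values \<open>p\<close> and \<open>q\<close>
  satisfies \<open>\<integral>(|u'|\<^sup>2 - k\<^sup>2 |u|\<^sup>2) = ((|p|\<^sup>2 + |q|\<^sup>2) cos (k h) - 2 Re (cnj p * q)) / sinq k h\<close>.
  The link term is this quadratic form, polarised and twisted by the holonomy of the connection.
\<close>

abbreviation link_term where
  "link_term G c N k e a b p q \<equiv> of_real (inverse (sinq k (mesh G N e))) *
     (a * (of_real (cos (k * mesh G N e)) * p - cis (phase G c N e) * q) +
      b * (of_real (cos (k * mesh G N e)) * q - cis (- phase G c N e) * p))"

definition node_matrix :: "('v, 'e::finite) qgraph \<Rightarrow> real ^ 'e \<Rightarrow> ('e \<Rightarrow> nat) \<Rightarrow> real \<Rightarrow>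
    'v + 'e \<times> nat \<Rightarrow> 'v + 'e \<times> nat \<Rightarrow> complex" where
  "node_matrix G c N k i i' = (\<Sum>e\<in>edges G. \<Sum>j<N e.
     link_term G c N k e (unit_at (node G N e j) i) (unit_at (node G N e (Suc j)) i) (unit_at (node G N e j) i') (unit_at (node G N e (Suc j)) i'))"

abbreviation node_kernel where
  "node_kernel G c N k x \<equiv> \<forall>i\<in>nodes G N. (\<Sum>i'\<in>nodes G N. node_matrix G c N k i i' * x i') = 0"

lemma finite_nodes: "finite (edges G) \<Longrightarrow> finite (nodes G N)"
  by (auto simp: nodes_def)

lemma node_in_nodes: "e \<in> edges G \<Longrightarrow> j \<le> N e \<Longrightarrow> node G N e j \<in> nodes G N"
  by (auto simp: nodes_def)

lemma sum_unit_at: "finite I \<Longrightarrow> p \<in> I \<Longrightarrow> (\<Sum>i\<in>I. unit_at p i * x i) = x p"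
  by (simp add: unit_at_def if_distrib[of "\<lambda>y. y * _"] cong: if_cong)

lemma node_matrix_apply:
  assumes fin: "finite (edges G)"
  shows "(\<Sum>i'\<in>nodes G N. node_matrix G c N k i i' * x i') = (\<Sum>e\<in>edges G. \<Sum>j<N e.
     link_term G c N k e (unit_at (node G N e j) i) (unit_at (node G N e (Suc j)) i) (x (node G N e j)) (x (node G N e (Suc j))))"
proof -
  have lin: "(\<Sum>i'\<in>nodes G N. w * (a * (s * unit_at p i' - r * unit_at q i') + b * (s * unit_at q i' - r' * unit_at p i')) * x i') =
      w * (a * (s * x p - r * x q) + b * (s * x q - r' * x p))" if "p \<in> nodes G N" "q \<in> nodes G N" for w a b s r r' p q
  proof -
    have "(\<Sum>i'\<in>nodes G N. w * (a * (s * unit_at p i' - r * unit_at q i') + b * (s * unit_at q i' - r' * unit_at p i')) * x i') =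
      w * (a * (s * (\<Sum>i'\<in>nodes G N. unit_at p i' * x i') - r * (\<Sum>i'\<in>nodes G N. unit_at q i' * x i')) +
        b * (s * (\<Sum>i'\<in>nodes G N. unit_at q i' * x i') - r' * (\<Sum>i'\<in>nodes G N. unit_at p i' * x i')))"
      unfolding sum_distrib_left sum_subtractf[symmetric] sum.distrib[symmetric]
      by (intro sum.cong refl) (simp add: algebra_simps)
    then show ?thesis using that finite_nodes[OF fin] by (simp add: sum_unit_at)
  qed
  show ?thesis
    unfolding node_matrix_def sum_distrib_right
    by (subst sum.swap, intro sum.cong refl, subst sum.swap, intro sum.cong refl lin node_in_nodes) auto
qed

lemma node_form:
  assumes fin: "finite (edges G)"
  shows "hform (nodes G N) (node_matrix G c N k) x y = (\<Sum>e\<in>edges G. \<Sum>j<N e.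
     link_term G c N k e (cnj (x (node G N e j))) (cnj (x (node G N e (Suc j)))) (y (node G N e j)) (y (node G N e (Suc j))))"
proof -
  have lin: "(\<Sum>i\<in>nodes G N. cnj (x i) * (w * (unit_at p i * a + unit_at q i * b))) = w * (cnj (x p) * a + cnj (x q) * b)"
    if "p \<in> nodes G N" "q \<in> nodes G N" for w a b p q
  proof -
    have "(\<Sum>i\<in>nodes G N. cnj (x i) * (w * (unit_at p i * a + unit_at q i * b))) =
      w * ((\<Sum>i\<in>nodes G N. unit_at p i * cnj (x i)) * a + (\<Sum>i\<in>nodes G N. unit_at q i * cnj (x i)) * b)"
      unfolding sum_distrib_left sum_distrib_right sum.distrib[symmetric]
      by (intro sum.cong refl) (simp add: algebra_simps)
    then show ?thesis using that finite_nodes[OF fin] by (simp add: sum_unit_at)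
  qed
  have "hform (nodes G N) (node_matrix G c N k) x y =
     (\<Sum>i\<in>nodes G N. cnj (x i) * (\<Sum>i'\<in>nodes G N. node_matrix G c N k i i' * y i'))"
    by (simp add: hform_def sum_distrib_left mult.assoc)
  also have "\<dots> = (\<Sum>e\<in>edges G. \<Sum>j<N e. \<Sum>i\<in>nodes G N. cnj (x i) * (link_term G c N k e (unit_at (node G N e j) i) (unit_at (node G N e (Suc j)) i) (y (node G N e j)) (y (node G N e (Suc j)))))"
    unfolding node_matrix_apply[OF fin] sum_distrib_left
    by (subst sum.swap, intro sum.cong refl, rule sum.swap)
  also have "\<dots> = (\<Sum>e\<in>edges G. \<Sum>j<N e.
     link_term G c N k e (cnj (x (node G N e j))) (cnj (x (node G N e (Suc j)))) (y (node G N e j)) (y (node G N e (Suc j))))"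
    by (intro sum.cong refl lin node_in_nodes) auto
  finally show ?thesis .
qed

lemma Re_node_form:
  assumes fin: "finite (edges G)"
  shows "Re (hform (nodes G N) (node_matrix G c N k) x x) = (\<Sum>e\<in>edges G. \<Sum>j<N e.
     inverse (sinq k (mesh G N e)) * (cos (k * mesh G N e) * ((cmod (x (node G N e j)))\<^sup>2 + (cmod (x (node G N e (Suc j))))\<^sup>2)
        - 2 * Re (cnj (x (node G N e j)) * cis (phase G c N e) * x (node G N e (Suc j)))))"
proof -
  have "Re (of_real w * (cnj p * (of_real s * p - cis \<theta> * q) + cnj q * (of_real s * q - cis (- \<theta>) * p))) =
      w * (s * ((cmod p)\<^sup>2 + (cmod q)\<^sup>2) - 2 * Re (cnj p * cis \<theta> * q))" for w s \<theta> p q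
    unfolding cmod_power2 by (simp add: power2_eq_square algebra_simps)
  then show ?thesis unfolding node_form[OF fin] Re_sum by (intro sum.cong refl)
qed

lemma node_matrix_hermitian: "node_matrix G c N k i i' = cnj (node_matrix G c N k i' i)"
proof -
  have unit: "cnj (unit_at p i) = unit_at p i" for p i :: "'v + 'e \<times> nat" by (simp add: unit_at_def)
  have alg: "w * (a * (s * a' - p * b') + b * (s * b' - q * a')) = w * (a' * (s * a - q * b) + b' * (s * b - p * a))"
    for w a s a' p b' b q :: complex by algebra
  show ?thesis
    unfolding node_matrix_def cnj_sum complex_cnj_mult complex_cnj_add complex_cnj_diff unit cis_cnj complex_cnj_complex_of_real minus_minus
    by (intro sum.cong refl) (rule alg)
qed

lemma node_matrix_continuous:
  assumes G: "quantum_graph G" and N: "\<And>e. e \<in> edges G \<Longrightarrow> 0 < N e" "\<And>e. e \<in> edges G \<Longrightarrow> K * len G e < pi * real (N e)"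
  shows "continuous_on {0..K} (\<lambda>k. node_matrix G c N k i i')"
proof -
  have "continuous_on {0..K} (\<lambda>k. inverse (sinq k (mesh G N e)))" if e: "e \<in> edges G" for e
  proof -
    have h: "0 < mesh G N e" using N(1)[OF e] quantum_graphD(3)[OF G e] by (simp add: mesh_def)
    have "sinq k (mesh G N e) \<noteq> 0" if k: "k \<in> {0..K}" for k
    proof -
      have "k * mesh G N e \<le> K * mesh G N e" using k h by (intro mult_right_mono) auto
      also have "\<dots> < pi" using N[OF e] by (simp add: mesh_def field_simps)
      finally show ?thesis using sinq_pos[of k "mesh G N e"] k h by auto
    qed
    then show ?thesis by (intro continuous_on_inverse continuous_sinq h) auto
  qed
  then show ?thesis
    unfolding node_matrix_def
    by (intro continuous_on_sum continuous_on_mult continuous_on_add continuous_on_diff continuous_on_const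
        continuous_on_of_real continuous_on_cos continuous_on_id)
qed

lemma mesh_bounds:
  assumes G: "quantum_graph G" and e: "e \<in> edges G" and N: "0 < N e" "K * len G e < pi * real (N e)" and k: "0 \<le> k" "k \<le> K"
  shows "0 < mesh G N e" "real (N e) * mesh G N e = len G e" "0 < sinq k (mesh G N e)"
proof -
  show h: "0 < mesh G N e" using N(1) quantum_graphD(3)[OF G e] by (simp add: mesh_def)
  show "real (N e) * mesh G N e = len G e" using N(1) by (simp add: mesh_def)
  have "k * mesh G N e \<le> K * mesh G N e" using k h by (intro mult_right_mono) auto
  also have "\<dots> < pi" using N by (simp add: mesh_def field_simps)
  finally show "0 < sinq k (mesh G N e)" using sinq_pos h k by blast
qed

text \<open>
  The initial derivative of the solution of \<open>u'' = - k\<^sup>2 u\<close> through the first two node values, in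
  the gauge that removes \<open>c\<close>.
\<close>

definition slope :: "('v, 'e::finite) qgraph \<Rightarrow> real ^ 'e \<Rightarrow> ('e \<Rightarrow> nat) \<Rightarrow> real \<Rightarrow> ('v + 'e \<times> nat \<Rightarrow> complex) \<Rightarrow> 'e \<Rightarrow> complex" where
  "slope G c N k x e = (cis (phase G c N e) * x (node G N e 1) - of_real (cos (k * mesh G N e)) * x (node G N e 0)) /
     of_real (sinq k (mesh G N e))"

definition extension :: "('v, 'e::finite) qgraph \<Rightarrow> real ^ 'e \<Rightarrow> ('e \<Rightarrow> nat) \<Rightarrow> real \<Rightarrow> ('v + 'e \<times> nat \<Rightarrow> complex) \<Rightarrow>
    'e \<Rightarrow> real \<Rightarrow> complex" where
  "extension G c N k x e y = (if on_graph G e y then cis (- (2 * pi * c $ e * y)) *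
     (x (node G N e 0) * of_real (cos (k * y)) + slope G c N k x e * of_real (sinq k y)) else 0)"

definition extension_deriv :: "('v, 'e::finite) qgraph \<Rightarrow> real ^ 'e \<Rightarrow> ('e \<Rightarrow> nat) \<Rightarrow> real \<Rightarrow> ('v + 'e \<times> nat \<Rightarrow> complex) \<Rightarrow>
    'e \<Rightarrow> real \<Rightarrow> complex" where
  "extension_deriv G c N k x e y = cis (- (2 * pi * c $ e * y)) *
     (slope G c N k x e * of_real (cos (k * y)) - of_real (k\<^sup>2) * x (node G N e 0) * of_real (sinq k y))"

text \<open>
  In the gauge that removes \<open>c\<close>, the kernel equation at an interior node is the recurrence
  \<open>u (j + 1) + u (j - 1) = 2 cos (k h) u j\<close>, which is also satisfied by the samples of \<open>cos (k x)\<close>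
  and \<open>sinq k x\<close>.
\<close>

lemma kernel_node_values:
  assumes G: "quantum_graph G" and e: "e \<in> edges G"
    and N: "\<And>e. e \<in> edges G \<Longrightarrow> 0 < N e" "\<And>e. e \<in> edges G \<Longrightarrow> K * len G e < pi * real (N e)" and k: "0 \<le> k" "k \<le> K"
    and ker: "node_kernel G c N k x"
    and j: "j \<le> N e"
  shows "cis (real j * phase G c N e) * x (node G N e j) =
     x (node G N e 0) * of_real (cos (k * (real j * mesh G N e))) + slope G c N k x e * of_real (sinq k (real j * mesh G N e))"
proof -
  note mb = mesh_bounds[where N = N and e = e, OF G e N(1)[OF e] N(2)[OF e] k]
  have fin: "finite (edges G)" using G by (simp add: quantum_graph_def)
  define h where "h = mesh G N e"
  define \<theta> where "\<theta> = phase G c N e"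
  define u where "u j = cis (real j * \<theta>) * x (node G N e j)" for j
  define C where "C = complex_of_real (cos (k * h))"
  have rec: "u (Suc j) + u (j - 1) = 2 * C * u j" if j: "0 < j" "j < N e" for j
  proof -
    let ?t = "\<lambda>e' j'. link_term G c N k e' (unit_at (node G N e' j') (Inr (e, j))) (unit_at (node G N e' (Suc j')) (Inr (e, j))) (x (node G N e' j')) (x (node G N e' (Suc j')))"
    have "Inr (e, j) = node G N e j" using j by (simp add: node_def)
    then have "Inr (e, j) \<in> nodes G N" using node_in_nodes[OF e, of j N] j by simp
    then have 0: "(\<Sum>e'\<in>edges G. \<Sum>j'<N e'. ?t e' j') = 0" using ker unfolding node_matrix_apply[OF fin] by blast
    have "(\<Sum>e'\<in>edges G. \<Sum>j'<N e'. ?t e' j') = (\<Sum>j'<N e. ?t e j')"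
    proof (subst sum.mono_neutral_right[of _ "{e}"])
      show "\<forall>i\<in>edges G - {e}. (\<Sum>j'<N i. ?t i j') = 0"
        by (intro ballI sum.neutral) (auto simp: unit_at_def node_def)
    qed (use e fin in auto)
    also have "\<dots> = (\<Sum>j'\<in>{j - 1, j}. ?t e j')"
    proof (rule sum.mono_neutral_right)
      show "\<forall>j'\<in>{..<N e} - {j - 1, j}. ?t e j' = 0"
        by (intro ballI) (auto simp: unit_at_def node_def)
    qed (use j in auto)
    also have "\<dots> = of_real (inverse (sinq k h)) * (2 * C * x (node G N e j) - cis \<theta> * x (node G N e (Suc j)) - cis (- \<theta>) * x (node G N e (j - 1)))"
    proof -
      have "unit_at (node G N e j) (Inr (e, j)) = 1" "unit_at (node G N e (Suc j)) (Inr (e, j)) = 0"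
        "unit_at (node G N e (j - 1)) (Inr (e, j)) = 0" "Suc (j - 1) = j" "j - 1 \<noteq> j"
        using j by (auto simp: unit_at_def node_def)
      then show ?thesis by (simp add: h_def \<theta>_def C_def algebra_simps)
    qed
    finally have "2 * C * x (node G N e j) - cis \<theta> * x (node G N e (Suc j)) - cis (- \<theta>) * x (node G N e (j - 1)) = 0"
      using 0 mb(3) by (simp add: h_def)
    then have 1: "2 * C * x (node G N e j) = cis \<theta> * x (node G N e (Suc j)) + cis (- \<theta>) * x (node G N e (j - 1))"
      by (simp add: algebra_simps)
    have 2: "cis (real j * \<theta>) * cis \<theta> = cis (real (Suc j) * \<theta>)" "cis (real j * \<theta>) * cis (- \<theta>) = cis (real (j - 1) * \<theta>)"
      using j by (auto simp: cis_mult algebra_simps of_nat_diff)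
    have "2 * C * u j = cis (real j * \<theta>) * (2 * C * x (node G N e j))" by (simp add: u_def)
    also have "\<dots> = u (Suc j) + u (j - 1)"
      unfolding 1 u_def 2[symmetric] by (simp only: distrib_left mult.assoc)
    finally show ?thesis by simp
  qed
  define v where "v j = x (node G N e 0) * of_real (cos (k * (real j * h))) + slope G c N k x e * of_real (sinq k (real j * h))" for j
  have vrec: "v (Suc j) + v (j - 1) = 2 * C * v j" if "0 < j" for j
  proof -
    have 1: "real (Suc j) * h = real j * h + h" "real (j - 1) * h = real j * h - h" using that by (auto simp: algebra_simps of_nat_diff)
    show ?thesis unfolding v_def 1 C_def sinq_add sinq_diff cos_add_sinq cos_diff_sinq by (simp add: algebra_simps)
  qed
  have "u j = v j" if "j \<le> N e" for j
    using that
  proof (induction j rule: less_induct)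
    case (less j)
    consider "j = 0" | "j = 1" | i where "j = Suc i" "0 < i" by (metis One_nat_def not0_implies_Suc not_gr_zero)
    then show ?case
    proof cases
      case 1
      then show ?thesis by (simp add: u_def v_def)
    next
      case 2
      then show ?thesis using mb(3) by (simp add: u_def v_def slope_def h_def \<theta>_def)
    next
      case 3
      then have "u i = v i" "u (i - 1) = v (i - 1)" using less by auto
      moreover have "u j = 2 * C * u i - u (i - 1)" "v j = 2 * C * v i - v (i - 1)"
        using rec[of i] vrec[of i] 3 less.prems by (auto simp: algebra_simps)
      ultimately show ?thesis by simp
    qed
  qed
  from this[OF j] show ?thesis by (simp add: u_def v_def h_def \<theta>_def)
qed


text \<open>
  The kernel equation at a vertex says that the covariant derivatives of the extension are
  balanced there. The second claim shows that a kernel vector can be recovered from its extension.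
\<close>

lemma extension_bloch_pair:
  assumes G: "quantum_graph G"
    and N: "\<And>e. e \<in> edges G \<Longrightarrow> 0 < N e" "\<And>e. e \<in> edges G \<Longrightarrow> K * len G e < pi * real (N e)" and k: "0 \<le> k" "k \<le> K"
    and ker: "node_kernel G c N k x"
  shows "bloch_pair G c (of_real (k\<^sup>2)) (extension G c N k x) (extension_deriv G c N k x)"
    and "\<And>e j. e \<in> edges G \<Longrightarrow> j \<le> N e \<Longrightarrow> extension G c N k x e (real j * mesh G N e) = x (node G N e j)"
proof -
  let ?f = "extension G c N k x" and ?D = "extension_deriv G c N k x"
  have mb: "0 < mesh G N e" "real (N e) * mesh G N e = len G e" "0 < sinq k (mesh G N e)" if "e \<in> edges G" for e
    using mesh_bounds[where N = N and e = e, OF G that N(1)[OF that] N(2)[OF that] k] by auto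
  have fin: "finite (edges G)" using G by (simp add: quantum_graph_def)
  define \<omega> where "\<omega> e = 2 * pi * c $ e" for e
  have phase: "phase G c N e = \<omega> e * mesh G N e" for e by (simp add: phase_def \<omega>_def)
  have on: "on_graph G e (real j * mesh G N e)" if "e \<in> edges G" "j \<le> N e" for e j
  proof -
    have "real j * mesh G N e \<le> real (N e) * mesh G N e" using that mb(1)[OF that(1)] by (intro mult_right_mono) auto
    then show ?thesis using mb[OF that(1)] that(1) by (simp add: on_graph_def)
  qed
  show node_val: "?f e (real j * mesh G N e) = x (node G N e j)" if "e \<in> edges G" "j \<le> N e" for e j
  proof -
    have "?f e (real j * mesh G N e) = cis (- (real j * phase G c N e)) * (cis (real j * phase G c N e) * x (node G N e j))"
      using on[OF that] kernel_node_values[OF G that(1) N k ker that(2)]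
      by (simp add: extension_def phase \<omega>_def mult_ac)
    also have "\<dots> = x (node G N e j)" by (simp only: mult.assoc[symmetric] cis_mult) simp
    finally show ?thesis .
  qed
  have Dderiv: "(?f e has_vector_derivative ?D e y - 2 * of_real pi * \<i> * ?f e y * of_real (c $ e)) (at y within {0..len G e})"
    "(?D e has_vector_derivative - of_real (k\<^sup>2) * ?f e y - 2 * of_real pi * \<i> * ?D e y * of_real (c $ e)) (at y within {0..len G e})"
    if e: "e \<in> edges G" and y: "y \<in> {0..len G e}" for e y
  proof -
    let ?S = "{0..len G e}"
    define A where "A = x (node G N e 0)"
    define b where "b = slope G c N k x e"
    have cis': "((\<lambda>y. cis (- (\<omega> e * y))) has_vector_derivative - \<i> * of_real (\<omega> e) * cis (- (\<omega> e * y))) (at y within ?S)"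
    proof -
      have "((\<lambda>z. exp (- (\<i> * of_real (\<omega> e)) * z)) has_field_derivative - (\<i> * of_real (\<omega> e)) * exp (- (\<i> * of_real (\<omega> e)) * of_real y)) (at (of_real y))"
        by (auto intro!: derivative_eq_intros)
      then have "((\<lambda>y. exp (- (\<i> * of_real (\<omega> e)) * of_real y)) has_vector_derivative - (\<i> * of_real (\<omega> e)) * exp (- (\<i> * of_real (\<omega> e)) * of_real y)) (at y within ?S)"
        by (rule has_vector_derivative_real_field)
      then show ?thesis by (simp add: cis_conv_exp mult.assoc)
    qed
    have sc: "((\<lambda>y. complex_of_real (cos (k * y))) has_vector_derivative of_real (- k\<^sup>2 * sinq k y)) (at y within ?S)"
      "((\<lambda>y. complex_of_real (sinq k y)) has_vector_derivative of_real (cos (k * y))) (at y within ?S)"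
      using sinq_derivs[of k y ?S] has_vector_derivative_of_real by blast+
    have f_eq: "?f e y = cis (- (\<omega> e * y)) * (A * of_real (cos (k * y)) + b * of_real (sinq k y))" if "y \<in> ?S" for y
      using that e by (simp add: extension_def on_graph_def A_def b_def \<omega>_def)
    have D_eq: "?D e y = cis (- (\<omega> e * y)) * (b * of_real (cos (k * y)) - of_real (k\<^sup>2) * A * of_real (sinq k y))" for y
      by (simp add: extension_deriv_def A_def b_def \<omega>_def)
    have "((\<lambda>y. cis (- (\<omega> e * y)) * (A * of_real (cos (k * y)) + b * of_real (sinq k y))) has_vector_derivative
       cis (- (\<omega> e * y)) * (A * of_real (- k\<^sup>2 * sinq k y) + b * of_real (cos (k * y))) +
       - \<i> * of_real (\<omega> e) * cis (- (\<omega> e * y)) * (A * of_real (cos (k * y)) + b * of_real (sinq k y))) (at y within ?S)"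
      by (intro has_vector_derivative_mult has_vector_derivative_add has_vector_derivative_mult_right cis' sc)
    then have "(?f e has_vector_derivative
       cis (- (\<omega> e * y)) * (A * of_real (- k\<^sup>2 * sinq k y) + b * of_real (cos (k * y))) +
       - \<i> * of_real (\<omega> e) * cis (- (\<omega> e * y)) * (A * of_real (cos (k * y)) + b * of_real (sinq k y))) (at y within ?S)"
      by (rule has_vector_derivative_transform[OF y, rotated]) (erule f_eq)
    then show "(?f e has_vector_derivative ?D e y - 2 * of_real pi * \<i> * ?f e y * of_real (c $ e)) (at y within ?S)"
      unfolding f_eq[OF y] D_eq by (simp add: \<omega>_def algebra_simps)
    have "((\<lambda>y. cis (- (\<omega> e * y)) * (b * of_real (cos (k * y)) - of_real (k\<^sup>2) * A * of_real (sinq k y))) has_vector_derivative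
       cis (- (\<omega> e * y)) * (b * of_real (- k\<^sup>2 * sinq k y) - of_real (k\<^sup>2) * A * of_real (cos (k * y))) +
       - \<i> * of_real (\<omega> e) * cis (- (\<omega> e * y)) * (b * of_real (cos (k * y)) - of_real (k\<^sup>2) * A * of_real (sinq k y))) (at y within ?S)"
      by (intro has_vector_derivative_mult has_vector_derivative_diff has_vector_derivative_mult_right cis' sc)
    then show "(?D e has_vector_derivative - of_real (k\<^sup>2) * ?f e y - 2 * of_real pi * \<i> * ?D e y * of_real (c $ e)) (at y within ?S)"
      unfolding f_eq[OF y] D_eq[abs_def] by (simp add: \<omega>_def algebra_simps)
  qed
  have D0: "?D e 0 = slope G c N k x e" for e by (simp add: extension_deriv_def)
  have DL: "?D e (len G e) = of_real (inverse (sinq k (mesh G N e))) *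
      (of_real (cos (k * mesh G N e)) * x (node G N e (N e)) - cis (- phase G c N e) * x (node G N e (N e - 1)))" if e: "e \<in> edges G" for e
  proof -
    define h where "h = mesh G N e"
    define L where "L = len G e"
    define A where "A = x (node G N e 0)"
    define b where "b = slope G c N k x e"
    have L: "real (N e) * h = L" "real (N e - 1) * h = L - h"
      using mb(2)[OF e] N(1)[OF e] by (auto simp: h_def L_def of_nat_diff left_diff_distrib)
    have v: "cis (real j * phase G c N e) * x (node G N e j) =
       A * of_real (cos (k * (real j * h))) + b * of_real (sinq k (real j * h))" if "j \<le> N e" for j
      using kernel_node_values[OF G e N k ker that] by (simp add: A_def b_def h_def)
    have vL: "cis (\<omega> e * L) * x (node G N e (N e)) = A * of_real (cos (k * L)) + b * of_real (sinq k L)"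
    proof -
      have "real (N e) * phase G c N e = \<omega> e * L" unfolding L(1)[symmetric] phase h_def by (simp only: mult_ac)
      then show ?thesis using v[of "N e"] unfolding L(1) by simp
    qed
    have vL': "cis (\<omega> e * L) * cis (- phase G c N e) * x (node G N e (N e - 1)) = A * of_real (cos (k * (L - h))) + b * of_real (sinq k (L - h))"
    proof -
      have "real (N e - 1) * phase G c N e = \<omega> e * L + - phase G c N e"
      proof -
        have "real (N e - 1) * phase G c N e = \<omega> e * (real (N e - 1) * h)" unfolding phase h_def by (simp only: mult_ac)
        then show ?thesis unfolding L(2) by (simp add: phase h_def right_diff_distrib)
      qed
      then show ?thesis using v[of "N e - 1"] unfolding L(2) by (simp add: cis_mult)
    qed
    have "of_real (cos (k * h)) * (A * of_real (cos (k * L)) + b * of_real (sinq k L)) - (A * of_real (cos (k * (L - h))) + b * of_real (sinq k (L - h)))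
       = of_real (sinq k h) * (b * of_real (cos (k * L)) - of_real (k\<^sup>2) * A * of_real (sinq k L))"
      unfolding sinq_diff cos_diff_sinq by (simp add: algebra_simps)
    then have that_eq: "of_real (sinq k h) * (b * of_real (cos (k * L)) - of_real (k\<^sup>2) * A * of_real (sinq k L)) =
      cis (\<omega> e * L) * (of_real (cos (k * h)) * x (node G N e (N e)) - cis (- phase G c N e) * x (node G N e (N e - 1)))"
      unfolding vL[symmetric] vL'[symmetric] by (simp add: algebra_simps)
    have "b * of_real (cos (k * L)) - of_real (k\<^sup>2) * A * of_real (sinq k L) = of_real (inverse (sinq k h)) *
      (cis (\<omega> e * L) * (of_real (cos (k * h)) * x (node G N e (N e)) - cis (- phase G c N e) * x (node G N e (N e - 1))))"
    proof -
      have "of_real (inverse (sinq k h)) * (of_real (sinq k h) * X) = X" for X :: complex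
        using mb(3)[OF e] by (simp add: h_def)
      then show ?thesis using that_eq by metis
    qed
    then have "?D e L = cis (- (\<omega> e * L)) * (of_real (inverse (sinq k h)) *
      (cis (\<omega> e * L) * (of_real (cos (k * h)) * x (node G N e (N e)) - cis (- phase G c N e) * x (node G N e (N e - 1)))))"
      unfolding extension_deriv_def b_def A_def \<omega>_def by simp
    also have "\<dots> = (cis (- (\<omega> e * L)) * cis (\<omega> e * L)) * (of_real (inverse (sinq k h)) *
      (of_real (cos (k * h)) * x (node G N e (N e)) - cis (- phase G c N e) * x (node G N e (N e - 1))))"
      by (simp only: mult_ac)
    also have "cis (- (\<omega> e * L)) * cis (\<omega> e * L) = 1" by (simp add: cis_mult)
    finally show ?thesis by (simp add: h_def L_def)
  qed
  have "flow_balanced G (\<lambda>e. ?D e 0) (\<lambda>e. ?D e (len G e))"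
    unfolding flow_balanced_def
  proof
    fix v assume "v \<in> verts G"
    show "(\<Sum>e\<in>{e \<in> edges G. tgt G e = v}. ?D e (len G e)) = (\<Sum>e\<in>{e \<in> edges G. src G e = v}. ?D e 0)"
    proof (cases "\<exists>e\<in>edges G. src G e = v \<or> tgt G e = v")
      case False
      then have *: "{e \<in> edges G. tgt G e = v} = {}" "{e \<in> edges G. src G e = v} = {}" by blast+
      show ?thesis unfolding * by simp
    next
      case True
      then obtain e where e: "e \<in> edges G" "src G e = v \<or> tgt G e = v" by blast
      have "Inl v = node G N e 0 \<or> Inl v = node G N e (N e)" using e N(1)[OF e(1)] by (auto simp: node_def)
      then have "Inl v \<in> nodes G N" using node_in_nodes[OF e(1), of 0 N] node_in_nodes[OF e(1), of "N e" N] by auto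
      then have 0: "(\<Sum>e\<in>edges G. \<Sum>j<N e. link_term G c N k e (unit_at (node G N e j) (Inl v)) (unit_at (node G N e (Suc j)) (Inl v)) (x (node G N e j)) (x (node G N e (Suc j)))) = 0"
        (is "(\<Sum>e\<in>edges G. \<Sum>j<N e. ?t e j) = 0")
        using ker unfolding node_matrix_apply[OF fin] by blast
      have "(\<Sum>j<N e. ?t e j) = (if tgt G e = v then ?D e (len G e) else 0) - (if src G e = v then ?D e 0 else 0)" if e: "e \<in> edges G" for e
      proof -
        let ?w = "complex_of_real (inverse (sinq k (mesh G N e)))"
        let ?C = "complex_of_real (cos (k * mesh G N e))"
        have "(\<Sum>j<N e. ?t e j) = (\<Sum>j<N e. unit_at (node G N e j) (Inl v) * (?w * (?C * x (node G N e j) - cis (phase G c N e) * x (node G N e (Suc j)))))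
          + (\<Sum>j<N e. unit_at (node G N e (Suc j)) (Inl v) * (?w * (?C * x (node G N e (Suc j)) - cis (- phase G c N e) * x (node G N e j))))"
          unfolding sum.distrib[symmetric] by (intro sum.cong refl) (simp add: algebra_simps)
        also have "(\<Sum>j<N e. unit_at (node G N e j) (Inl v) * (?w * (?C * x (node G N e j) - cis (phase G c N e) * x (node G N e (Suc j)))))
           = (\<Sum>j\<in>{0}. unit_at (node G N e j) (Inl v) * (?w * (?C * x (node G N e j) - cis (phase G c N e) * x (node G N e (Suc j)))))"
          by (rule sum.mono_neutral_right) (use N(1)[OF e] in \<open>auto simp: unit_at_def node_def\<close>)
        also have "\<dots> = - (if src G e = v then ?D e 0 else 0)"
        proof -
          have "unit_at (node G N e 0) (Inl v) = (if src G e = v then 1 else 0)" by (auto simp: unit_at_def node_def)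
          moreover have "?w * (?C * x (node G N e 0) - cis (phase G c N e) * x (node G N e (Suc 0))) = - ?D e 0"
            by (simp add: D0 slope_def divide_inverse algebra_simps)
          ultimately show ?thesis by simp
        qed
        also have "(\<Sum>j<N e. unit_at (node G N e (Suc j)) (Inl v) * (?w * (?C * x (node G N e (Suc j)) - cis (- phase G c N e) * x (node G N e j))))
           = (\<Sum>j\<in>{N e - 1}. unit_at (node G N e (Suc j)) (Inl v) * (?w * (?C * x (node G N e (Suc j)) - cis (- phase G c N e) * x (node G N e j))))"
          by (rule sum.mono_neutral_right) (use N(1)[OF e] in \<open>auto simp: unit_at_def node_def\<close>)
        also have "\<dots> = (if tgt G e = v then ?D e (len G e) else 0)"
        proof -
          have 1: "Suc (N e - 1) = N e" using N(1)[OF e] by simp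
          have 2: "unit_at (node G N e (N e)) (Inl v) = (if tgt G e = v then 1 else 0)"
            using N(1)[OF e] by (auto simp: unit_at_def node_def)
          have "(\<Sum>j\<in>{N e - 1}. unit_at (node G N e (Suc j)) (Inl v) * (?w * (?C * x (node G N e (Suc j)) - cis (- phase G c N e) * x (node G N e j))))
            = unit_at (node G N e (N e)) (Inl v) * ?D e (len G e)"
            unfolding DL[OF e] by (subst sum.insert) (simp_all only: 1 finite.emptyI empty_iff not_False_eq_True sum.empty add_0_right)
          then show ?thesis unfolding 2 by simp
        qed
        finally show ?thesis by simp
      qed
      then have "(\<Sum>e\<in>edges G. (if tgt G e = v then ?D e (len G e) else 0)) - (\<Sum>e\<in>edges G. (if src G e = v then ?D e 0 else 0)) = 0"
        using 0 by (simp add: sum_subtractf)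
      then show ?thesis using fin by (simp add: sum.inter_filter)
    qed
  qed
  moreover have "\<forall>e\<in>edges G. ?f e 0 = x (Inl (src G e)) \<and> ?f e (len G e) = x (Inl (tgt G e))"
  proof
    fix e assume e: "e \<in> edges G"
    have "node G N e 0 = Inl (src G e)" "node G N e (N e) = Inl (tgt G e)" using N(1)[OF e] by (auto simp: node_def)
    then show "?f e 0 = x (Inl (src G e)) \<and> ?f e (len G e) = x (Inl (tgt G e))"
      using node_val[OF e, of 0] node_val[OF e, of "N e"] mb(2)[OF e] by simp
  qed
  moreover have "supported G ?f" by (simp add: supported_def extension_def)
  ultimately show "bloch_pair G c (of_real (k\<^sup>2)) ?f ?D"
    unfolding bloch_pair_def by (intro conjI ballI exI[of _ "\<lambda>v. x (Inl v)"] Dderiv) simp_all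
qed

section \<open>Weyl's law and the total length\<close>

lemma exists_subdivision:
  fixes G :: "('v, 'e::finite) qgraph"
  shows "\<exists>N. \<forall>e. 0 < N e \<and> K * len G e < pi * real (N e)"
proof -
  have "\<exists>n. 0 < n \<and> K * len G e < pi * real n" for e
  proof -
    obtain n where "K * len G e / pi < real n" using reals_Archimedean2 by blast
    then have "K * len G e < pi * real (Suc n)" by (simp add: pos_divide_less_eq algebra_simps) (smt (verit) pi_gt_zero)
    then show ?thesis by blast
  qed
  then show ?thesis by (intro choice allI)
qed

lemma eigenspace_basis:
  fixes G :: "('v, 'e::finite) qgraph"
  assumes G: "quantum_graph G" and c: "c \<in> H1_real G" and k: "0 \<le> k"
  obtains B where "finite B" "CV.independent B" "B \<subseteq> eig_space G c k"
    "eig_space G c k \<subseteq> CV.span B"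
    "card B = eig_mult G c k"
proof -
  let ?V = "eig_space G c k"
  obtain B where B: "B \<subseteq> ?V" "CV.independent B" "?V \<subseteq> CV.span B" "card B = CV.dim ?V"
    using CV.basis_exists[of ?V] by metis
  obtain N where N: "\<forall>e. 0 < N e \<and> (k + 1) * len G e < pi * real (N e)"
    using exists_subdivision[of "k + 1" G] by blast
  have "finite B"
  proof (rule ccontr)
    assume "infinite B"
    then obtain C where C: "C \<subseteq> B" "finite C" "card C = Suc (\<Sum>e\<in>edges G. N e + 1)"
      using infinite_arbitrarily_large by blast
    have "(\<Sum>l\<in>{k}. card C) \<le> (\<Sum>e\<in>edges G. N e + 1)"
      by (rule eigenvalue_count_upper_bound[OF G c, of _ "k + 1"])
        (use C B N k CV.independent_mono[OF B(2) C(1)] in auto)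
    with C(3) show False by simp
  qed
  with B show ?thesis using that unfolding eigen_multiplicity_def by metis
qed

lemma multiplicity_pos_iff:
  assumes G: "quantum_graph G" and c: "c \<in> H1_real G" and k: "0 \<le> k"
  shows "0 < eig_mult G c k \<longleftrightarrow>
     (\<exists>f\<in>eig_space G c k. f \<noteq> 0)"
proof -
  obtain B where B: "finite B" "CV.independent B" "B \<subseteq> eig_space G c k"
    "eig_space G c k \<subseteq> CV.span B"
    "card B = eig_mult G c k"
    by (rule eigenspace_basis[OF assms])
  show ?thesis
  proof
    assume "0 < eig_mult G c k"
    then obtain b where "b \<in> B" using B(5) by (metis card.empty ex_in_conv less_irrefl)
    moreover have "b \<noteq> 0" using \<open>b \<in> B\<close> B(2) CV.dependent_zero by blast
    ultimately show "\<exists>f\<in>eig_space G c k. f \<noteq> 0" using B(3) by blast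
  next
    assume "\<exists>f\<in>eig_space G c k. f \<noteq> 0"
    then have "B \<noteq> {}" using B(4) by (auto simp: CV.span_empty)
    then show "0 < eig_mult G c k" using B(1,5) by (metis card_gt_0_iff)
  qed
qed

text \<open>
  Extension embeds the kernel into the eigenspace, so at most \<open>eig_mult G c k\<close> vectors span the
  kernel, and pairing with them separates its points.
\<close>

lemma kernel_separation:
  fixes G :: "('v, 'e::finite) qgraph"
  assumes G: "quantum_graph G" and c: "c \<in> H1_real G"
    and N: "\<And>e. e \<in> edges G \<Longrightarrow> 0 < N e" "\<And>e. e \<in> edges G \<Longrightarrow> K * len G e < pi * real (N e)" and k: "0 \<le> k" "k \<le> K"
  shows "\<exists>D. \<forall>x. node_kernel G c N k x \<longrightarrow>
     (\<forall>m<eig_mult G c k. (\<Sum>i\<in>nodes G N. D m i * x i) = 0) \<longrightarrow> (\<forall>i\<in>nodes G N. x i = 0)"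
proof -
  let ?E = "eig_space G c k"
  let ?d = "eig_mult G c k"
  have finI: "finite (nodes G N)" using G by (intro finite_nodes) (simp add: quantum_graph_def)
  define Ker where "Ker = {x. node_kernel G c N k x}"
  define V where "V = extension G c N k ` Ker"
  have ext: "extension G c N k x \<in> ?E" "\<And>e j. e \<in> edges G \<Longrightarrow> j \<le> N e \<Longrightarrow> extension G c N k x e (real j * mesh G N e) = x (node G N e j)" if "x \<in> Ker" for x
    using extension_bloch_pair[OF G N k] eigenfunction_if_bloch_pair[OF G c] that unfolding Ker_def by blast+
  obtain B0 where B0: "finite B0" "CV.independent B0" "B0 \<subseteq> ?E" "?E \<subseteq> CV.span B0" "card B0 = ?d"
    by (rule eigenspace_basis[OF G c k(1)])
  obtain B where B: "B \<subseteq> V" "CV.independent B" "V \<subseteq> CV.span B" "card B = CV.dim V"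
    using CV.basis_exists[of V] by metis
  have "V \<subseteq> ?E" using ext(1) by (auto simp: V_def)
  then have "B \<subseteq> CV.span B0" using B(1) B0(4) by blast
  then have fB: "finite B" "card B \<le> ?d" using CV.independent_span_bound[OF B0(1) B(2)] B0(5) by auto
  obtain g where g: "bij_betw g {0..<card B} B" using ex_bij_betw_nat_finite[OF fB(1)] by blast
  have "\<forall>b\<in>B. \<exists>x. x \<in> Ker \<and> extension G c N k x = b" using B(1) unfolding V_def by blast
  then obtain y where y0: "\<forall>b\<in>B. y b \<in> Ker \<and> extension G c N k (y b) = b"
    by (rule bchoice[THEN exE])
  then have y: "y b \<in> Ker \<and> extension G c N k (y b) = b" if "b \<in> B" for b using that by blast
  define D where "D m i = cnj (y (g m) i)" for m i
  show ?thesis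
  proof (intro exI[of _ D] allI impI)
    fix x assume xk: "node_kernel G c N k x"
      and D0: "\<forall>m<?d. (\<Sum>i\<in>nodes G N. D m i * x i) = 0"
    have x: "x \<in> Ker" using xk by (simp add: Ker_def)
    then have "extension G c N k x \<in> CV.span B" using B(3) by (auto simp: V_def)
    then obtain r where r: "extension G c N k x = (\<Sum>b\<in>B. cscale (r b) b)"
      unfolding CV.span_finite[OF fB(1)] by blast
    have xi: "x i = (\<Sum>b\<in>B. r b * y b i)" if "i \<in> nodes G N" for i
    proof -
      obtain e j where ej: "e \<in> edges G" "j \<le> N e" "i = node G N e j" using \<open>i \<in> nodes G N\<close> by (auto simp: nodes_def)
      have "x i = (\<Sum>b\<in>B. cscale (r b) b) e (real j * mesh G N e)"
        using ext(2)[OF x ej(1,2)] r ej(3) by simp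
      also have "\<dots> = (\<Sum>b\<in>B. r b * b e (real j * mesh G N e))"
        by (simp add: sum_fun_apply2 cscale_def)
      also have "\<dots> = (\<Sum>b\<in>B. r b * y b i)"
      proof (intro sum.cong refl)
        fix b assume "b \<in> B"
        then have "b e (real j * mesh G N e) = y b i" using ext(2)[of "y b", OF _ ej(1,2)] y[of b] ej(3) by simp
        then show "r b * b e (real j * mesh G N e) = r b * y b i" by simp
      qed
      finally show ?thesis .
    qed
    have orth: "(\<Sum>i\<in>nodes G N. cnj (y b i) * x i) = 0" if "b \<in> B" for b
    proof -
      have "b \<in> g ` {0..<card B}" using g that by (simp add: bij_betw_def)
      then obtain m where m: "m < card B" "g m = b" by auto
      then have "m < ?d" using fB(2) by simp
      then show ?thesis using D0 m(2) unfolding D_def by blast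
    qed
    have "(\<Sum>i\<in>nodes G N. complex_of_real ((cmod (x i))\<^sup>2)) = (\<Sum>i\<in>nodes G N. \<Sum>b\<in>B. cnj (r b) * (cnj (y b i) * x i))"
    proof (intro sum.cong refl)
      fix i assume i: "i \<in> nodes G N"
      have "complex_of_real ((cmod (x i))\<^sup>2) = cnj (x i) * x i" by (simp add: complex_norm_square[symmetric] mult.commute)
      also have "cnj (x i) = (\<Sum>b\<in>B. cnj (r b) * cnj (y b i))" using xi[OF i] by simp
      finally show "complex_of_real ((cmod (x i))\<^sup>2) = (\<Sum>b\<in>B. cnj (r b) * (cnj (y b i) * x i))"
        by (simp add: sum_distrib_right mult.assoc)
    qed
    also have "\<dots> = (\<Sum>b\<in>B. cnj (r b) * (\<Sum>i\<in>nodes G N. cnj (y b i) * x i))"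
      unfolding sum_distrib_left by (rule sum.swap)
    also have "\<dots> = 0" using orth by simp
    finally have "of_real (\<Sum>i\<in>nodes G N. (cmod (x i))\<^sup>2) = (0::complex)" by simp
    then have "(\<Sum>i\<in>nodes G N. (cmod (x i))\<^sup>2) = 0" by (simp only: of_real_eq_0_iff)
    then show "\<forall>i\<in>nodes G N. x i = 0" using finI by (simp add: sum_nonneg_eq_0_iff)
  qed
qed

text \<open>
  Spectral flow for the path of node matrices, which starts at \<open>k = 0\<close> with a sum of terms
  \<open>|p - cis \<theta> * q|\<^sup>2 / h\<close>.
\<close>

theorem eigenvalue_count_lower_bound:
  fixes G :: "('v, 'e::finite) qgraph"
  assumes G: "quantum_graph G" and c: "c \<in> H1_real G"
    and N: "\<And>e. e \<in> edges G \<Longrightarrow> 0 < N e" "\<And>e. e \<in> edges G \<Longrightarrow> K * len G e < pi * real (N e)" and K: "0 \<le> K"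
    and neg: "neg_family (nodes G N) (node_matrix G c N K) n w"
  shows "\<exists>S. finite S \<and> S \<subseteq> {0..<K} \<and> n \<le> (\<Sum>k\<in>S. eig_mult G c k)"
proof -
  let ?d = "\<lambda>k. eig_mult G c k"
  have fin: "finite (edges G)" using G by (simp add: quantum_graph_def)
  have "\<forall>k. \<exists>D. k \<in> {0..<K} \<longrightarrow> (\<forall>x. node_kernel G c N k x \<longrightarrow>
     (\<forall>m<?d k. (\<Sum>i\<in>nodes G N. D m i * x i) = 0) \<longrightarrow> (\<forall>i\<in>nodes G N. x i = 0))"
    using kernel_separation[where N = N, OF G c N] by simp
  then obtain D where D: "\<forall>k. k \<in> {0..<K} \<longrightarrow> (\<forall>x. node_kernel G c N k x \<longrightarrow>
     (\<forall>m<?d k. (\<Sum>i\<in>nodes G N. D k m i * x i) = 0) \<longrightarrow> (\<forall>i\<in>nodes G N. x i = 0))"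
    by (rule choice[THEN exE])
  show ?thesis
  proof (rule spectral_flow_bound[where H = "node_matrix G c N" and D = D, OF finite_nodes[OF fin] K _ _ _ _ neg])
    show "continuous_on {0..K} (\<lambda>k. node_matrix G c N k i j)" for i j
      by (rule node_matrix_continuous[OF G N])
    show "node_matrix G c N k i j = cnj (node_matrix G c N k j i)" for k i j by (rule node_matrix_hermitian)
    show "0 \<le> Re (hform (nodes G N) (node_matrix G c N 0) x x)" for x
      unfolding Re_node_form[OF fin]
    proof (intro sum_nonneg mult_nonneg_nonneg)
      fix e j assume e: "e \<in> edges G"
      let ?p = "x (node G N e j)" and ?q = "x (node G N e (Suc j))"
      show "0 \<le> inverse (sinq 0 (mesh G N e))" using mesh_bounds(1)[where N = N and e = e, OF G e N(1)[OF e] N(2)[OF e] order.refl K] K by (simp add: sinq_def)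
      have "Re (cnj ?p * cis (phase G c N e) * ?q) \<le> cmod ?p * cmod ?q"
        using complex_Re_le_cmod[of "cnj ?p * cis (phase G c N e) * ?q"] by (simp add: norm_mult)
      moreover have "0 \<le> (cmod ?p - cmod ?q)\<^sup>2" by simp
      ultimately show "0 \<le> cos (0 * mesh G N e) * ((cmod ?p)\<^sup>2 + (cmod ?q)\<^sup>2) - 2 * Re (cnj ?p * cis (phase G c N e) * ?q)"
        by (simp add: power2_diff)
    qed
  qed (use D in blast)
qed

definition total_length :: "('v, 'e) qgraph \<Rightarrow> real" where
  "total_length G = (\<Sum>e\<in>edges G. len G e)"

text \<open>
  Each edge is cut into \<open>2 m\<close> pieces of length \<open>h\<close>, where \<open>m\<close> is the largest integer below
  \<open>K len / \<pi>\<close>. Then \<open>\<pi> / 2 < K h < \<pi>\<close>, so \<open>cos (K h)\<close> is negative and the form is negative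
  definite on the vectors that vanish outside the odd nodes, no two of which are adjacent. There
  are \<open>m\<close> odd nodes on each edge.
\<close>

lemma weyl_lower_bound:
  fixes G :: "('v, 'e::finite) qgraph"
  assumes G: "quantum_graph G" and c: "c \<in> H1_real G" and K: "0 < K" "\<And>e. e \<in> edges G \<Longrightarrow> 2 * pi < K * len G e"
  shows "\<exists>S. finite S \<and> S \<subseteq> {0..<K} \<and>
     (\<Sum>e\<in>edges G. K * len G e / pi - 1) \<le> real (\<Sum>k\<in>S. eig_mult G c k)"
proof -
  have fin: "finite (edges G)" using G by (simp add: quantum_graph_def)
  define m where "m e = nat (\<lceil>K * len G e / pi\<rceil> - 1)" for e
  define N where "N e = 2 * m e" for e
  have m: "K * len G e / pi - 1 \<le> real (m e)" "real (m e) < K * len G e / pi" "K * len G e / pi < 2 * real (m e)" if "e \<in> edges G" for e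
  proof -
    have y: "2 < K * len G e / pi" using K(2)[OF that] by (simp add: pos_less_divide_eq)
    then have "1 \<le> \<lceil>K * len G e / pi\<rceil>" by linarith
    then have "real (m e) = of_int \<lceil>K * len G e / pi\<rceil> - 1" by (simp add: m_def)
    with y show "K * len G e / pi - 1 \<le> real (m e)" "real (m e) < K * len G e / pi" "K * len G e / pi < 2 * real (m e)"
      by linarith+
  qed
  have mpos: "0 < m e" if "e \<in> edges G" for e
  proof -
    have "2 < K * len G e / pi" using K(2)[OF that] by (simp add: pos_less_divide_eq)
    with m(3)[OF that] have "0 < real (m e)" by linarith
    then show ?thesis by simp
  qed
  have N: "0 < N e" "K * len G e < pi * real (N e)" if "e \<in> edges G" for e
    using mpos[OF that] m(3)[OF that] by (auto simp: N_def pos_divide_less_eq mult_ac)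
  define Odd :: "('v + 'e \<times> nat) set" where "Odd = (\<lambda>(e, p). Inr (e, 2 * p + 1)) ` (SIGMA e:edges G. {..<m e})"
  have finO: "finite Odd" using fin by (auto simp: Odd_def)
  have cardO: "card Odd = (\<Sum>e\<in>edges G. m e)"
  proof -
    have "card Odd = card (SIGMA e:edges G. {..<m e})"
      unfolding Odd_def by (rule card_image) (auto simp: inj_on_def)
    then show ?thesis using fin by simp
  qed
  obtain g where g: "bij_betw g {0..<card Odd} Odd" using ex_bij_betw_nat_finite[OF finO] by blast
  have odd_node: "node G N e j \<in> Odd \<longleftrightarrow> odd j" if "e \<in> edges G" "j \<le> N e" for e j
    using that by (auto simp: Odd_def node_def N_def image_iff elim!: oddE)
  have "neg_family (nodes G N) (node_matrix G c N K) (card Odd) (\<lambda>k. unit_at (g k))"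
    unfolding neg_family_def
  proof (intro allI impI)
    fix a :: "nat \<Rightarrow> complex" assume a: "\<exists>k<card Odd. a k \<noteq> 0"
    define x where "x = lin_comb (card Odd) a (\<lambda>k. unit_at (g k))"
    have x0: "x i = 0" if "i \<notin> Odd" for i
    proof -
      have "g k \<noteq> i" if "k < card Odd" for k using g that \<open>i \<notin> Odd\<close> by (auto simp: bij_betw_def)
      then show ?thesis unfolding x_def lin_comb_def by (intro sum.neutral) (auto simp: unit_at_def)
    qed
    have xg: "x (g k) = a k" if "k < card Odd" for k
    proof -
      have "x (g k) = (\<Sum>l<card Odd. if l = k then a k else 0)"
        unfolding x_def lin_comb_def
      proof (intro sum.cong refl)
        fix l assume "l \<in> {..<card Odd}"
        then show "a l * unit_at (g l) (g k) = (if l = k then a k else 0)"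
          using g that by (auto simp: unit_at_def bij_betw_def inj_on_def)
      qed
      then show ?thesis using that by simp
    qed
    obtain i where i: "i \<in> Odd" "x i \<noteq> 0"
      using a xg g by (metis atLeastLessThan_iff bij_betwE zero_le)
    then obtain e0 p where e0: "e0 \<in> edges G" "p < m e0" "i = Inr (e0, 2 * p + 1)" by (auto simp: Odd_def)
    let ?t = "\<lambda>e j. inverse (sinq K (mesh G N e)) * (cos (K * mesh G N e) * ((cmod (x (node G N e j)))\<^sup>2 + (cmod (x (node G N e (Suc j))))\<^sup>2)
        - 2 * Re (cnj (x (node G N e j)) * cis (phase G c N e) * x (node G N e (Suc j))))"
    have coeff: "inverse (sinq K (mesh G N e)) * cos (K * mesh G N e) < 0" if e: "e \<in> edges G" for e
    proof -
      have "K * mesh G N e < pi" using N[OF e] by (simp add: mesh_def field_simps)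
      moreover have "pi / 2 < K * mesh G N e"
        using m(2)[OF e] mpos[OF e] by (simp add: mesh_def N_def field_simps)
      ultimately have "cos (K * mesh G N e) < 0" using cos_monotone_0_pi[of "pi / 2" "K * mesh G N e"] by simp
      moreover have "0 < sinq K (mesh G N e)" using mesh_bounds(3)[where N = N and e = e and K = K and k = K, OF G e N(1)[OF e] N(2)[OF e]] K(1) by simp
      ultimately show ?thesis by (simp add: mult_pos_neg)
    qed
    have t: "?t e j = inverse (sinq K (mesh G N e)) * cos (K * mesh G N e) * ((cmod (x (node G N e j)))\<^sup>2 + (cmod (x (node G N e (Suc j))))\<^sup>2)"
      if "e \<in> edges G" "j < N e" for e j
    proof -
      have "x (node G N e j) = 0 \<or> x (node G N e (Suc j)) = 0"
        using x0 odd_node[of e j] odd_node[of e "Suc j"] that by (cases "odd j") auto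
      then show ?thesis by auto
    qed
    have le: "?t e j \<le> 0" if "e \<in> edges G" "j < N e" for e j
      unfolding t[OF that] by (rule mult_nonpos_nonneg[OF less_imp_le[OF coeff[OF that(1)]]]) simp
    have "node G N e0 (Suc (2 * p)) = i" using e0 by (simp add: node_def N_def)
    then have "0 < (cmod (x (node G N e0 (2 * p))))\<^sup>2 + (cmod (x (node G N e0 (Suc (2 * p)))))\<^sup>2"
      using i(2) by (simp add: add_nonneg_pos)
    moreover have p2: "2 * p < N e0" using e0(2) by (simp add: N_def)
    ultimately have neg1: "?t e0 (2 * p) < 0"
      unfolding t[OF e0(1) p2] by (intro mult_neg_pos[OF coeff[OF e0(1)]])
    have "(\<Sum>j<N e0. ?t e0 j) < (\<Sum>j<N e0. 0)"
    proof (rule sum_strict_mono_ex1)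
      show "\<forall>j\<in>{..<N e0}. ?t e0 j \<le> 0" using le[OF e0(1)] by blast
      show "\<exists>j\<in>{..<N e0}. ?t e0 j < 0" using neg1 p2 by blast
    qed simp
    then have neg2: "(\<Sum>j<N e0. ?t e0 j) < 0" by simp
    have "(\<Sum>e\<in>edges G. \<Sum>j<N e. ?t e j) < (\<Sum>e\<in>edges G. 0)"
    proof (rule sum_strict_mono_ex1[OF fin])
      show "\<forall>e\<in>edges G. (\<Sum>j<N e. ?t e j) \<le> 0" by (intro ballI sum_nonpos le) auto
      show "\<exists>e\<in>edges G. (\<Sum>j<N e. ?t e j) < 0" using neg2 e0(1) by blast
    qed
    then show "Re (hform (nodes G N) (node_matrix G c N K) (lin_comb (card Odd) a (\<lambda>k. unit_at (g k))) (lin_comb (card Odd) a (\<lambda>k. unit_at (g k)))) < 0"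
      unfolding x_def[symmetric] Re_node_form[OF fin] by simp
  qed
  then obtain S where S: "finite S" "S \<subseteq> {0..<K}" "card Odd \<le> (\<Sum>k\<in>S. eig_mult G c k)"
    using eigenvalue_count_lower_bound[where N = N, OF G c N] K(1) by (metis less_imp_le)
  have "(\<Sum>e\<in>edges G. K * len G e / pi - 1) \<le> real (card Odd)"
    unfolding cardO of_nat_sum by (intro sum_mono m(1))
  also have "\<dots> \<le> real (\<Sum>k\<in>S. eig_mult G c k)" using S(3) by (rule of_nat_mono)
  finally show ?thesis using S(1,2) by blast
qed

lemma weyl_upper_bound:
  fixes G :: "('v, 'e::finite) qgraph"
  assumes G: "quantum_graph G" and c: "c \<in> H1_real G" and S: "finite S" "S \<subseteq> {0..<K}" and K: "0 \<le> K"
  shows "real (\<Sum>k\<in>S. eig_mult G c k) \<le> (\<Sum>e\<in>edges G. K * len G e / pi + 2)"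
proof -
  define N where "N e = nat \<lfloor>K * len G e / pi\<rfloor> + 1" for e
  have N: "0 < N e" "K * len G e < pi * real (N e)" "real (N e) \<le> K * len G e / pi + 1" if "e \<in> edges G" for e
  proof -
    have y: "0 \<le> K * len G e / pi" using K quantum_graphD(4)[OF G that] by simp
    then have N: "real (N e) = of_int \<lfloor>K * len G e / pi\<rfloor> + 1" by (simp add: N_def)
    show "0 < N e" by (simp add: N_def)
    have "K * len G e / pi < real (N e)" unfolding N by linarith
    then show "K * len G e < pi * real (N e)" by (simp add: pos_divide_less_eq mult_ac)
    show "real (N e) \<le> K * len G e / pi + 1" unfolding N by linarith
  qed
  have "\<forall>k\<in>S. \<exists>B. finite B \<and> CV.independent B \<and> B \<subseteq> eig_space G c k \<and>
      card B = eig_mult G c k"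
    using eigenspace_basis[OF G c] S(2) by (metis atLeastLessThan_iff subsetD)
  then obtain B where B: "\<forall>k\<in>S. finite (B k) \<and> CV.independent (B k) \<and> B k \<subseteq> eig_space G c k \<and>
      card (B k) = eig_mult G c k"
    using bchoice by metis
  have "(\<Sum>k\<in>S. card (B k)) \<le> (\<Sum>e\<in>edges G. N e + 1)"
    by (rule eigenvalue_count_upper_bound[OF G c S]) (use B N in auto)
  then have "real (\<Sum>k\<in>S. eig_mult G c k) \<le> real (\<Sum>e\<in>edges G. N e + 1)"
    using B by (simp del: of_nat_sum)
  also have "\<dots> \<le> (\<Sum>e\<in>edges G. K * len G e / pi + 2)"
    unfolding of_nat_sum by (intro sum_mono) (use N(3) in force)
  finally show ?thesis .
qed

text \<open>
  The two bounds for the number of eigenvalues differ by \<open>K (L' - L) / \<pi>\<close> up to a constant, which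
  cannot be positive for large \<open>K\<close>.
\<close>

lemma total_length_le_if_isospectral:
  fixes G :: "('v, 'e::finite) qgraph" and G' :: "('w, 'f::finite) qgraph"
  assumes G: "quantum_graph G" "c \<in> H1_real G" and G': "quantum_graph G'" "c' \<in> H1_real G'"
    and eq: "\<And>k. eig_mult G c k = eig_mult G' c' k"
  shows "total_length G' \<le> total_length G"
proof (rule ccontr)
  assume "\<not> ?thesis"
  then have gap: "0 < total_length G' - total_length G" by simp
  define C where "C = 2 * real (card (edges G)) + real (card (edges G'))"
  define K where "K = max (Max (insert 1 ((\<lambda>e. 2 * pi / len G' e + 1) ` edges G'))) (pi * (C + 1) / (total_length G' - total_length G))"
  have fin: "finite (edges G')" using G'(1) by (simp add: quantum_graph_def)
  have "1 \<le> Max (insert 1 ((\<lambda>e. 2 * pi / len G' e + 1) ` edges G'))" using fin by simp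
  then have K1: "1 \<le> K" unfolding K_def by (rule max.coboundedI1)
  have K2: "2 * pi < K * len G' e" if e: "e \<in> edges G'" for e
  proof -
    have "2 * pi / len G' e + 1 \<le> K" unfolding K_def using fin e by (intro max.coboundedI1 Max_ge) auto
    then have "2 * pi / len G' e < K" by simp
    then show ?thesis using quantum_graphD(3)[OF G'(1) e] by (simp add: pos_divide_less_eq)
  qed
  obtain S where S: "finite S" "S \<subseteq> {0..<K}"
    "(\<Sum>e\<in>edges G'. K * len G' e / pi - 1) \<le> real (\<Sum>k\<in>S. eig_mult G' c' k)"
    using weyl_lower_bound[OF G' _ K2] K1 by force
  note S(3)
  also have "real (\<Sum>k\<in>S. eig_mult G' c' k) \<le> (\<Sum>e\<in>edges G. K * len G e / pi + 2)"
    unfolding eq[symmetric] using K1 by (intro weyl_upper_bound[OF G S(1,2)]) simp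
  finally have "K * total_length G' / pi - real (card (edges G')) \<le> K * total_length G / pi + 2 * real (card (edges G))"
    by (simp add: sum_subtractf sum.distrib total_length_def sum_distrib_left sum_divide_distrib)
  then have "K * (total_length G' - total_length G) / pi \<le> C"
    by (simp add: C_def right_diff_distrib diff_divide_distrib)
  moreover have "pi * (C + 1) / (total_length G' - total_length G) \<le> K" by (simp add: K_def)
  then have "C + 1 \<le> K * (total_length G' - total_length G) / pi"
    using gap by (simp add: pos_divide_le_eq pos_le_divide_eq mult_ac)
  ultimately show False by simp
qed

section \<open>The bottom of the Bloch spectrum near the trivial class\<close>

text \<open>
  The inner product of the harmonic forms with constant coefficients \<open>c\<close> and \<open>d\<close>; it also turns
  out to be the dual inner product of \<open>c\<close> and \<open>d\<close> as cycles.
\<close>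

definition len_inner :: "('v, 'e::finite) qgraph \<Rightarrow> real ^ 'e \<Rightarrow> real ^ 'e \<Rightarrow> real" where
  "len_inner G c d = (\<Sum>e\<in>edges G. len G e * (c $ e * d $ e))"

lemma total_length_nonneg: "quantum_graph G \<Longrightarrow> 0 \<le> total_length G"
  unfolding total_length_def by (intro sum_nonneg quantum_graphD(4))

lemma len_le_total_length: "quantum_graph G \<Longrightarrow> e \<in> edges G \<Longrightarrow> len G e \<le> total_length G"
  unfolding total_length_def by (intro member_le_sum quantum_graphD(4)) (auto simp: quantum_graph_def)

lemma len_inner_le_norm:
  assumes "quantum_graph G" shows "len_inner G c c \<le> total_length G * (norm c)\<^sup>2"
proof -
  have "len G e * (c $ e * c $ e) \<le> len G e * (norm c)\<^sup>2" if "e \<in> edges G" for e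
  proof -
    have "\<bar>c $ e\<bar>\<^sup>2 \<le> (norm c)\<^sup>2" using component_le_norm_cart[of c e] by (intro power_mono) auto
    then show ?thesis using quantum_graphD(4)[OF assms that] by (intro mult_left_mono) (auto simp: power2_eq_square)
  qed
  then show ?thesis unfolding len_inner_def total_length_def sum_distrib_right by (rule sum_mono)
qed

lemma len_inner_nonneg: "quantum_graph G \<Longrightarrow> 0 \<le> len_inner G c c"
  unfolding len_inner_def by (intro sum_nonneg mult_nonneg_nonneg[OF quantum_graphD(4) zero_le_square])

lemma tan_half_bound:
  assumes "0 < x" "x < pi"
  shows "x * sin x \<le> 2 - 2 * cos x"
proof -
  define t where "t = x / 2"
  have "0 < t" "t < pi / 2" using assms by (auto simp: t_def)
  then have "0 < cos t" "t \<le> tan t" using abs_tan_ge[of t] tan_gt_zero[of t] by (auto intro: cos_gt_zero)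
  then have "t * cos t \<le> sin t" by (simp add: tan_def pos_le_divide_eq)
  moreover have "0 \<le> sin t" using assms by (intro sin_ge_zero) (auto simp: t_def)
  ultimately have "4 * sin t * (t * cos t) \<le> 4 * sin t * sin t" by (intro mult_left_mono) auto
  moreover have "x * sin x = 4 * sin t * (t * cos t)" "2 - 2 * cos x = 4 * sin t * sin t"
    using sin_double[of t] cos_double_sin[of t] by (auto simp: t_def power2_eq_square)
  ultimately show ?thesis by simp
qed

lemma one_minus_cos_bound: "2 - 2 * cos (x::real) \<le> x\<^sup>2"
proof -
  have "2 - 2 * cos x = 4 * (sin (x / 2))\<^sup>2" using cos_double_sin[of "x / 2"] by simp
  also have "\<dots> \<le> 4 * (x / 2)\<^sup>2" using abs_sin_x_le_abs_x[of "x / 2", unfolded abs_le_square_iff] by (intro mult_left_mono) auto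
  finally show ?thesis by (simp add: power2_eq_square)
qed

lemma sin_almost_linear:
  assumes "0 < \<epsilon>" shows "\<exists>\<eta>>0. \<eta> < pi \<and> (\<forall>t. 0 < t \<and> t < \<eta> \<longrightarrow> t \<le> (1 + \<epsilon>) * sin t)"
proof -
  have "(\<lambda>h. sin h / h) \<midarrow>0\<rightarrow> (1::real)" using DERIV_sin[of "0::real"] by (simp add: DERIV_def)
  moreover have "inverse (1 + \<epsilon>) < 1" using assms by (simp add: inverse_less_1_iff)
  ultimately have "\<forall>\<^sub>F h in at 0. inverse (1 + \<epsilon>) < sin h / h" by (rule order_tendstoD)
  then obtain d where d: "d > 0" "\<And>h. h \<noteq> 0 \<Longrightarrow> dist h 0 < d \<Longrightarrow> inverse (1 + \<epsilon>) < sin h / h"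
    unfolding eventually_at by auto
  have "t \<le> (1 + \<epsilon>) * sin t" if "0 < t" "t < min d 1" for t
  proof -
    have "inverse (1 + \<epsilon>) < sin t / t" using d(2)[of t] that by simp
    then have "inverse (1 + \<epsilon>) * t < sin t" using that by (simp add: pos_less_divide_eq)
    then have "(1 + \<epsilon>) * (inverse (1 + \<epsilon>) * t) \<le> (1 + \<epsilon>) * sin t" using assms by (intro mult_left_mono) auto
    moreover have "(1 + \<epsilon>) * (inverse (1 + \<epsilon>) * t) = t" using assms by (simp only: mult.assoc[symmetric]) simp
    ultimately show ?thesis by simp
  qed
  then show ?thesis using d(1) pi_gt3 by (intro exI[of _ "min d 1"]) auto
qed

text \<open>
  With one piece for each edge and \<open>K\<^sup>2\<close> slightly above the Rayleigh quotient \<open>4 \<pi>\<^sup>2 <c, c> / L\<close>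
  of the constant functions, the node form is negative on the constant vector. The factor \<open>1 + \<epsilon>\<close>
  absorbs the difference between \<open>sin (K l)\<close> and \<open>K l\<close>.
\<close>

lemma small_eigenvalue_exists:
  fixes G :: "('v, 'e::finite) qgraph"
  assumes G: "quantum_graph G" and \<epsilon>: "0 < \<epsilon>"
  shows "\<exists>\<delta>>0. \<forall>c\<in>H1_real G. 0 < len_inner G c c \<longrightarrow> norm c < \<delta> \<longrightarrow>
    (\<exists>k\<ge>0. k\<^sup>2 * total_length G \<le> (1 + \<epsilon>) * (4 * pi\<^sup>2 * len_inner G c c) \<and>
       0 < eig_mult G c k)"
proof -
  define L where "L = total_length G"
  have L0: "0 \<le> L" unfolding L_def by (rule total_length_nonneg[OF G])
  have fin: "finite (edges G)" using G by (simp add: quantum_graph_def)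
  obtain \<eta> where \<eta>: "0 < \<eta>" "\<eta> < pi" "\<And>t. 0 < t \<Longrightarrow> t < \<eta> \<Longrightarrow> t \<le> (1 + \<epsilon> / 2) * sin t"
    using sin_almost_linear[of "\<epsilon> / 2"] \<epsilon> by auto
  define \<delta> where "\<delta> = \<eta> / ((1 + \<epsilon>) * (2 * pi) * (L + 1))"
  have \<delta>: "0 < \<delta>" unfolding \<delta>_def using \<eta> \<epsilon> L0 by (intro divide_pos_pos mult_pos_pos) auto
  have "\<exists>k\<ge>0. k\<^sup>2 * L \<le> (1 + \<epsilon>) * (4 * pi\<^sup>2 * len_inner G c c) \<and> 0 < eig_mult G c k"
    if c: "c \<in> H1_real G" and Q: "0 < len_inner G c c" and small: "norm c < \<delta>" for c
  proof -
    have Lpos: "0 < L"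
    proof (rule ccontr)
      assume "\<not> 0 < L"
      then have "len_inner G c c \<le> 0" using len_inner_le_norm[OF G, of c] L0 by (simp add: L_def)
      with Q show False by simp
    qed
    define K where "K = sqrt ((1 + \<epsilon>) * (4 * pi\<^sup>2 * len_inner G c c) / L)"
    have K2: "K\<^sup>2 = (1 + \<epsilon>) * (4 * pi\<^sup>2 * len_inner G c c) / L" unfolding K_def using Q \<epsilon> Lpos by simp
    have Kpos: "0 < K" unfolding K_def using Q \<epsilon> Lpos by simp
    have "K \<le> (1 + \<epsilon>) * (2 * pi) * norm c"
    proof (rule power2_le_imp_le)
      have "K\<^sup>2 \<le> (1 + \<epsilon>) * (4 * pi\<^sup>2 * (L * (norm c)\<^sup>2)) / L"
        unfolding K2 using len_inner_le_norm[OF G, of c] \<epsilon> Lpos by (intro divide_right_mono mult_left_mono) (auto simp: L_def)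
      also have "\<dots> = (1 + \<epsilon>) * (4 * pi\<^sup>2 * (norm c)\<^sup>2)" using Lpos by simp
      also have "\<dots> \<le> (1 + \<epsilon>)\<^sup>2 * (4 * pi\<^sup>2 * (norm c)\<^sup>2)"
        using \<epsilon> by (intro mult_right_mono) (auto simp: power2_eq_square)
      finally show "K\<^sup>2 \<le> ((1 + \<epsilon>) * (2 * pi) * norm c)\<^sup>2" by (simp add: power_mult_distrib)
    qed (use \<epsilon> in simp)
    also have "\<dots> < (1 + \<epsilon>) * (2 * pi) * \<delta>" using small \<epsilon> by (intro mult_strict_left_mono) auto
    also have "\<dots> = \<eta> / (L + 1)"
    proof -
      define A where "A = (1 + \<epsilon>) * (2 * pi)"
      have "0 < A" using \<epsilon> by (simp add: A_def)
      then show ?thesis unfolding \<delta>_def A_def[symmetric] by simp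
    qed
    finally have "K * (L + 1) < \<eta>" using L0 by (simp add: pos_less_divide_eq)
    then have KL: "K * L < \<eta>" using Kpos by (simp add: algebra_simps)
    have Kl: "K * len G e < \<eta>" if "e \<in> edges G" for e
    proof -
      have "K * len G e \<le> K * L" using len_le_total_length[OF G that] Kpos by (simp add: L_def)
      with KL show ?thesis by simp
    qed
    define N :: "'e \<Rightarrow> nat" where "N = (\<lambda>_. 1)"
    have N: "0 < N e" "K * len G e < pi * real (N e)" if "e \<in> edges G" for e
      using Kl[OF that] \<eta>(2) by (auto simp: N_def)
    have mesh: "mesh G N e = len G e" for e by (simp add: mesh_def N_def)
    have edge_term: "inverse (sinq K (len G e)) * (2 * cos (K * len G e) - 2 * cos (phase G c N e))
        \<le> (1 + \<epsilon> / 2) * (4 * pi\<^sup>2) * (len G e * (c $ e * c $ e)) - K\<^sup>2 * len G e" if e: "e \<in> edges G" for e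
    proof -
      define l where "l = len G e"
      define s where "s = sinq K l"
      have l: "0 < l" using quantum_graphD(3)[OF G e] by (simp add: l_def)
      have Kl0: "0 < K * l" "K * l < \<eta>" using Kpos l Kl[OF e] by (auto simp: l_def)
      have s: "s = sin (K * l) / K" using Kpos by (simp add: s_def sinq_def)
      have spos: "0 < s" unfolding s_def using Kpos l Kl0 \<eta>(2) by (intro sinq_pos) auto
      have "K * l \<le> (1 + \<epsilon> / 2) * sin (K * l)" using \<eta>(3) Kl0 by blast
      then have "l \<le> (1 + \<epsilon> / 2) * s" using Kpos by (simp add: s field_simps)
      then have "inverse s \<le> (1 + \<epsilon> / 2) / l" using spos l by (simp add: field_simps)
      then have "inverse s * (2 - 2 * cos (phase G c N e)) \<le> (1 + \<epsilon> / 2) / l * (phase G c N e)\<^sup>2"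
        using one_minus_cos_bound[of "phase G c N e"] spos l \<epsilon> by (intro mult_mono) auto
      also have "\<dots> = (1 + \<epsilon> / 2) * (4 * pi\<^sup>2) * (l * (c $ e * c $ e))"
        using l by (simp add: phase_def mesh l_def[symmetric] power2_eq_square field_simps)
      finally have 1: "inverse s * (2 - 2 * cos (phase G c N e)) \<le> (1 + \<epsilon> / 2) * (4 * pi\<^sup>2) * (l * (c $ e * c $ e))" .
      have "K * l * sin (K * l) \<le> 2 - 2 * cos (K * l)" using Kl0 \<eta>(2) by (intro tan_half_bound) auto
      then have "inverse s * (K * l * sin (K * l)) \<le> inverse s * (2 - 2 * cos (K * l))" using spos by (intro mult_left_mono) auto
      moreover have "inverse s * (K * l * sin (K * l)) = K\<^sup>2 * l"
      proof -
        have "sin (K * l) = K * s" using Kpos by (simp add: s)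
        then show ?thesis using spos by (simp add: power2_eq_square)
      qed
      ultimately show ?thesis using 1 unfolding l_def[symmetric] s_def[symmetric] by (simp add: right_diff_distrib)
    qed
    have "neg_family (nodes G N) (node_matrix G c N K) 1 (\<lambda>_ _. 1)"
      unfolding neg_family_def
    proof (intro allI impI)
      fix a :: "nat \<Rightarrow> complex" assume "\<exists>k<1. a k \<noteq> 0"
      then have a: "a 0 \<noteq> 0" by auto
      have x: "lin_comb 1 a (\<lambda>_ _. 1) = (\<lambda>i. a 0)" by (auto simp: lin_comb_def fun_eq_iff)
      have cs: "Re (cnj p * cis \<theta> * p) = (cmod p)\<^sup>2 * cos \<theta>" for p \<theta>
        unfolding cmod_power2 by (simp add: power2_eq_square algebra_simps)
      have "Re (hform (nodes G N) (node_matrix G c N K) (\<lambda>i. a 0) (\<lambda>i. a 0)) =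
          (cmod (a 0))\<^sup>2 * (\<Sum>e\<in>edges G. inverse (sinq K (len G e)) * (2 * cos (K * len G e) - 2 * cos (phase G c N e)))"
        unfolding Re_node_form[OF fin] sum_distrib_left
        by (intro sum.cong refl) (simp only: mesh cs, simp add: N_def algebra_simps)
      also have "\<dots> < 0"
      proof (rule mult_pos_neg)
        have "(\<Sum>e\<in>edges G. inverse (sinq K (len G e)) * (2 * cos (K * len G e) - 2 * cos (phase G c N e)))
           \<le> (\<Sum>e\<in>edges G. (1 + \<epsilon> / 2) * (4 * pi\<^sup>2) * (len G e * (c $ e * c $ e)) - K\<^sup>2 * len G e)"
          by (rule sum_mono[OF edge_term])
        also have "\<dots> = (1 + \<epsilon> / 2) * (4 * pi\<^sup>2) * len_inner G c c - K\<^sup>2 * L"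
          by (simp add: sum_subtractf len_inner_def L_def total_length_def sum_distrib_left)
        also have "K\<^sup>2 * L = (1 + \<epsilon>) * (4 * pi\<^sup>2 * len_inner G c c)" unfolding K2 using Lpos by simp
        also have "(1 + \<epsilon> / 2) * (4 * pi\<^sup>2) * len_inner G c c - (1 + \<epsilon>) * (4 * pi\<^sup>2 * len_inner G c c) = - (\<epsilon> / 2 * (4 * pi\<^sup>2 * len_inner G c c))"
          by (simp add: algebra_simps)
        also have "\<dots> < 0" using \<epsilon> Q by simp
        finally show "(\<Sum>e\<in>edges G. inverse (sinq K (len G e)) * (2 * cos (K * len G e) - 2 * cos (phase G c N e))) < 0" .
      qed (use a in simp)
      finally show "Re (hform (nodes G N) (node_matrix G c N K) (lin_comb 1 a (\<lambda>_ _. 1)) (lin_comb 1 a (\<lambda>_ _. 1))) < 0"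
        unfolding x .
    qed
    then obtain S where S: "finite S" "S \<subseteq> {0..<K}" "1 \<le> (\<Sum>k\<in>S. eig_mult G c k)"
      using eigenvalue_count_lower_bound[where N = N, OF G c N less_imp_le[OF Kpos]] by blast
    then have "(\<Sum>k\<in>S. eig_mult G c k) \<noteq> 0" by linarith
    then obtain k where k: "k \<in> S" "eig_mult G c k \<noteq> 0"
      by (meson sum.neutral)
    have k0: "0 \<le> k" "k < K" using k(1) S(2) by auto
    then have "k\<^sup>2 * L \<le> K\<^sup>2 * L" using L0 by (intro mult_right_mono power_mono) auto
    also have "\<dots> = (1 + \<epsilon>) * (4 * pi\<^sup>2 * len_inner G c c)" unfolding K2 using Lpos by simp
    finally show ?thesis using k k0 by (intro exI[of _ k]) auto
  qed
  then show ?thesis using \<delta> unfolding L_def by (intro exI[of _ \<delta>]) blast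
qed

lemma walk_length_bound:
  assumes "quantum_graph G"
  shows "\<exists>R. \<forall>u\<in>verts G. \<forall>w\<in>verts G. \<exists>ss. walk G u ss w \<and> length ss \<le> R"
proof -
  define p where "p u w = (SOME ss. walk G u ss w)" for u w
  have fin: "finite (verts G)" using assms by (simp add: quantum_graph_def)
  have p: "walk G u (p u w) w" if "u \<in> verts G" "w \<in> verts G" for u w
    unfolding p_def using assms that by (intro someI_ex[of "\<lambda>ss. walk G u ss w"]) (auto simp: quantum_graph_def)
  have "length (p u w) \<le> (\<Sum>(u, w)\<in>verts G \<times> verts G. length (p u w))" if "u \<in> verts G" "w \<in> verts G" for u w
    using member_le_sum[of "(u, w)" "verts G \<times> verts G" "\<lambda>(u, w). length (p u w)"] that fin by auto
  with p show ?thesis by blast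
qed

lemma walk_oscillation:
  fixes val :: "'v \<Rightarrow> complex"
  assumes "\<And>e. e \<in> edges G \<Longrightarrow> norm (val (src G e) - val (tgt G e)) \<le> \<eta>" "walk G u ss w"
  shows "norm (val u - val w) \<le> real (length ss) * \<eta>"
  using assms(2)
proof (induction ss arbitrary: u)
  case Nil
  then show ?case by simp
next
  case (Cons s ss)
  obtain e b where s: "s = (e, b)" by (cases s)
  have e: "e \<in> edges G" and u: "step_start G s = u" and w: "walk G (step_end G s) ss w" using Cons.prems s by auto
  have "norm (val u - val w) \<le> norm (val u - val (step_end G s)) + norm (val (step_end G s) - val w)"
    using norm_triangle_ineq[of "val u - val (step_end G s)" "val (step_end G s) - val w"] by simp
  moreover have "norm (val u - val (step_end G s)) \<le> \<eta>"
    using assms(1)[OF e] u s by (cases b) (auto simp: norm_minus_commute)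
  ultimately show ?case using Cons.IH[OF w] by (simp add: algebra_simps)
qed

text \<open>
  Along an edge \<open>|f'| \<le> |D| + 2 \<pi> |c|\<close>, and the inequality \<open>|D| \<le> \<tau> / 2 + |D|\<^sup>2 / (2 \<tau>)\<close> bounds
  the integral of \<open>|D|\<close> by the energy, which is \<open>z\<close> times the squared norm of \<open>f\<close>.
\<close>

lemma eigenfunction_oscillation:
  fixes G :: "('v, 'e::finite) qgraph"
  assumes G: "quantum_graph G" and bp: "bloch_pair G c (of_real z) f D" and \<tau>: "0 < \<tau>" "2 * pi * norm c \<le> \<tau>" "z \<le> \<tau>\<^sup>2" "0 \<le> z"
    and bd: "\<And>e x. e \<in> edges G \<Longrightarrow> x \<in> {0..len G e} \<Longrightarrow> norm (f e x) \<le> 1"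
    and e: "e \<in> edges G" and xy: "0 \<le> x" "x \<le> y" "y \<le> len G e"
  shows "norm (f e y - f e x) \<le> 2 * \<tau> * total_length G"
proof -
  define L where "L = total_length G"
  note ec = bloch_pair_edge_continuous[OF bp]
  have nf: "norm_sq G f \<le> L"
    unfolding norm_sq_def L_def total_length_def
  proof (rule sum_mono)
    fix e assume e: "e \<in> edges G"
    have "integral {0..len G e} (\<lambda>x. (cmod (f e x))\<^sup>2) \<le> integral {0..len G e} (\<lambda>x. 1)"
      using integrable_on_graph(2)[OF ec(1) ec(1) e] bd[OF e] by (intro integral_le) (auto simp: power_le_one)
    then show "integral {0..len G e} (\<lambda>x. (cmod (f e x))\<^sup>2) \<le> len G e" using quantum_graphD(4)[OF G e] by simp
  qed
  have "norm_sq G D = z * norm_sq G f"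
    using bloch_pair_energy[OF G bp] by (simp only: of_real_mult[symmetric] of_real_eq_iff)
  also have "\<dots> \<le> \<tau>\<^sup>2 * L" using nf \<tau> norm_sq_nonneg[OF ec(1)] by (intro mult_mono) auto
  finally have nD: "norm_sq G D \<le> \<tau>\<^sup>2 * L" .
  have iD: "(\<lambda>x. (cmod (D e x))\<^sup>2) integrable_on {0..len G e}" by (rule integrable_on_graph(2)[OF ec(2) ec(2) e])
  have iDxy: "(\<lambda>x. (cmod (D e x))\<^sup>2) integrable_on {x..y}" by (rule integrable_subinterval_real[OF iD]) (use xy in auto)
  have "integral {x..y} (\<lambda>x. (cmod (D e x))\<^sup>2) \<le> integral {0..len G e} (\<lambda>x. (cmod (D e x))\<^sup>2)"
    using xy by (intro integral_subset_le iD iDxy) auto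
  also have "\<dots> \<le> norm_sq G D"
    unfolding norm_sq_def
    by (rule member_le_sum) (use e G Henstock_Kurzweil_Integration.integral_nonneg[OF integrable_on_graph(2)[OF ec(2) ec(2)]] in \<open>auto simp: quantum_graph_def\<close>)
  finally have ID: "integral {x..y} (\<lambda>x. (cmod (D e x))\<^sup>2) \<le> \<tau>\<^sup>2 * L" using nD by simp
  let ?f' = "\<lambda>x. D e x - 2 * of_real pi * \<i> * f e x * of_real (c $ e)"
  have f': "(?f' has_integral (f e y - f e x)) {x..y}"
    using xy by (intro fundamental_theorem_of_calculus)
      (auto intro!: has_vector_derivative_within_subset[OF bloch_pair_derivs(1)[OF bp e]])
  have bound: "norm (?f' s) \<le> 3 * \<tau> / 2 + (cmod (D e s))\<^sup>2 / (2 * \<tau>)" if "s \<in> {x..y}" for s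
  proof -
    have "norm (2 * of_real pi * \<i> * f e s * of_real (c $ e)) = 2 * pi * \<bar>c $ e\<bar> * norm (f e s)"
      by (simp add: norm_mult)
    also have "\<dots> \<le> 2 * pi * norm c * 1"
      using component_le_norm_cart[of c e] bd[OF e, of s] that xy by (intro mult_mono) auto
    finally have 1: "norm (2 * of_real pi * \<i> * f e s * of_real (c $ e)) \<le> \<tau>" using \<tau> by simp
    have "0 \<le> (cmod (D e s) - \<tau>)\<^sup>2" by simp
    then have "2 * \<tau> * cmod (D e s) \<le> \<tau>\<^sup>2 + (cmod (D e s))\<^sup>2" by (simp add: power2_diff algebra_simps)
    then have "cmod (D e s) \<le> \<tau> / 2 + (cmod (D e s))\<^sup>2 / (2 * \<tau>)" using \<tau>(1) by (simp add: field_simps power2_eq_square)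
    with 1 show ?thesis using norm_triangle_ineq4[of "D e s" "2 * of_real pi * \<i> * f e s * of_real (c $ e)"] by linarith
  qed
  have int: "((\<lambda>s. 3 * \<tau> / 2 + (cmod (D e s))\<^sup>2 / (2 * \<tau>)) has_integral
      (y - x) * (3 * \<tau> / 2) + integral {x..y} (\<lambda>x. (cmod (D e x))\<^sup>2) / (2 * \<tau>)) {x..y}"
    using has_integral_add[OF has_integral_const_real[of "3 * \<tau> / 2" x y] has_integral_divide[OF integrable_integral[OF iDxy], of "2 * \<tau>"]] xy
    by simp
  have "norm (f e y - f e x) \<le> (y - x) * (3 * \<tau> / 2) + integral {x..y} (\<lambda>x. (cmod (D e x))\<^sup>2) / (2 * \<tau>)"
    using integral_norm_bound_integral[OF has_integral_integrable[OF f'] has_integral_integrable[OF int] bound]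
      integral_unique[OF f'] integral_unique[OF int] by simp
  also have "\<dots> \<le> L * (3 * \<tau> / 2) + \<tau>\<^sup>2 * L / (2 * \<tau>)"
    using \<tau>(1) ID len_le_total_length[OF G e] xy by (intro add_mono mult_right_mono divide_right_mono) (auto simp: L_def)
  also have "\<dots> = 2 * \<tau> * L" using \<tau>(1) by (simp add: field_simps power2_eq_square)
  finally show ?thesis by (simp add: L_def)
qed


text \<open>
  Let the eigenfunction have the value \<open>1\<close> at a point of maximal modulus. If \<open>c\<close> and \<open>k\<close> are
  small, it oscillates little along each edge, hence it is close to \<open>1\<close> on the whole connected
  graph. Testing it against the constant function \<open>1\<close> in Green's formula gives
  \<open>k\<^sup>2 * \<Sum>e. \<integral>f = \<Sum>e. (2 \<pi> c e)\<^sup>2 * \<integral>f\<close> with integrals over the edges \<open>e\<close>, and the integral over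
  \<open>e\<close> is close to the length of \<open>e\<close>.
\<close>

lemma eigenvalues_bounded_below:
  fixes G :: "('v, 'e::finite) qgraph"
  assumes G: "quantum_graph G" and \<epsilon>: "0 < \<epsilon>"
  shows "\<exists>\<delta>>0. \<forall>c\<in>H1_real G. norm c < \<delta> \<longrightarrow> (\<forall>k\<ge>0.
      0 < eig_mult G c k \<longrightarrow>
      (1 - \<epsilon>) * (4 * pi\<^sup>2 * len_inner G c c) \<le> k\<^sup>2 * total_length G)"
proof -
  define L where "L = total_length G"
  have L0: "0 \<le> L" unfolding L_def by (rule total_length_nonneg[OF G])
  have fin: "finite (edges G)" using G by (simp add: quantum_graph_def)
  obtain R where R: "\<And>u w. u \<in> verts G \<Longrightarrow> w \<in> verts G \<Longrightarrow> \<exists>ss. walk G u ss w \<and> length ss \<le> R"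
    using walk_length_bound[OF G] by blast
  define \<delta> where "\<delta> = \<epsilon> / (8 * pi * (real R + 2) * (L + 1))"
  have \<delta>: "0 < \<delta>" unfolding \<delta>_def using \<epsilon> L0 by (intro divide_pos_pos mult_pos_pos) auto
  have "(1 - \<epsilon>) * (4 * pi\<^sup>2 * len_inner G c c) \<le> k\<^sup>2 * L"
    if c: "c \<in> H1_real G" and small: "norm c < \<delta>" and k: "0 \<le> k"
      and ev: "0 < eig_mult G c k" for c k
  proof (cases "4 * pi\<^sup>2 * len_inner G c c \<le> k\<^sup>2 * L")
    case True
    have "(1 - \<epsilon>) * (4 * pi\<^sup>2 * len_inner G c c) \<le> 1 * (4 * pi\<^sup>2 * len_inner G c c)"
      using \<epsilon> len_inner_nonneg[OF G, of c] by (intro mult_right_mono) auto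
    with True show ?thesis by linarith
  next
    case False
    define \<tau> where "\<tau> = 2 * pi * norm c"
    have "k\<^sup>2 * L < 4 * pi\<^sup>2 * (L * (norm c)\<^sup>2)"
    proof -
      have "4 * pi\<^sup>2 * len_inner G c c \<le> 4 * pi\<^sup>2 * (L * (norm c)\<^sup>2)"
        using len_inner_le_norm[OF G, of c] by (intro mult_left_mono) (auto simp: L_def)
      with False show ?thesis by linarith
    qed
    then have kL: "k\<^sup>2 * L < \<tau>\<^sup>2 * L" by (simp add: \<tau>_def power_mult_distrib mult_ac)
    then have Lpos: "0 < L" using L0 by (cases "L = 0") auto
    with kL have k\<tau>: "k\<^sup>2 \<le> \<tau>\<^sup>2" by simp
    have "\<tau> \<noteq> 0" using kL k Lpos by (auto simp: not_less)
    then have \<tau>: "0 < \<tau>" by (simp add: \<tau>_def)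
    obtain f0 where f0: "f0 \<in> eig_space G c k" "f0 \<noteq> 0"
      using ev multiplicity_pos_iff[OF G c k] by blast
    define D0 where "D0 = magnetic_deriv G (constant_form G c) f0"
    have bp0: "bloch_pair G c (of_real (k\<^sup>2)) f0 D0" unfolding D0_def by (rule bloch_pair_if_eigenfunction[OF G c f0(1)])
    have sup0: "supported G f0" using bp0 by (simp add: bloch_pair_def)
    obtain e1 x1 where "f0 e1 x1 \<noteq> 0" using f0(2) by (auto simp: fun_eq_iff)
    then have e1: "e1 \<in> edges G" "x1 \<in> {0..len G e1}" "f0 e1 x1 \<noteq> 0"
      using sup0 unfolding supported_def on_graph_def by blast+
    have "\<forall>e\<in>edges G. \<exists>x. x \<in> {0..len G e} \<and> (\<forall>y\<in>{0..len G e}. cmod (f0 e y) \<le> cmod (f0 e x))"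
    proof
      fix e assume e: "e \<in> edges G"
      have "continuous_on {0..len G e} (\<lambda>y. cmod (f0 e y))"
        using bloch_pair_edge_continuous(1)[OF bp0] e by (intro continuous_intros) (simp add: edge_continuous_def)
      then show "\<exists>x. x \<in> {0..len G e} \<and> (\<forall>y\<in>{0..len G e}. cmod (f0 e y) \<le> cmod (f0 e x))"
        using continuous_attains_sup[of "{0..len G e}" "\<lambda>y. cmod (f0 e y)"] quantum_graphD(4)[OF G e] by auto
    qed
    then obtain p where p: "\<forall>e\<in>edges G. p e \<in> {0..len G e} \<and> (\<forall>y\<in>{0..len G e}. cmod (f0 e y) \<le> cmod (f0 e (p e)))"
      by (rule bchoice[THEN exE])
    define M where "M = Max ((\<lambda>e. cmod (f0 e (p e))) ` edges G)"
    have "M \<in> (\<lambda>e. cmod (f0 e (p e))) ` edges G" unfolding M_def using fin e1(1) by (intro Max_in) auto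
    then obtain e0 where e0: "e0 \<in> edges G" "cmod (f0 e0 (p e0)) = M" by auto
    have M: "cmod (f0 e y) \<le> M" if "e \<in> edges G" "y \<in> {0..len G e}" for e y
    proof -
      have "cmod (f0 e y) \<le> cmod (f0 e (p e))" using p that by blast
      also have "\<dots> \<le> M" unfolding M_def using fin that(1) by (intro Max_ge) auto
      finally show ?thesis .
    qed
    have Mpos: "0 < M" using M[OF e1(1,2)] e1(3) by (meson less_le_trans zero_less_norm_iff)
    define x0 where "x0 = p e0"
    have x0: "x0 \<in> {0..len G e0}" using p e0(1) by (simp add: x0_def)
    define f where "f = cscale (inverse (f0 e0 x0)) f0"
    define D where "D = cscale (inverse (f0 e0 x0)) D0"
    have bp: "bloch_pair G c (of_real (k\<^sup>2)) f D" unfolding f_def D_def by (rule bloch_pair_scale[OF bp0])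
    have fx0: "f e0 x0 = 1" using Mpos e0(2) by (auto simp: f_def cscale_def x0_def)
    have f1: "norm (f e y) \<le> 1" if "e \<in> edges G" "y \<in> {0..len G e}" for e y
    proof -
      have "norm (f e y) = cmod (f0 e y) / M"
        unfolding f_def cscale_def norm_mult norm_inverse x0_def e0(2) by (simp add: divide_inverse mult.commute)
      then show ?thesis using M[OF that] Mpos by simp
    qed
    note ec = bloch_pair_edge_continuous[OF bp]
    obtain val where val: "\<And>e. e \<in> edges G \<Longrightarrow> f e 0 = val (src G e) \<and> f e (len G e) = val (tgt G e)"
      using bp unfolding bloch_pair_def by blast
    define \<eta> where "\<eta> = 2 * \<tau> * L"
    have \<eta>0: "0 \<le> \<eta>" using \<tau> L0 by (simp add: \<eta>_def)
    have osc: "norm (f e y - f e x) \<le> \<eta>" if "e \<in> edges G" "0 \<le> x" "x \<le> y" "y \<le> len G e" for e x y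
      unfolding \<eta>_def L_def
      by (rule eigenfunction_oscillation[OF G bp \<tau> _ k\<tau> _ f1 that]) (auto simp: \<tau>_def)
    define d where "d = (real R + 2) * \<eta>"
    have close: "norm (f e x - 1) \<le> d" if e: "e \<in> edges G" and x: "x \<in> {0..len G e}" for e x
    proof -
      obtain ss where ss: "walk G (src G e) ss (src G e0)" "length ss \<le> R"
        using R quantum_graphD(1)[OF G e] quantum_graphD(1)[OF G e0(1)] by blast
      have "norm (val (src G e) - val (src G e0)) \<le> real (length ss) * \<eta>"
      proof (rule walk_oscillation[OF _ ss(1)])
        fix e' assume e': "e' \<in> edges G"
        show "norm (val (src G e') - val (tgt G e')) \<le> \<eta>"
          using osc[OF e', of 0 "len G e'"] val[OF e'] quantum_graphD(4)[OF G e'] by (simp add: norm_minus_commute)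
      qed
      also have "\<dots> \<le> real R * \<eta>" using ss(2) \<eta>0 by (intro mult_right_mono) auto
      finally have 1: "norm (val (src G e) - val (src G e0)) \<le> real R * \<eta>" .
      have 2: "norm (f e x - val (src G e)) \<le> \<eta>" using osc[OF e, of 0 x] x val[OF e] by simp
      have 3: "norm (val (src G e0) - 1) \<le> \<eta>" using osc[OF e0(1), of 0 x0] x0 val[OF e0(1)] fx0 by (simp add: norm_minus_commute)
      have "f e x - 1 = (f e x - val (src G e)) + (val (src G e) - val (src G e0)) + (val (src G e0) - 1)" by simp
      then have "norm (f e x - 1) \<le> norm (f e x - val (src G e)) + norm (val (src G e) - val (src G e0)) + norm (val (src G e0) - 1)"
        using norm_triangle_ineq[of "(f e x - val (src G e)) + (val (src G e) - val (src G e0))" "val (src G e0) - 1"]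
          norm_triangle_ineq[of "f e x - val (src G e)" "val (src G e) - val (src G e0)"] by simp
      then show ?thesis using 1 2 3 by (simp add: d_def algebra_simps)
    qed
    have d: "0 \<le> d" "d \<le> \<epsilon> / 2"
    proof -
      show "0 \<le> d" using \<eta>0 by (simp add: d_def)
      have "\<tau> \<le> 2 * pi * \<delta>" using small by (simp add: \<tau>_def)
      then have "d \<le> (real R + 2) * (2 * (2 * pi * \<delta>) * (L + 1))"
        unfolding d_def \<eta>_def using L0 \<tau> by (intro mult_left_mono mult_mono) auto
      also have "\<dots> = \<epsilon> / 2"
      proof -
        define B where "B = pi * (real R + 2) * (L + 1)"
        have "0 < B" unfolding B_def using L0 by (intro mult_pos_pos) auto
        have "(real R + 2) * (2 * (2 * pi * \<delta>) * (L + 1)) = 4 * B * \<delta>" by (simp add: B_def)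
        also have "4 * B * \<delta> = 4 * B * (\<epsilon> / (8 * B))" by (simp add: \<delta>_def B_def mult.assoc)
        also have "\<dots> = \<epsilon> / 2" using \<open>0 < B\<close> by simp
        finally show ?thesis .
      qed
      finally show "d \<le> \<epsilon> / 2" .
    qed
    define r where "r e = Re (integral {0..len G e} (f e))" for e
    have intf: "f e integrable_on {0..len G e}" if "e \<in> edges G" for e
      using ec(1) that unfolding edge_continuous_def by (intro integrable_continuous_interval) blast
    have r: "\<bar>r e - len G e\<bar> \<le> d * len G e" if e: "e \<in> edges G" for e
    proof -
      have "((\<lambda>x. f e x - 1) has_integral integral {0..len G e} (f e) - of_real (len G e)) {0..len G e}"
        using has_integral_diff[OF integrable_integral[OF intf[OF e]] has_integral_const_real[of "1::complex" 0 "len G e"]]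
          quantum_graphD(4)[OF G e] by (simp add: scaleR_conv_of_real)
      then have "norm (integral {0..len G e} (f e) - of_real (len G e)) \<le> d * measure lborel {0..len G e}"
        by (rule has_integral_bound_real[OF d(1) finite.emptyI]) (use close[OF e] in auto)
      then have "norm (integral {0..len G e} (f e) - of_real (len G e)) \<le> d * len G e" using quantum_graphD(4)[OF G e] by simp
      moreover have "\<bar>r e - len G e\<bar> \<le> norm (integral {0..len G e} (f e) - of_real (len G e))"
        using abs_Re_le_cmod[of "integral {0..len G e} (f e) - of_real (len G e)"] by (simp add: r_def)
      ultimately show ?thesis by simp
    qed
    define \<omega> where "\<omega> e = 2 * pi * c $ e" for e
    have key: "k\<^sup>2 * (\<Sum>e\<in>edges G. r e) = (\<Sum>e\<in>edges G. (\<omega> e)\<^sup>2 * r e)"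
    proof -
      define Dh where "Dh e x = \<i> * complex_of_real (\<omega> e)" for e :: 'e and x :: real
      have "inner_L2 G D Dh = of_real (k\<^sup>2) * inner_L2 G f (\<lambda>e x. 1)"
      proof (rule green_formula[OF G bp, where val = "\<lambda>_. 1"])
        show "((\<lambda>x. 1) has_vector_derivative Dh e x - 2 * of_real pi * \<i> * 1 * of_real (c $ e)) (at x within {0..len G e})" for e x
          by (simp add: Dh_def \<omega>_def)
        show "edge_continuous G Dh" by (simp add: edge_continuous_def Dh_def)
      qed auto
      moreover have "integral {0..len G e} (\<lambda>x. D e x * cnj (Dh e x)) =
          - \<i> * of_real (2 * pi) * (of_real (c $ e) * val (tgt G e) - of_real (c $ e) * val (src G e)) + of_real ((\<omega> e)\<^sup>2) * integral {0..len G e} (f e)"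
        if e: "e \<in> edges G" for e
      proof -
        have "((\<lambda>x. D e x - 2 * of_real pi * \<i> * f e x * of_real (c $ e)) has_integral f e (len G e) - f e 0) {0..len G e}"
          by (intro fundamental_theorem_of_calculus bloch_pair_derivs(1)[OF bp e] quantum_graphD(4)[OF G e])
        then have "((\<lambda>x. (D e x - 2 * of_real pi * \<i> * f e x * of_real (c $ e)) + 2 * of_real pi * \<i> * of_real (c $ e) * f e x) has_integral
          (f e (len G e) - f e 0) + 2 * of_real pi * \<i> * of_real (c $ e) * integral {0..len G e} (f e)) {0..len G e}"
          by (intro has_integral_add has_integral_mult_right integrable_integral intf[OF e])
        then have "(D e has_integral
          (f e (len G e) - f e 0) + 2 * of_real pi * \<i> * of_real (c $ e) * integral {0..len G e} (f e)) {0..len G e}"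
          by (simp add: mult_ac)
        then have "((\<lambda>x. D e x * (- \<i> * of_real (\<omega> e))) has_integral
          ((f e (len G e) - f e 0) + 2 * of_real pi * \<i> * of_real (c $ e) * integral {0..len G e} (f e)) * (- \<i> * of_real (\<omega> e))) {0..len G e}"
          by (rule has_integral_mult_left)
        moreover have "cnj (Dh e x) = - \<i> * of_real (\<omega> e)" for x by (simp add: Dh_def)
        ultimately have "integral {0..len G e} (\<lambda>x. D e x * cnj (Dh e x)) =
          ((f e (len G e) - f e 0) + 2 * of_real pi * \<i> * of_real (c $ e) * integral {0..len G e} (f e)) * (- \<i> * of_real (\<omega> e))"
          by (simp only: integral_unique)
        also have "\<dots> = - \<i> * of_real (2 * pi) * (of_real (c $ e) * val (tgt G e) - of_real (c $ e) * val (src G e)) + of_real ((\<omega> e)\<^sup>2) * integral {0..len G e} (f e)"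
          using val[OF e] by (simp add: \<omega>_def algebra_simps power2_eq_square)
        finally show ?thesis .
      qed
      ultimately have "of_real (k\<^sup>2) * (\<Sum>e\<in>edges G. integral {0..len G e} (f e)) =
         - \<i> * of_real (2 * pi) * (\<Sum>e\<in>edges G. of_real (c $ e) * val (tgt G e) - of_real (c $ e) * val (src G e)) +
         (\<Sum>e\<in>edges G. of_real ((\<omega> e)\<^sup>2) * integral {0..len G e} (f e))"
        unfolding inner_L2_def sum_distrib_left sum.distrib[symmetric] by simp
      also have "flow_balanced G (\<lambda>e. complex_of_real (c $ e)) (\<lambda>e. of_real (c $ e))"
        using H1_realD[OF c] by (simp add: flow_balanced_def flip: of_real_sum)
      then have "(\<Sum>e\<in>edges G. of_real (c $ e) * val (tgt G e) - of_real (c $ e) * val (src G e)) = 0"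
        by (rule flow_balanced_sum_potential[OF G])
      finally have "Re (of_real (k\<^sup>2) * (\<Sum>e\<in>edges G. integral {0..len G e} (f e))) =
         Re (\<Sum>e\<in>edges G. of_real ((\<omega> e)\<^sup>2) * integral {0..len G e} (f e))" by simp
      then show ?thesis by (simp add: r_def Re_complex_of_real del: of_real_power)
    qed
    have "(1 - d) * (4 * pi\<^sup>2 * len_inner G c c) = (\<Sum>e\<in>edges G. (\<omega> e)\<^sup>2 * ((1 - d) * len G e))"
      unfolding len_inner_def sum_distrib_left by (intro sum.cong refl) (simp add: \<omega>_def power2_eq_square)
    also have "\<dots> \<le> (\<Sum>e\<in>edges G. (\<omega> e)\<^sup>2 * r e)"
      using r by (intro sum_mono mult_left_mono) (force simp: left_diff_distrib abs_le_iff)+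
    also have "\<dots> = k\<^sup>2 * (\<Sum>e\<in>edges G. r e)" by (rule key[symmetric])
    also have "\<dots> \<le> k\<^sup>2 * (\<Sum>e\<in>edges G. (1 + d) * len G e)"
      using r by (intro sum_mono mult_left_mono) (force simp: distrib_right abs_le_iff)+
    also have "\<dots> = (1 + d) * (k\<^sup>2 * L)"
      unfolding L_def total_length_def sum_distrib_left[symmetric] by (simp only: mult_ac)
    finally have main: "(1 - d) * (4 * pi\<^sup>2 * len_inner G c c) \<le> (1 + d) * (k\<^sup>2 * L)" .
    have "(1 + d) * (1 - \<epsilon>) \<le> 1 - d"
    proof -
      have "(1 + d) * (1 - \<epsilon>) = 1 - d + (2 * d - \<epsilon>) - d * \<epsilon>" by (simp add: algebra_simps)
      moreover have "0 \<le> d * \<epsilon>" using d(1) \<epsilon> by simp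
      ultimately show ?thesis using d(2) by linarith
    qed
    then have "((1 + d) * (1 - \<epsilon>)) * (4 * pi\<^sup>2 * len_inner G c c) \<le> (1 - d) * (4 * pi\<^sup>2 * len_inner G c c)"
      using len_inner_nonneg[OF G, of c] by (intro mult_right_mono) auto
    from order.trans[OF this main]
    have "(1 + d) * ((1 - \<epsilon>) * (4 * pi\<^sup>2 * len_inner G c c)) \<le> (1 + d) * (k\<^sup>2 * L)" by (simp only: mult.assoc)
    then show ?thesis by (rule mult_left_le_imp_le) (use d(1) in simp)
  qed
  then show ?thesis using \<delta> unfolding L_def by (intro exI[of _ \<delta>]) blast
qed

section \<open>Walks, cycles and potentials\<close>

definition walk_sum :: "('e \<Rightarrow> real) \<Rightarrow> ('e \<times> bool) list \<Rightarrow> real" where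
  "walk_sum r ss = (\<Sum>(e, b)\<leftarrow>ss. (if b then 1 else - 1) * r e)"

definition walk_cycle :: "('e::finite \<times> bool) list \<Rightarrow> real ^ 'e" where
  "walk_cycle ss = (\<chi> e. walk_sum (\<lambda>e'. if e' = e then 1 else 0) ss)"

lemma walk_sum_simps [simp]:
  "walk_sum r [] = 0" "walk_sum r ((e, b) # ss) = (if b then 1 else - 1) * r e + walk_sum r ss"
  "walk_sum r (ss @ ts) = walk_sum r ss + walk_sum r ts"
  by (simp_all add: walk_sum_def)

lemma walk_append: "walk G u ss w \<Longrightarrow> walk G w ts x \<Longrightarrow> walk G u (ss @ ts) x"
  by (induction ss arbitrary: u) auto

lemma walk_reverse:
  assumes "quantum_graph G" "walk G u ss w"
  shows "\<exists>ts. walk G w ts u \<and> (\<forall>r. walk_sum r ts = - walk_sum r ss)"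
  using assms(2)
proof (induction ss arbitrary: u)
  case Nil
  then show ?case by (intro exI[of _ "[]"]) auto
next
  case (Cons s ss)
  obtain e b where s: "s = (e, b)" by (cases s)
  have e: "e \<in> edges G" and u: "step_start G s = u" and w: "walk G (step_end G s) ss w" using Cons.prems s by auto
  obtain ts where ts: "walk G w ts (step_end G s)" "\<forall>r. walk_sum r ts = - walk_sum r ss" using Cons.IH[OF w] by blast
  have "walk G (step_end G s) [(e, \<not> b)] u"
    using e u s quantum_graphD(1,2)[OF assms(1) e] by (cases b) auto
  then have "walk G w (ts @ [(e, \<not> b)]) u" by (rule walk_append[OF ts(1)])
  moreover have "walk_sum r (ts @ [(e, \<not> b)]) = - walk_sum r (s # ss)" for r using ts(2) s by simp
  ultimately show ?case by blast
qed

lemma walk_sum_bound: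
  assumes "\<And>e. \<bar>r e\<bar> \<le> M" shows "\<bar>walk_sum r ss\<bar> \<le> real (length ss) * M"
proof (induction ss)
  case (Cons s ss)
  obtain e b where s: "s = (e, b)" by (cases s)
  have "\<bar>walk_sum r (s # ss)\<bar> \<le> \<bar>r e\<bar> + \<bar>walk_sum r ss\<bar>" unfolding s by (cases b) auto
  then show ?case using assms[of e] Cons by (simp add: algebra_simps)
qed simp

text \<open>
  The potential of a vertex is the sum of \<open>r\<close> along a fixed walk from a base vertex, and \<open>cw e\<close>
  goes along such walks to \<open>e\<close>, through \<open>e\<close> and back. These closed walks are the same for all \<open>r\<close>;
  so a small \<open>r\<close> has small sums along all of them.
\<close>

lemma walk_potential:
  assumes G: "quantum_graph G"
  shows "\<exists>cw. (\<forall>e\<in>edges G. closed_walk G (cw e)) \<and>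
     (\<forall>r. \<exists>val. \<forall>e\<in>edges G. r e = val (tgt G e) - val (src G e) + walk_sum r (cw e))"
proof -
  obtain v0 where v0: "v0 \<in> verts G" using G by (auto simp: quantum_graph_def)
  have "\<forall>v\<in>verts G. \<exists>ss. walk G v0 ss v" using G v0 by (auto simp: quantum_graph_def)
  then obtain p where p: "\<forall>v\<in>verts G. walk G v0 (p v) v" by (rule bchoice[THEN exE])
  have "\<forall>e\<in>edges G. \<exists>ss. closed_walk G ss \<and> (\<forall>r. walk_sum r ss = walk_sum r (p (src G e)) + r e - walk_sum r (p (tgt G e)))"
  proof
    fix e assume e: "e \<in> edges G"
    note st = quantum_graphD(1,2)[OF G e]
    obtain ts where ts: "walk G (tgt G e) ts v0" "\<forall>r. walk_sum r ts = - walk_sum r (p (tgt G e))"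
      using walk_reverse[OF G] p st(2) by blast
    have "walk G (src G e) ((e, True) # ts) v0" using e ts(1) by simp
    then have "walk G v0 (p (src G e) @ (e, True) # ts) v0" using p st(1) by (intro walk_append) auto
    then show "\<exists>ss. closed_walk G ss \<and> (\<forall>r. walk_sum r ss = walk_sum r (p (src G e)) + r e - walk_sum r (p (tgt G e)))"
      using ts(2) by (intro exI[of _ "p (src G e) @ (e, True) # ts"]) (auto simp: closed_walk_def)
  qed
  then obtain cw where cw: "\<forall>e\<in>edges G. closed_walk G (cw e) \<and> (\<forall>r. walk_sum r (cw e) = walk_sum r (p (src G e)) + r e - walk_sum r (p (tgt G e)))"
    by (rule bchoice[THEN exE])
  show ?thesis
  proof (intro exI[of _ cw] conjI allI)
    fix r
    show "\<exists>val. \<forall>e\<in>edges G. r e = val (tgt G e) - val (src G e) + walk_sum r (cw e)"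
      using cw by (intro exI[of _ "\<lambda>v. walk_sum r (p v)"]) auto
  qed (use cw in blast)
qed

lemma walk_sum_eq_cycle:
  fixes r :: "'e::finite \<Rightarrow> real"
  assumes "fst ` set ss \<subseteq> E"
  shows "walk_sum r ss = (\<Sum>e\<in>E. walk_cycle ss $ e * r e)"
  using assms
proof (induction ss)
  case Nil
  then show ?case by (simp add: walk_cycle_def)
next
  case (Cons s ss)
  obtain e b where s: "s = (e, b)" by (cases s)
  have e: "e \<in> E" using Cons.prems s by simp
  have "(\<Sum>e'\<in>E. walk_cycle (s # ss) $ e' * r e') = (\<Sum>e'\<in>E. (if e' = e then (if b then 1 else - 1) * r e else 0)) + (\<Sum>e'\<in>E. walk_cycle ss $ e' * r e')"
    unfolding sum.distrib[symmetric] by (intro sum.cong refl) (auto simp: walk_cycle_def s algebra_simps)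
  then show ?case using Cons e s by simp
qed

lemma walk_edges: "walk G u ss w \<Longrightarrow> fst ` set ss \<subseteq> edges G"
  by (induction ss arbitrary: u) auto

lemma walk_cycle_in_H1_int:
  assumes G: "quantum_graph G" and ss: "closed_walk G ss"
  shows "walk_cycle ss \<in> H1_int G"
proof -
  obtain v where v: "walk G v ss v" using ss by (auto simp: closed_walk_def)
  note E = walk_edges[OF v]
  have int: "walk_cycle ss $ e \<in> \<int>" for e
    unfolding walk_cycle_def by (simp, induction ss) (auto simp: split_paired_all)
  have supp: "walk_cycle ss $ e = 0" if "e \<notin> edges G" for e
  proof -
    have "walk_cycle ss $ e = (\<Sum>e'\<in>edges G. walk_cycle ss $ e' * (if e' = e then 1 else 0))"
      using walk_sum_eq_cycle[OF E, of "\<lambda>e'. if e' = e then 1 else 0"] by (simp add: walk_cycle_def)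
    also have "\<dots> = 0" using that by (intro sum.neutral) auto
    finally show ?thesis .
  qed
  have bal: "(\<Sum>e\<in>{e \<in> edges G. tgt G e = x}. walk_cycle ss $ e) - (\<Sum>e\<in>{e \<in> edges G. src G e = x}. walk_cycle ss $ e) = 0" for x
  proof -
    have fin: "finite (edges G)" using G by (simp add: quantum_graph_def)
    let ?r = "\<lambda>e. (if tgt G e = x then 1 else 0) - (if src G e = x then 1 else 0) :: real"
    have "walk_sum ?r ts = (if w = x then 1 else 0) - (if u = x then 1 else 0)" if "walk G u ts w" for u ts w
      using that
    proof (induction ts arbitrary: u)
      case (Cons s ts)
      obtain e b where s: "s = (e, b)" by (cases s)
      show ?case using Cons.prems Cons.IH[of "step_end G s"] unfolding s by (cases b) auto
    qed simp
    from this[OF v] have "walk_sum ?r ss = 0" by simp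
    then have "(\<Sum>e\<in>edges G. walk_cycle ss $ e * ?r e) = 0" using walk_sum_eq_cycle[OF E] by simp
    moreover have "(\<Sum>e\<in>edges G. walk_cycle ss $ e * ?r e) =
       (\<Sum>e\<in>edges G. if tgt G e = x then walk_cycle ss $ e else 0) - (\<Sum>e\<in>edges G. if src G e = x then walk_cycle ss $ e else 0)"
      unfolding sum_subtractf[symmetric] by (intro sum.cong refl) auto
    ultimately show ?thesis using fin by (simp add: sum.inter_filter)
  qed
  show ?thesis using int supp bal by (simp add: H1_int_def H1_real_def)
qed

lemma subspace_H1_real: "subspace (H1_real G)"
  by (auto simp: subspace_def H1_real_def sum.distrib sum_distrib_left[symmetric])

lemma len_inner_linear:
  "len_inner G (c + c') d = len_inner G c d + len_inner G c' d" "len_inner G (t *\<^sub>R c) d = t * len_inner G c d"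
  "len_inner G c (d + d') = len_inner G c d + len_inner G c d'" "len_inner G c (t *\<^sub>R d) = t * len_inner G c d"
  "len_inner G c d = len_inner G d c"
  unfolding len_inner_def by (simp_all add: sum.distrib sum_distrib_left algebra_simps)

lemma len_inner_eq_0:
  assumes G: "quantum_graph G" and c: "c \<in> H1_real G" and 0: "len_inner G c c = 0"
  shows "c = 0"
proof -
  have fin: "finite (edges G)" using G by (simp add: quantum_graph_def)
  have "\<forall>e\<in>edges G. len G e * (c $ e * c $ e) = 0"
    using 0 fin quantum_graphD(4)[OF G] unfolding len_inner_def
    by (subst (asm) sum_nonneg_eq_0_iff) auto
  then have "c $ e = 0" for e
    using c quantum_graphD(3)[OF G, of e] by (cases "e \<in> edges G") (auto simp: H1_real_def)
  then show ?thesis by (simp add: vec_eq_iff)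
qed

text \<open>
  Riesz representation on the space of cycles. Multiplying the coordinates by the square roots of
  the lengths turns \<open>len_inner\<close> into the standard inner product, for which orthogonal projections
  are available.
\<close>

lemma cycle_representation:
  fixes G :: "('v, 'e::finite) qgraph" and I :: "'e \<Rightarrow> real"
  assumes G: "quantum_graph G"
  shows "\<exists>c\<in>H1_real G. \<forall>w\<in>H1_real G. len_inner G c w = (\<Sum>e\<in>edges G. I e * w $ e)"
proof -
  define sc where "sc = (\<lambda>w::real^'e. \<chi> e. if e \<in> edges G then sqrt (len G e) * w $ e else 0)"
  define u :: "real^'e" where "u = (\<chi> e. if e \<in> edges G then I e / sqrt (len G e) else 0)"
  have lin: "linear sc" by (rule linearI) (auto simp: sc_def vec_eq_iff algebra_simps)
  have sub: "subspace (sc ` H1_real G)" by (rule linear_subspace_image[OF lin subspace_H1_real])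
  have pos: "sqrt (len G e) * sqrt (len G e) = len G e" "0 < sqrt (len G e)" if "e \<in> edges G" for e
    using quantum_graphD(3)[OF G that] by auto
  obtain y z where yz: "y \<in> span (sc ` H1_real G)" "\<And>w. w \<in> span (sc ` H1_real G) \<Longrightarrow> orthogonal z w" "u = y + z"
    using orthogonal_subspace_decomp_exists[of "sc ` H1_real G" u] by blast
  then obtain c where c: "c \<in> H1_real G" "y = sc c" using sub by (metis imageE span_eq_iff)
  have "len_inner G c w = (\<Sum>e\<in>edges G. I e * w $ e)" if w: "w \<in> H1_real G" for w
  proof -
    have "sc w \<in> span (sc ` H1_real G)" using w by (intro span_base) simp
    then have "inner u (sc w) = inner (sc c) (sc w)" using yz(2)[of "sc w"] yz(3) c(2) by (simp add: orthogonal_def inner_add_left)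
    moreover have "inner u (sc w) = (\<Sum>e\<in>edges G. I e * w $ e)"
    proof -
      have "inner u (sc w) = (\<Sum>e\<in>UNIV. if e \<in> edges G then I e * w $ e else 0)"
        unfolding inner_vec_def
      proof (intro sum.cong refl)
        fix e show "inner (u $ e) (sc w $ e) = (if e \<in> edges G then I e * w $ e else 0)"
          using pos(2)[of e] by (cases "e \<in> edges G") (auto simp: u_def sc_def)
      qed
      then show ?thesis by (simp add: sum.If_cases)
    qed
    moreover have "inner (sc c) (sc w) = len_inner G c w"
    proof -
      have "inner (sc c) (sc w) = (\<Sum>e\<in>UNIV. if e \<in> edges G then len G e * (c $ e * w $ e) else 0)"
        unfolding inner_vec_def
      proof (intro sum.cong refl)
        fix e
        have "(sqrt (len G e) * c $ e) * (sqrt (len G e) * w $ e) = (sqrt (len G e) * sqrt (len G e)) * (c $ e * w $ e)" by simp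
        then show "inner (sc c $ e) (sc w $ e) = (if e \<in> edges G then len G e * (c $ e * w $ e) else 0)"
          using pos(1)[of e] by (auto simp: sc_def)
      qed
      then show ?thesis by (simp add: sum.If_cases len_inner_def)
    qed
    ultimately show ?thesis by simp
  qed
  with c(1) show ?thesis by blast
qed

definition period_lattice :: "('v, 'e::finite) qgraph \<Rightarrow> (real ^ 'e) set" where
  "period_lattice G = {c \<in> H1_real G. \<forall>d\<in>H1_int G. len_inner G c d \<in> \<int>}"

lemma potential_orthogonal_to_cycles:
  assumes G: "quantum_graph G" and w: "w \<in> H1_real G"
  shows "(\<Sum>e\<in>edges G. w $ e * (val (tgt G e) - val (src G e))) = (0::real)"
  using flow_balanced_sum_potential[OF G H1_realD[OF w], of val] by (simp add: right_diff_distrib)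

text \<open>
  Potential differences are orthogonal to cycles, so an integral cycle pairs with \<open>c\<close> as an
  integral combination of the sums along the closed walks \<open>cw e\<close> of \<open>walk_potential\<close>.
\<close>

lemma period_lattice_iff_closed_walks:
  assumes G: "quantum_graph G" and c: "c \<in> H1_real G"
  shows "c \<in> period_lattice G \<longleftrightarrow> (\<forall>ss. closed_walk G ss \<longrightarrow> walk_sum (\<lambda>e. len G e * c $ e) ss \<in> \<int>)"
proof
  assume lat: "c \<in> period_lattice G"
  show "\<forall>ss. closed_walk G ss \<longrightarrow> walk_sum (\<lambda>e. len G e * c $ e) ss \<in> \<int>"
  proof (intro allI impI)
    fix ss assume ss: "closed_walk G ss"
    then obtain v where "walk G v ss v" by (auto simp: closed_walk_def)
    then have "fst ` set ss \<subseteq> edges G" by (rule walk_edges)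
    then have "walk_sum (\<lambda>e. len G e * c $ e) ss = len_inner G c (walk_cycle ss)"
      unfolding len_inner_def by (subst walk_sum_eq_cycle) (auto intro!: sum.cong)
    then show "walk_sum (\<lambda>e. len G e * c $ e) ss \<in> \<int>"
      using lat walk_cycle_in_H1_int[OF G ss] by (auto simp: period_lattice_def)
  qed
next
  assume W: "\<forall>ss. closed_walk G ss \<longrightarrow> walk_sum (\<lambda>e. len G e * c $ e) ss \<in> \<int>"
  obtain cw where cw: "\<forall>e\<in>edges G. closed_walk G (cw e)"
    "\<forall>r. \<exists>val. \<forall>e\<in>edges G. r e = val (tgt G e) - val (src G e) + walk_sum r (cw e)"
    using walk_potential[OF G] by blast
  let ?r = "\<lambda>e. len G e * c $ e"
  obtain val where val: "\<forall>e\<in>edges G. ?r e = val (tgt G e) - val (src G e) + walk_sum ?r (cw e)"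
    using cw(2)[rule_format, of ?r] by blast
  have "len_inner G c d \<in> \<int>" if d: "d \<in> H1_int G" for d
  proof -
    have "len_inner G c d = (\<Sum>e\<in>edges G. d $ e * ?r e)" by (simp add: len_inner_def mult_ac)
    also have "\<dots> = (\<Sum>e\<in>edges G. d $ e * (val (tgt G e) - val (src G e)) + d $ e * walk_sum ?r (cw e))"
    proof (intro sum.cong refl)
      fix e assume "e \<in> edges G"
      then show "d $ e * ?r e = d $ e * (val (tgt G e) - val (src G e)) + d $ e * walk_sum ?r (cw e)"
        using val by (simp only: distrib_left[symmetric])
    qed
    also have "\<dots> = (\<Sum>e\<in>edges G. d $ e * walk_sum ?r (cw e))"
      using potential_orthogonal_to_cycles[OF G, of d val] d by (simp add: sum.distrib H1_int_def)
    also have "\<dots> \<in> \<int>" using d W cw(1) by (intro Ints_sum Ints_mult) (auto simp: H1_int_def)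
    finally show ?thesis .
  qed
  then show "c \<in> period_lattice G" using c by (simp add: period_lattice_def)
qed

text \<open>
  The coordinate of cycles at an edge is represented by some \<open>a\<close> in the space of cycles. As \<open>a\<close>
  has integral pairings with integral cycles, it belongs to the period lattice; so a cycle with
  integral pairings with that lattice has integral coordinates.
\<close>

lemma H1_int_iff_dual:
  assumes G: "quantum_graph G" and d: "d \<in> H1_real G"
  shows "d \<in> H1_int G \<longleftrightarrow> (\<forall>c\<in>period_lattice G. len_inner G c d \<in> \<int>)"
proof
  assume R: "\<forall>c\<in>period_lattice G. len_inner G c d \<in> \<int>"
  have "d $ e \<in> \<int>" for e
  proof (cases "e \<in> edges G")
    case True
    have fin: "finite (edges G)" using G by (simp add: quantum_graph_def)
    obtain a where a: "a \<in> H1_real G" "\<forall>w\<in>H1_real G. len_inner G a w = (\<Sum>e'\<in>edges G. (if e' = e then 1 else 0) * w $ e')"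
      using cycle_representation[OF G, of "\<lambda>e'. if e' = e then 1 else 0"] by blast
    then have a': "len_inner G a w = w $ e" if "w \<in> H1_real G" for w
      using that True fin by (simp add: if_distrib[of "\<lambda>x. x * _"] cong: if_cong)
    have "a \<in> period_lattice G" using a(1) a' by (auto simp: period_lattice_def H1_int_def)
    then show ?thesis using R a' d by force
  qed (use d in \<open>auto simp: H1_real_def\<close>)
  then show "d \<in> H1_int G" using d by (simp add: H1_int_def)
qed (auto simp: period_lattice_def)

text \<open>
  If \<open>c\<close> is small, its periods along the finitely many closed walks of \<open>walk_potential\<close> are
  integers of absolute value below \<open>1\<close>, hence zero. Then \<open>c\<close> comes from a potential, so it is
  orthogonal to all cycles and in particular to itself.
\<close>

lemma period_lattice_discrete:
  fixes G :: "('v, 'e::finite) qgraph"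
  assumes G: "quantum_graph G"
  shows "\<exists>\<rho>>0. \<forall>c\<in>period_lattice G. norm c < \<rho> \<longrightarrow> c = 0"
proof -
  obtain cw where cw: "\<forall>e\<in>edges G. closed_walk G (cw e)"
    "\<forall>r. \<exists>val. \<forall>e\<in>edges G. r e = val (tgt G e) - val (src G e) + walk_sum r (cw e)"
    using walk_potential[OF G] by blast
  define R where "R = (\<Sum>e\<in>edges G. length (cw e))"
  define M where "M = (\<Sum>e\<in>UNIV. \<bar>len G e\<bar>)"
  have fin: "finite (edges G)" using G by (simp add: quantum_graph_def)
  have M0: "0 \<le> M" by (simp add: M_def sum_nonneg)
  define \<rho> where "\<rho> = 1 / ((real R + 1) * (M + 1))"
  have \<rho>: "0 < \<rho>" unfolding \<rho>_def using M0 by (intro divide_pos_pos mult_pos_pos) auto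
  have "c = 0" if c: "c \<in> period_lattice G" and small: "norm c < \<rho>" for c
  proof -
    let ?r = "\<lambda>e. len G e * c $ e"
    have cW: "c \<in> H1_real G" using c by (simp add: period_lattice_def)
    have r: "\<bar>?r e\<bar> \<le> M * \<rho>" for e
    proof -
      have "\<bar>len G e\<bar> \<le> M" unfolding M_def by (rule member_le_sum) auto
      moreover have "\<bar>c $ e\<bar> \<le> \<rho>" using component_le_norm_cart[of c e] small by simp
      ultimately show ?thesis using M0 by (auto simp: abs_mult intro!: mult_mono)
    qed
    have w0: "walk_sum ?r (cw e) = 0" if e: "e \<in> edges G" for e
    proof -
      have "length (cw e) \<le> R" unfolding R_def using fin e by (intro member_le_sum) auto
      then have "\<bar>walk_sum ?r (cw e)\<bar> \<le> real R * (M * \<rho>)"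
        using walk_sum_bound[where r = ?r and ss = "cw e", OF r] M0 \<rho> by (meson mult_right_mono of_nat_le_iff order.trans mult_nonneg_nonneg less_imp_le)
      also have "\<dots> < (real R + 1) * ((M + 1) * \<rho>)"
      proof -
        have "real R * M < (real R + 1) * (M + 1)" using M0 by (simp add: algebra_simps add_nonneg_pos)
        then have "real R * M * \<rho> < (real R + 1) * (M + 1) * \<rho>" using \<rho> by (rule mult_strict_right_mono)
        then show ?thesis by (simp only: mult.assoc)
      qed
      also have "\<dots> = 1"
      proof -
        define P where "P = (real R + 1) * (M + 1)"
        have "0 < P" unfolding P_def using M0 by (intro mult_pos_pos) auto
        then have "P * \<rho> = 1" unfolding \<rho>_def P_def[symmetric] by simp
        then show ?thesis unfolding P_def by (simp only: mult.assoc)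
      qed
      finally have "\<bar>walk_sum ?r (cw e)\<bar> < 1" .
      moreover have "walk_sum ?r (cw e) \<in> \<int>"
        using c period_lattice_iff_closed_walks[OF G cW] cw(1) e by blast
      ultimately show ?thesis using Ints_nonzero_abs_ge1 by fastforce
    qed
    obtain val where val: "\<forall>e\<in>edges G. ?r e = val (tgt G e) - val (src G e) + walk_sum ?r (cw e)"
      using cw(2)[rule_format, of ?r] by blast
    have "len_inner G c c = (\<Sum>e\<in>edges G. c $ e * (val (tgt G e) - val (src G e)))"
      unfolding len_inner_def
    proof (intro sum.cong refl)
      fix e assume e: "e \<in> edges G"
      have "len G e * (c $ e * c $ e) = c $ e * ?r e" by simp
      also have "?r e = val (tgt G e) - val (src G e)" using val w0[OF e] e by simp
      finally show "len G e * (c $ e * c $ e) = c $ e * (val (tgt G e) - val (src G e))" .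
    qed
    then have "len_inner G c c = 0" using potential_orthogonal_to_cycles[OF G cW] by simp
    then show ?thesis by (rule len_inner_eq_0[OF G cW])
  qed
  with \<rho> show ?thesis by blast
qed

section \<open>Harmonic representatives\<close>

lemma smooth_interval_continuous: "smooth_interval L f \<Longrightarrow> continuous_on {0..L} f"
  unfolding smooth_interval_def by (metis continuous_on_vector_derivative)

lemma smooth_interval_combine:
  fixes f g :: "real \<Rightarrow> real"
  assumes "smooth_interval L f" "smooth_interval L g"
  shows "smooth_interval L (\<lambda>x. f x + s * g x)"
proof -
  obtain D E where D: "D 0 = f" "\<forall>n. \<forall>x\<in>{0..L}. (D n has_vector_derivative D (Suc n) x) (at x within {0..L})"
    and E: "E 0 = g" "\<forall>n. \<forall>x\<in>{0..L}. (E n has_vector_derivative E (Suc n) x) (at x within {0..L})"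
    using assms unfolding smooth_interval_def by metis
  have "((\<lambda>x. D n x + s * E n x) has_vector_derivative D (Suc n) x + s * E (Suc n) x) (at x within {0..L})" if "x \<in> {0..L}" for n x
    by (intro has_vector_derivative_add has_vector_derivative_mult_right D(2)[rule_format] E(2)[rule_format] that)
  then show ?thesis
    unfolding smooth_interval_def using D(1) E(1) by (intro exI[of _ "\<lambda>n x. D n x + s * E n x"]) auto
qed

lemma one_forms_combine:
  assumes "a \<in> one_forms G" "b \<in> one_forms G" shows "(\<lambda>e x. a e x + s * b e x) \<in> one_forms G"
proof -
  have "normal_sum G (\<lambda>e x. a e x + s * b e x) v = normal_sum G a v + s * normal_sum G b v" for v
    by (simp add: normal_sum_def sum.distrib sum_negf sum_subtractf sum_distrib_left algebra_simps)
  then show ?thesis using assms smooth_interval_combine by (auto simp: one_forms_def supported_def)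
qed

lemma one_forms_group_laws:
  assumes "a \<in> one_forms G" "b \<in> one_forms G"
  shows "a + b \<in> one_forms G" "a - b \<in> one_forms G"
  using one_forms_combine[OF assms, of 1] one_forms_combine[OF assms, of "-1"]
  by (simp_all add: plus_fun_def fun_diff_def)

lemma zero_one_form: "0 \<in> one_forms G"
proof -
  have "smooth_interval L (0 :: real \<Rightarrow> real)" for L
    unfolding smooth_interval_def by (intro exI[of _ "\<lambda>_. 0"]) (simp add: zero_fun_def)
  then show ?thesis by (auto simp: one_forms_def supported_def normal_sum_def zero_fun_def)
qed

lemma one_form_continuous: "a \<in> one_forms G \<Longrightarrow> e \<in> edges G \<Longrightarrow> continuous_on {0..len G e} (a e)"
  using smooth_interval_continuous by (auto simp: one_forms_def)

lemma one_form_integral: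
  assumes "a \<in> one_forms G" "b \<in> one_forms G" "e \<in> edges G"
  shows "integral {0..len G e} ((a + b) e) = integral {0..len G e} (a e) + integral {0..len G e} (b e)"
    "integral {0..len G e} ((a - b) e) = integral {0..len G e} (a e) - integral {0..len G e} (b e)"
  using integrable_continuous_interval[OF one_form_continuous[OF assms(1,3)]] integrable_continuous_interval[OF one_form_continuous[OF assms(2,3)]]
  by (simp_all add: plus_fun_def fun_diff_def Henstock_Kurzweil_Integration.integral_add Henstock_Kurzweil_Integration.integral_diff)

text \<open>
  A primitive is determined by its values at the vertices, and the Kirchhoff condition for it is
  the one for its derivative.
\<close>

lemma exact_forms_iff:
  assumes G: "quantum_graph G"
  shows "a \<in> exact_forms G \<longleftrightarrow> a \<in> one_forms G \<and>
    (\<exists>val. \<forall>e\<in>edges G. integral {0..len G e} (a e) = val (tgt G e) - val (src G e))"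
proof
  assume "a \<in> exact_forms G"
  then obtain f where f: "f \<in> zero_forms G" "a = edge_deriv G f" by (auto simp: exact_forms_def)
  obtain val where val: "\<forall>e\<in>edges G. f e 0 = val (src G e) \<and> f e (len G e) = val (tgt G e)"
    using f(1) by (auto simp: zero_forms_def continuous_graph_def)
  have sm: "smooth_interval (len G e) (a e) \<and> integral {0..len G e} (a e) = f e (len G e) - f e 0" if e: "e \<in> edges G" for e
  proof -
    obtain D where D: "D 0 = f e" "\<forall>n. \<forall>x\<in>{0..len G e}. (D n has_vector_derivative D (Suc n) x) (at x within {0..len G e})"
      using f(1) e unfolding zero_forms_def smooth_interval_def by blast
    have aD: "a e x = D 1 x" if x: "x \<in> {0..len G e}" for x
    proof -
      have "(f e has_vector_derivative D 1 x) (at x within {0..len G e})" using D x by (metis One_nat_def)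
      then show ?thesis using vector_derivative_within_closed_interval[OF quantum_graphD(3)[OF G e] x] x e f(2)
        by (simp add: edge_deriv_def on_graph_def)
    qed
    define D' where "D' n = (if n = 0 then a e else D (Suc n))" for n
    have "(D' n has_vector_derivative D' (Suc n) x) (at x within {0..len G e})" if x: "x \<in> {0..len G e}" for n x
    proof (cases n)
      case 0
      have "(D 1 has_vector_derivative D (Suc 1) x) (at x within {0..len G e})" using D(2) x by blast
      then have "(a e has_vector_derivative D (Suc 1) x) (at x within {0..len G e})"
        by (rule has_vector_derivative_transform[OF x, rotated]) (erule aD)
      then show ?thesis using 0 by (simp add: D'_def)
    next
      case (Suc m)
      then show ?thesis using D(2) x by (simp add: D'_def)
    qed
    then have "smooth_interval (len G e) (a e)"
      unfolding smooth_interval_def by (intro exI[of _ D']) (simp add: D'_def)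
    moreover have "(D 1 has_integral f e (len G e) - f e 0) {0..len G e}"
      using D quantum_graphD(4)[OF G e] by (intro fundamental_theorem_of_calculus) (metis One_nat_def)+
    then have "integral {0..len G e} (D 1) = f e (len G e) - f e 0" by (rule integral_unique)
    moreover have "integral {0..len G e} (a e) = integral {0..len G e} (D 1)" by (rule integral_cong) (rule aD)
    ultimately show ?thesis by simp
  qed
  have "a \<in> one_forms G"
    using f sm by (auto simp: one_forms_def zero_forms_def kirchhoff_def supported_def edge_deriv_def)
  then show "a \<in> one_forms G \<and> (\<exists>val. \<forall>e\<in>edges G. integral {0..len G e} (a e) = val (tgt G e) - val (src G e))"
    using sm val by (intro conjI exI[of _ val]) auto
next
  assume "a \<in> one_forms G \<and> (\<exists>val. \<forall>e\<in>edges G. integral {0..len G e} (a e) = val (tgt G e) - val (src G e))"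
  then obtain val where a: "a \<in> one_forms G" and val: "\<And>e. e \<in> edges G \<Longrightarrow> integral {0..len G e} (a e) = val (tgt G e) - val (src G e)" by blast
  define f where "f e x = (if on_graph G e x then val (src G e) + integral {0..x} (a e) else 0)" for e x
  have f': "(f e has_vector_derivative a e x) (at x within {0..len G e})" if e: "e \<in> edges G" and x: "x \<in> {0..len G e}" for e x
  proof -
    have "((\<lambda>y. val (src G e) + integral {0..y} (a e)) has_vector_derivative 0 + a e x) (at x within {0..len G e})"
      by (intro has_vector_derivative_add has_vector_derivative_const integral_has_vector_derivative one_form_continuous[OF a e] x)
    then show ?thesis unfolding add_0_left
      by (rule has_vector_derivative_transform[OF x, rotated]) (use e in \<open>simp add: f_def on_graph_def\<close>)
  qed
  have ed: "edge_deriv G f e x = a e x" for e x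
  proof (cases "on_graph G e x")
    case True
    then have ex: "e \<in> edges G" "x \<in> {0..len G e}" by (auto simp: on_graph_def)
    then show ?thesis using vector_derivative_within_closed_interval[OF quantum_graphD(3)[OF G ex(1)] ex(2) f'[OF ex]] True
      by (simp add: edge_deriv_def)
  next
    case False
    then show ?thesis using a by (simp add: edge_deriv_def one_forms_def supported_def)
  qed
  have "smooth_interval (len G e) (f e)" if e: "e \<in> edges G" for e
  proof -
    obtain D where D: "D 0 = a e" "\<forall>n. \<forall>x\<in>{0..len G e}. (D n has_vector_derivative D (Suc n) x) (at x within {0..len G e})"
      using a e unfolding one_forms_def smooth_interval_def by blast
    define D' where "D' n = (case n of 0 \<Rightarrow> f e | Suc m \<Rightarrow> D m)" for n
    have "(D' n has_vector_derivative D' (Suc n) x) (at x within {0..len G e})" if x: "x \<in> {0..len G e}" for n x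
      using f'[OF e x] D x by (cases n) (auto simp: D'_def)
    then show ?thesis unfolding smooth_interval_def by (intro exI[of _ D']) (simp add: D'_def)
  qed
  moreover have "continuous_graph G f"
    unfolding continuous_graph_def
  proof (intro conjI ballI exI[of _ val])
    fix e assume e: "e \<in> edges G"
    show "continuous_on {0..len G e} (f e)" by (rule continuous_on_vector_derivative[OF f'[OF e]])
    show "f e 0 = val (src G e)" "f e (len G e) = val (tgt G e)"
      using val[OF e] quantum_graphD(4)[OF G e] e by (auto simp: f_def on_graph_def)
  qed
  moreover have edf: "edge_deriv G f = a" by (intro ext) (rule ed)
  then have "kirchhoff G f" using a by (simp add: kirchhoff_def one_forms_def)
  ultimately have "f \<in> zero_forms G" by (simp add: zero_forms_def supported_def f_def)
  then show "a \<in> exact_forms G" unfolding exact_forms_def using edf by blast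
qed

lemma constant_form_one_form: "quantum_graph G \<Longrightarrow> c \<in> H1_real G \<Longrightarrow> constant_form G c \<in> one_forms G"
  using constant_form_in_harmonic_iff[of G c] H1_realD[of c G] by (simp add: harmonic_forms_def)

lemma integral_constant_form:
  assumes "quantum_graph G" "e \<in> edges G"
  shows "integral {0..len G e} (constant_form G c e) = len G e * c $ e"
proof -
  have "integral {0..len G e} (constant_form G c e) = integral {0..len G e} (\<lambda>x. c $ e)"
    by (rule integral_cong) (use assms in \<open>simp add: constant_form_def on_graph_def\<close>)
  then show ?thesis using quantum_graphD(4)[OF assms] by simp
qed

lemma constant_form_add: "constant_form G (c + d) = constant_form G c + constant_form G d"
  "constant_form G (c - d) = constant_form G c - constant_form G d"
  by (auto simp: constant_form_def fun_eq_iff)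

lemma harmonic_forms_eq:
  assumes G: "quantum_graph G" shows "harmonic_forms G = constant_form G ` H1_real G"
proof
  show "constant_form G ` H1_real G \<subseteq> harmonic_forms G"
    using constant_form_in_harmonic_iff[OF G] H1_realD by blast
  show "harmonic_forms G \<subseteq> constant_form G ` H1_real G"
  proof
    fix a assume a: "a \<in> harmonic_forms G"
    then obtain k where k: "\<forall>e\<in>edges G. \<forall>x\<in>{0..len G e}. a e x = k e"
      unfolding harmonic_forms_def by (auto dest!: bchoice)
    define c where "c = (\<chi> e. if e \<in> edges G then k e else 0)"
    have ac: "a = constant_form G c"
      using a k by (auto simp: fun_eq_iff constant_form_def c_def harmonic_forms_def one_forms_def supported_def on_graph_def)
    then have "flow_balanced G (\<lambda>e. c $ e) (\<lambda>e. c $ e)" using a constant_form_in_harmonic_iff[OF G] by simp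
    then have "c \<in> H1_real G" by (simp add: H1_real_def flow_balanced_def c_def)
    with ac show "a \<in> constant_form G ` H1_real G" by blast
  qed
qed

lemma exact_constant_form:
  assumes G: "quantum_graph G" and c: "c \<in> H1_real G" and ex: "constant_form G c \<in> exact_forms G"
  shows "c = 0"
proof -
  obtain val where val: "\<forall>e\<in>edges G. len G e * c $ e = val (tgt G e) - val (src G e)"
    using ex exact_forms_iff[OF G] integral_constant_form[OF G, of _ c] by auto
  have "len_inner G c c = (\<Sum>e\<in>edges G. c $ e * (val (tgt G e) - val (src G e)))"
    unfolding len_inner_def by (intro sum.cong refl) (simp add: val[rule_format, symmetric])
  then show ?thesis using potential_orthogonal_to_cycles[OF G c] len_inner_eq_0[OF G c] by simp
qed

text \<open>
  The cycle that represents pairing with the edge integrals of \<open>a\<close> gives the harmonic part. The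
  remaining edge integrals are orthogonal to all cycles, hence they are differences of a
  potential.
\<close>

lemma harmonic_representative_exists:
  fixes G :: "('v, 'e::finite) qgraph"
  assumes G: "quantum_graph G" and a: "a \<in> one_forms G"
  shows "\<exists>c\<in>H1_real G. a - constant_form G c \<in> exact_forms G"
proof -
  define I where "I e = integral {0..len G e} (a e)" for e
  obtain c where c: "c \<in> H1_real G" "\<forall>w\<in>H1_real G. len_inner G c w = (\<Sum>e\<in>edges G. I e * w $ e)"
    using cycle_representation[OF G, of I] by blast
  define r where "r e = I e - len G e * c $ e" for e
  obtain cw where cw: "\<forall>e\<in>edges G. closed_walk G (cw e)"
    "\<forall>r. \<exists>val. \<forall>e\<in>edges G. r e = val (tgt G e) - val (src G e) + walk_sum r (cw e)"
    using walk_potential[OF G] by blast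
  obtain val where val: "\<forall>e\<in>edges G. r e = val (tgt G e) - val (src G e) + walk_sum r (cw e)"
    using cw(2)[rule_format, of r] by blast
  have 0: "walk_sum r (cw e) = 0" if e: "e \<in> edges G" for e
  proof -
    have cl: "closed_walk G (cw e)" using cw(1) e by blast
    then obtain v where "walk G v (cw e) v" by (auto simp: closed_walk_def)
    then have E: "fst ` set (cw e) \<subseteq> edges G" by (rule walk_edges)
    have w: "walk_cycle (cw e) \<in> H1_real G" using walk_cycle_in_H1_int[OF G cl] by (simp add: H1_int_def)
    have "walk_sum r (cw e) = (\<Sum>e'\<in>edges G. I e' * walk_cycle (cw e) $ e') - len_inner G c (walk_cycle (cw e))"
      unfolding walk_sum_eq_cycle[OF E] len_inner_def sum_subtractf[symmetric] by (intro sum.cong refl) (simp add: r_def algebra_simps)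
    then show ?thesis using c(2) w by simp
  qed
  have cf: "constant_form G c \<in> one_forms G" by (rule constant_form_one_form[OF G c(1)])
  have "integral {0..len G e} ((a - constant_form G c) e) = val (tgt G e) - val (src G e)" if e: "e \<in> edges G" for e
  proof -
    have "integral {0..len G e} ((a - constant_form G c) e) = r e"
      unfolding one_form_integral(2)[OF a cf e] integral_constant_form[OF G e] r_def I_def ..
    then show ?thesis using val 0[OF e] e by simp
  qed
  then have "a - constant_form G c \<in> exact_forms G"
    unfolding exact_forms_iff[OF G] using one_forms_group_laws(2)[OF a cf] by blast
  then show ?thesis using c(1) by blast
qed

section \<open>Cohomology classes\<close>

lemma comm_group_one_forms: "comm_group (one_form_group G)"
proof (rule comm_groupI)
  fix a assume "a \<in> carrier (one_form_group G)"
  then have "0 - a \<in> one_forms G" using one_forms_group_laws(2)[OF zero_one_form] by (simp add: one_form_group_def)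
  then show "\<exists>b\<in>carrier (one_form_group G). b \<otimes>\<^bsub>one_form_group G\<^esub> a = \<one>\<^bsub>one_form_group G\<^esub>"
    by (intro bexI[of _ "0 - a"]) (auto simp: one_form_group_def)
qed (auto simp: one_form_group_def zero_one_form one_forms_group_laws(1) add_ac)

lemma exact_forms_closed:
  assumes G: "quantum_graph G" and "a \<in> exact_forms G" "b \<in> exact_forms G"
  shows "a + b \<in> exact_forms G" "a - b \<in> exact_forms G"
proof -
  obtain v where a: "a \<in> one_forms G" "\<forall>e\<in>edges G. integral {0..len G e} (a e) = v (tgt G e) - v (src G e)"
    using assms exact_forms_iff[OF G] by blast
  obtain w where b: "b \<in> one_forms G" "\<forall>e\<in>edges G. integral {0..len G e} (b e) = w (tgt G e) - w (src G e)"
    using assms exact_forms_iff[OF G] by blast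
  show "a + b \<in> exact_forms G"
    unfolding exact_forms_iff[OF G] using a b one_form_integral(1)[OF a(1) b(1)] one_forms_group_laws(1)[OF a(1) b(1)]
    by (intro conjI exI[of _ "\<lambda>u. v u + w u"]) auto
  show "a - b \<in> exact_forms G"
    unfolding exact_forms_iff[OF G] using a b one_form_integral(2)[OF a(1) b(1)] one_forms_group_laws(2)[OF a(1) b(1)]
    by (intro conjI exI[of _ "\<lambda>u. v u - w u"]) auto
qed

lemma zero_exact: "quantum_graph G \<Longrightarrow> 0 \<in> exact_forms G"
  unfolding exact_forms_iff using zero_one_form by (auto simp: zero_fun_def)

lemma exact_one_forms: "quantum_graph G \<Longrightarrow> exact_forms G \<subseteq> one_forms G"
  using exact_forms_iff by blast

lemma subgroup_exact_forms:
  assumes G: "quantum_graph G" shows "subgroup (exact_forms G) (one_form_group G)"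
proof -
  interpret comm_group "one_form_group G" by (rule comm_group_one_forms)
  show ?thesis
  proof (rule subgroupI)
    show "exact_forms G \<subseteq> carrier (one_form_group G)" using exact_one_forms[OF G] by (simp add: one_form_group_def)
    show "exact_forms G \<noteq> {}" using zero_exact[OF G] by blast
    fix a assume a: "a \<in> exact_forms G"
    have "inv\<^bsub>one_form_group G\<^esub> a = 0 - a"
    proof (rule inv_equality)
      show "(0 - a) \<otimes>\<^bsub>one_form_group G\<^esub> a = \<one>\<^bsub>one_form_group G\<^esub>" by (simp add: one_form_group_def)
    qed (use a exact_one_forms[OF G] exact_forms_closed(2)[OF G zero_exact[OF G] a] in \<open>auto simp: one_form_group_def\<close>)
    then show "inv\<^bsub>one_form_group G\<^esub> a \<in> exact_forms G" using exact_forms_closed(2)[OF G zero_exact[OF G] a] by simp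
  next
    fix a b assume "a \<in> exact_forms G" "b \<in> exact_forms G"
    then show "a \<otimes>\<^bsub>one_form_group G\<^esub> b \<in> exact_forms G" using exact_forms_closed(1)[OF G] by (simp add: one_form_group_def)
  qed
qed

lemma dR_class_eq: "dR_class G a = (\<lambda>x. x + a) ` exact_forms G"
  by (auto simp: dR_class_def r_coset_def one_form_group_def)

lemma in_dR_class: "quantum_graph G \<Longrightarrow> a \<in> dR_class G b \<longleftrightarrow> a - b \<in> exact_forms G"
  unfolding dR_class_eq by (auto simp: image_iff intro!: bexI[of _ "a - b"])

lemma H1_dR_carrier: "carrier (H1_dR G) = dR_class G ` one_forms G"
  by (auto simp: H1_dR_def FactGroup_def RCOSETS_def dR_class_def one_form_group_def)

lemma H1_dR_carrier_harmonic:
  assumes G: "quantum_graph G"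
  shows "carrier (H1_dR G) = (\<lambda>c. dR_class G (constant_form G c)) ` H1_real G"
proof
  show "(\<lambda>c. dR_class G (constant_form G c)) ` H1_real G \<subseteq> carrier (H1_dR G)"
    using constant_form_one_form[OF G] by (auto simp: H1_dR_carrier)
  show "carrier (H1_dR G) \<subseteq> (\<lambda>c. dR_class G (constant_form G c)) ` H1_real G"
  proof
    fix A assume "A \<in> carrier (H1_dR G)"
    then obtain a where a: "a \<in> one_forms G" "A = dR_class G a" by (auto simp: H1_dR_carrier)
    obtain c where c: "c \<in> H1_real G" "a - constant_form G c \<in> exact_forms G"
      using harmonic_representative_exists[OF G a(1)] by blast
    interpret comm_group "one_form_group G" by (rule comm_group_one_forms)
    have "a \<in> dR_class G (constant_form G c)" using c(2) in_dR_class[OF G] by blast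
    then have "dR_class G (constant_form G c) = dR_class G a"
      unfolding dR_class_def using subgroup_exact_forms[OF G] constant_form_one_form[OF G c(1)]
      by (intro repr_independence) (auto simp: one_form_group_def)
    then show "A \<in> (\<lambda>c. dR_class G (constant_form G c)) ` H1_real G" using a(2) c(1) by blast
  qed
qed

lemma harmonic_rep_constant_form:
  assumes G: "quantum_graph G" and c: "c \<in> H1_real G"
  shows "harmonic_rep G (dR_class G (constant_form G c)) = constant_form G c"
  unfolding harmonic_rep_def
proof (rule the_equality)
  show "constant_form G c \<in> dR_class G (constant_form G c) \<and> constant_form G c \<in> harmonic_forms G"
    using in_dR_class[OF G] zero_exact[OF G] harmonic_forms_eq[OF G] c by simp
  fix a assume a: "a \<in> dR_class G (constant_form G c) \<and> a \<in> harmonic_forms G"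
  then obtain d where d: "d \<in> H1_real G" "a = constant_form G d" using harmonic_forms_eq[OF G] by blast
  have "constant_form G (d - c) \<in> exact_forms G" using a in_dR_class[OF G] by (simp add: d(2) constant_form_add)
  then have "d - c = 0" by (intro exact_constant_form[OF G] subspace_diff[OF subspace_H1_real] d(1) c)
  then show "a = constant_form G c" using d(2) by simp
qed

lemma H1_inner_constant_form:
  assumes G: "quantum_graph G" and c: "c \<in> H1_real G" and d: "d \<in> H1_real G"
  shows "H1_inner G (dR_class G (constant_form G c)) (dR_class G (constant_form G d)) = len_inner G c d"
  unfolding H1_inner_def harmonic_rep_constant_form[OF G c] harmonic_rep_constant_form[OF G d] len_inner_def
proof (intro sum.cong refl)
  fix e assume e: "e \<in> edges G"
  have "integral {0..len G e} (\<lambda>x. constant_form G c e x * constant_form G d e x) = integral {0..len G e} (\<lambda>x. c $ e * d $ e)"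
    by (rule integral_cong) (use e in \<open>simp add: constant_form_def on_graph_def\<close>)
  then show "integral {0..len G e} (\<lambda>x. constant_form G c e x * constant_form G d e x) = len G e * (c $ e * d $ e)"
    using quantum_graphD(4)[OF G e] by simp
qed

lemma cycle_integral_class:
  assumes G: "quantum_graph G" and b: "b \<in> H1_real G" and c: "c \<in> H1_real G" and a: "a \<in> dR_class G (constant_form G b)"
  shows "cycle_integral G c a = len_inner G b c"
proof -
  have ex: "a - constant_form G b \<in> exact_forms G" using a in_dR_class[OF G] by blast
  then obtain val where x: "a - constant_form G b \<in> one_forms G"
    and val: "\<forall>e\<in>edges G. integral {0..len G e} ((a - constant_form G b) e) = val (tgt G e) - val (src G e)"
    using exact_forms_iff[OF G] by blast
  note cb = constant_form_one_form[OF G b]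
  have int: "integral {0..len G e} (a e) = (val (tgt G e) - val (src G e)) + len G e * b $ e" if e: "e \<in> edges G" for e
    using one_form_integral(1)[OF x cb e] val e integral_constant_form[OF G e, of b] by simp
  have "cycle_integral G c a = (\<Sum>e\<in>edges G. c $ e * (val (tgt G e) - val (src G e)) + len G e * (b $ e * c $ e))"
    unfolding cycle_integral_def
  proof (intro sum.cong refl)
    fix e assume "e \<in> edges G"
    then show "c $ e * integral {0..len G e} (a e) = c $ e * (val (tgt G e) - val (src G e)) + len G e * (b $ e * c $ e)"
      by (simp only: int distrib_left mult_ac)
  qed
  then show ?thesis using potential_orthogonal_to_cycles[OF G c] by (simp add: sum.distrib len_inner_def)
qed

lemma pairing_constant_form:
  assumes G: "quantum_graph G" and b: "b \<in> H1_real G" and c: "c \<in> H1_real G"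
  shows "pairing G (dR_class G (constant_form G b)) c = len_inner G b c"
proof -
  have "constant_form G b \<in> dR_class G (constant_form G b)" using in_dR_class[OF G] zero_exact[OF G] by simp
  then have "cycle_integral G c ` dR_class G (constant_form G b) = {len_inner G b c}"
    using cycle_integral_class[OF G b c] by force
  then show ?thesis by (simp add: pairing_def)
qed

text \<open>
  Both the pairing with a cycle and the inner product with a class are \<open>len_inner\<close> in harmonic
  coordinates.
\<close>

lemma dual_class_eq:
  assumes G: "quantum_graph G" and c: "c \<in> H1_real G"
  shows "dual_class G c = dR_class G (constant_form G c)"
  unfolding dual_class_def
proof (rule the_equality)
  show "dR_class G (constant_form G c) \<in> carrier (H1_dR G) \<and>
    (\<forall>B\<in>carrier (H1_dR G). H1_inner G B (dR_class G (constant_form G c)) = pairing G B c)"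
    using c by (auto simp: H1_dR_carrier_harmonic[OF G] H1_inner_constant_form[OF G] pairing_constant_form[OF G])
  fix A assume A: "A \<in> carrier (H1_dR G) \<and> (\<forall>B\<in>carrier (H1_dR G). H1_inner G B A = pairing G B c)"
  then obtain d where d: "d \<in> H1_real G" "A = dR_class G (constant_form G d)" using H1_dR_carrier_harmonic[OF G] by blast
  have dc: "d - c \<in> H1_real G" by (intro subspace_diff[OF subspace_H1_real] d(1) c)
  then have cls: "dR_class G (constant_form G (d - c)) \<in> carrier (H1_dR G)" using H1_dR_carrier_harmonic[OF G] by blast
  have "len_inner G (d - c) d = len_inner G (d - c) c"
    using A[THEN conjunct2, rule_format, OF cls] unfolding d(2) H1_inner_constant_form[OF G dc d(1)] pairing_constant_form[OF G dc c] .
  moreover have "len_inner G (d - c) d = len_inner G (d - c) (d - c) + len_inner G (d - c) c"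
    using len_inner_linear(3)[of G "d - c" "d - c" c] by simp
  ultimately have "d - c = 0" by (intro len_inner_eq_0[OF G dc]) simp
  then show "A = dR_class G (constant_form G c)" using d(2) by simp
qed

lemma dual_inner_eq:
  assumes "quantum_graph G" "c \<in> H1_real G" "d \<in> H1_real G"
  shows "dual_inner G c d = len_inner G c d"
  using assms by (simp add: dual_inner_def dual_class_eq H1_inner_constant_form)

section \<open>The torus of cohomology classes\<close>

lemma (in group) coset_mult_eq_iff:
  assumes H: "subgroup H G" and k: "k \<in> carrier G" and y: "y \<in> carrier G"
  shows "H #> (k \<otimes> y) = H #> y \<longleftrightarrow> k \<in> H"
proof
  assume "H #> (k \<otimes> y) = H #> y"
  then have "k \<otimes> y \<in> H #> y" using rcos_self[OF m_closed[OF k y] H] by simp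
  then obtain h where h: "h \<in> H" "k \<otimes> y = h \<otimes> y" by (auto simp: r_coset_def)
  then have "k = h" using right_cancel[of y k h] k y subgroup.mem_carrier[OF H] by auto
  then show "k \<in> H" using h(1) by simp
next
  assume "k \<in> H"
  then have "k \<otimes> y \<in> H #> y" by (auto simp: r_coset_def)
  then show "H #> (k \<otimes> y) = H #> y" using repr_independence[OF _ y H] by simp
qed

lemma comm_group_H1_dR: "quantum_graph G \<Longrightarrow> comm_group (H1_dR G)"
  unfolding H1_dR_def by (rule comm_group.abelian_FactGroup[OF comm_group_one_forms subgroup_exact_forms])

lemma class_add:
  assumes G: "quantum_graph G" and c: "c \<in> H1_real G" and d: "d \<in> H1_real G"
  shows "dR_class G (constant_form G (c + d)) = dR_class G (constant_form G c) \<otimes>\<^bsub>H1_dR G\<^esub> dR_class G (constant_form G d)"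
proof -
  interpret N: normal "exact_forms G" "one_form_group G"
    by (rule comm_group.subgroup_imp_normal[OF comm_group_one_forms subgroup_exact_forms[OF G]])
  show ?thesis
    using N.rcos_sum[of "constant_form G c" "constant_form G d"] constant_form_one_form[OF G c] constant_form_one_form[OF G d]
    by (simp add: dR_class_def H1_dR_def FactGroup_def constant_form_add) (simp add: one_form_group_def)
qed

lemma class_in_H1_dR_int_iff:
  assumes G: "quantum_graph G" and c: "c \<in> H1_real G"
  shows "dR_class G (constant_form G c) \<in> H1_dR_int G \<longleftrightarrow> c \<in> period_lattice G"
proof -
  let ?A = "dR_class G (constant_form G c)"
  have wi: "walk_integral G ss a = walk_sum (\<lambda>e. len G e * c $ e) ss" if ss: "closed_walk G ss" and a: "a \<in> ?A" for ss a
  proof -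
    obtain v where "walk G v ss v" using ss by (auto simp: closed_walk_def)
    then have E: "fst ` set ss \<subseteq> edges G" by (rule walk_edges)
    have "walk_integral G ss a = walk_sum (\<lambda>e. integral {0..len G e} (a e)) ss"
      by (simp add: walk_integral_def walk_sum_def)
    also have "\<dots> = cycle_integral G (walk_cycle ss) a"
      unfolding walk_sum_eq_cycle[OF E] cycle_integral_def ..
    also have "\<dots> = len_inner G c (walk_cycle ss)"
      using walk_cycle_in_H1_int[OF G ss] by (intro cycle_integral_class[OF G c _ a]) (simp add: H1_int_def)
    also have "\<dots> = walk_sum (\<lambda>e. len G e * c $ e) ss"
      unfolding walk_sum_eq_cycle[OF E] len_inner_def by (intro sum.cong refl) simp
    finally show ?thesis .
  qed
  have "?A \<in> carrier (H1_dR G)" using c H1_dR_carrier_harmonic[OF G] by blast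
  moreover have "constant_form G c \<in> ?A" using in_dR_class[OF G] zero_exact[OF G] by simp
  ultimately show ?thesis
    unfolding period_lattice_iff_closed_walks[OF G c] H1_dR_int_def using wi by (auto 4 3)
qed

lemma period_lattice_closed:
  assumes "c \<in> period_lattice G" "d \<in> period_lattice G"
  shows "c + d \<in> period_lattice G" "c - d \<in> period_lattice G"
proof -
  have "len_inner G (c - d) x = len_inner G c x - len_inner G d x" for x
    by (simp add: len_inner_def sum_subtractf algebra_simps)
  then show "c + d \<in> period_lattice G" "c - d \<in> period_lattice G"
    using assms subspace_add[OF subspace_H1_real] subspace_diff[OF subspace_H1_real]
    by (auto simp: period_lattice_def len_inner_linear)
qed

lemma zero_in_period_lattice: "0 \<in> period_lattice G"
  using subspace_0[OF subspace_H1_real] by (auto simp: period_lattice_def len_inner_def)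

lemma subgroup_H1_dR_int:
  fixes G :: "('v, 'e::finite) qgraph"
  assumes G: "quantum_graph G" shows "subgroup (H1_dR_int G) (H1_dR G)"
proof -
  interpret comm_group "H1_dR G" by (rule comm_group_H1_dR[OF G])
  let ?cl = "\<lambda>c. dR_class G (constant_form G c)"
  have img: "H1_dR_int G = ?cl ` period_lattice G"
  proof -
    have "H1_dR_int G \<subseteq> ?cl ` H1_real G" using H1_dR_carrier_harmonic[OF G] by (auto simp: H1_dR_int_def)
    then show ?thesis using class_in_H1_dR_int_iff[OF G] by (auto simp: period_lattice_def)
  qed
  have W: "period_lattice G \<subseteq> H1_real G" by (auto simp: period_lattice_def)
  have car: "?cl c \<in> carrier (H1_dR G)" if "c \<in> H1_real G" for c using that H1_dR_carrier_harmonic[OF G] by blast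
  have one: "?cl 0 = \<one>\<^bsub>H1_dR G\<^esub>"
  proof -
    have 0: "0 \<in> H1_real G" by (rule subspace_0[OF subspace_H1_real])
    have "?cl 0 \<otimes>\<^bsub>H1_dR G\<^esub> ?cl 0 = ?cl 0" using class_add[OF G 0 0] by simp
    then show ?thesis using car[OF 0] by (simp add: l_cancel_one)
  qed
  show ?thesis
  proof (rule subgroupI)
    show "H1_dR_int G \<subseteq> carrier (H1_dR G)" by (auto simp: H1_dR_int_def)
    show "H1_dR_int G \<noteq> {}" using zero_in_period_lattice img by blast
  next
    fix A assume "A \<in> H1_dR_int G"
    then obtain c where c: "c \<in> period_lattice G" "A = ?cl c" using img by blast
    have mc: "0 - c \<in> period_lattice G" by (rule period_lattice_closed(2)[OF zero_in_period_lattice c(1)])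
    have "?cl (0 - c) \<otimes>\<^bsub>H1_dR G\<^esub> ?cl c = ?cl ((0 - c) + c)" by (rule class_add[OF G, symmetric]) (use mc c(1) W in blast)+
    then have "?cl (0 - c) \<otimes>\<^bsub>H1_dR G\<^esub> ?cl c = \<one>\<^bsub>H1_dR G\<^esub>" using one by simp
    then have "inv\<^bsub>H1_dR G\<^esub> (?cl c) = ?cl (0 - c)"
      by (rule inv_equality) (use car W c(1) mc in blast)+
    then show "inv\<^bsub>H1_dR G\<^esub> A \<in> H1_dR_int G" using mc img c(2) by blast
  next
    fix A B assume "A \<in> H1_dR_int G" "B \<in> H1_dR_int G"
    then have "A \<in> ?cl ` period_lattice G" "B \<in> ?cl ` period_lattice G" unfolding img by simp_all
    then obtain c d where c: "c \<in> period_lattice G" "A = ?cl c" and d: "d \<in> period_lattice G" "B = ?cl d"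
      by (elim imageE)
    then have "c \<in> H1_real G" "d \<in> H1_real G" using W by blast+
    then have "A \<otimes>\<^bsub>H1_dR G\<^esub> B = ?cl (c + d)" unfolding c(2) d(2) by (rule class_add[OF G, symmetric])
    then show "A \<otimes>\<^bsub>H1_dR G\<^esub> B \<in> H1_dR_int G" using period_lattice_closed(1)[OF c(1) d(1)] img by blast
  qed
qed

lemma dR_torus_group:
  fixes G :: "('v, 'e::finite) qgraph"
  shows "quantum_graph G \<Longrightarrow> comm_group (dR_torus G)"
  unfolding dR_torus_def by (rule comm_group.abelian_FactGroup[OF comm_group_H1_dR subgroup_H1_dR_int])

lemma dR_torus_proj_carrier:
  assumes G: "quantum_graph G" and c: "c \<in> H1_real G"
  shows "dR_torus_proj G c \<in> carrier (dR_torus G)"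
  using c H1_dR_carrier_harmonic[OF G]
  by (auto simp: dR_torus_proj_def dR_torus_class_def dR_torus_def FactGroup_def RCOSETS_def)

lemma dR_torus_proj_add:
  assumes G: "quantum_graph G" and c: "c \<in> H1_real G" and d: "d \<in> H1_real G"
  shows "dR_torus_proj G (c + d) = dR_torus_proj G c \<otimes>\<^bsub>dR_torus G\<^esub> dR_torus_proj G d"
proof -
  interpret N: normal "H1_dR_int G" "H1_dR G"
    by (rule comm_group.subgroup_imp_normal[OF comm_group_H1_dR[OF G] subgroup_H1_dR_int[OF G]])
  have "dR_class G (constant_form G c) \<in> carrier (H1_dR G)" "dR_class G (constant_form G d) \<in> carrier (H1_dR G)"
    using c d H1_dR_carrier_harmonic[OF G] by blast+
  then show ?thesis
    using N.rcos_sum[of "dR_class G (constant_form G c)" "dR_class G (constant_form G d)"]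
    by (simp add: dR_torus_proj_def dR_torus_class_def dR_torus_def FactGroup_def class_add[OF G c d])
qed

lemma dR_torus_proj_eq_iff:
  assumes G: "quantum_graph G" and c: "c \<in> H1_real G" and d: "d \<in> H1_real G"
  shows "dR_torus_proj G c = dR_torus_proj G d \<longleftrightarrow> c - d \<in> period_lattice G"
proof -
  interpret comm_group "H1_dR G" by (rule comm_group_H1_dR[OF G])
  have cd: "c - d \<in> H1_real G" by (intro subspace_diff[OF subspace_H1_real] c d)
  have "dR_class G (constant_form G (c - d)) \<in> carrier (H1_dR G)" "dR_class G (constant_form G d) \<in> carrier (H1_dR G)"
    using cd d H1_dR_carrier_harmonic[OF G] by blast+
  moreover have "dR_class G (constant_form G c) = dR_class G (constant_form G (c - d)) \<otimes>\<^bsub>H1_dR G\<^esub> dR_class G (constant_form G d)"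
    using class_add[OF G cd d] by simp
  ultimately show ?thesis
    unfolding dR_torus_proj_def dR_torus_class_def
    using coset_mult_eq_iff[OF subgroup_H1_dR_int[OF G]] class_in_H1_dR_int_iff[OF G cd] by simp
qed

section \<open>Linearising a local lift of a homomorphism of tori\<close>

lemma linear_extension_from_subspace:
  fixes A :: "'a::euclidean_space \<Rightarrow> 'b::euclidean_space"
  assumes W: "subspace W" and add: "\<And>u v. u \<in> W \<Longrightarrow> v \<in> W \<Longrightarrow> A (u + v) = A u + A v"
    and scale: "\<And>t u. u \<in> W \<Longrightarrow> A (t *\<^sub>R u) = t *\<^sub>R A u"
  shows "\<exists>g. linear g \<and> (\<forall>u\<in>W. g u = A u)"
proof -
  obtain B where B: "B \<subseteq> W" "independent B" "W \<subseteq> span B" using basis_exists[of W] by metis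
  obtain g where g: "linear g" "\<forall>x\<in>B. g x = A x" using linear_independent_extend[OF B(2)] by blast
  have A0: "A 0 = 0" using scale[OF subspace_0[OF W], of 0] by simp
  have "subspace {x \<in> W. g x = A x}"
    using W A0 linear_0[OF g(1)] linear_add[OF g(1)] linear_cmul[OF g(1)] add scale
    by (auto simp: subspace_def)
  then have "span B \<subseteq> {x \<in> W. g x = A x}" using B(1) g(2) by (intro span_minimal) auto
  then show ?thesis using B(3) g(1) by blast
qed

text \<open>
  Read \<open>T u v\<close> as: \<open>u\<close> and \<open>v\<close> lie over corresponding points of the two tori. The local lift,
  shifted to vanish at \<open>0\<close>, is additive near \<open>0\<close> because its defect from additivity is a small
  element of a discrete group. So near \<open>0\<close> it agrees with its differential \<open>A\<close> at \<open>0\<close>, and the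
  relation \<open>T u (A u)\<close> extends from small \<open>u\<close> to all multiples.
\<close>

lemma local_lift_linear:
  fixes W :: "'a::euclidean_space set" and W' :: "'b::euclidean_space set"
  assumes W: "subspace W" and W': "subspace W'"
    and add: "\<And>u u' v v'. u \<in> W \<Longrightarrow> u' \<in> W \<Longrightarrow> v \<in> W' \<Longrightarrow> v' \<in> W' \<Longrightarrow> T u v \<Longrightarrow> T u' v' \<Longrightarrow> T (u + u') (v + v')"
    and neg: "\<And>u v. u \<in> W \<Longrightarrow> v \<in> W' \<Longrightarrow> T u v \<Longrightarrow> T (- u) (- v)"
    and \<rho>: "0 < \<rho>" and disc: "\<And>v. v \<in> W' \<Longrightarrow> T 0 v \<Longrightarrow> norm v < \<rho> \<Longrightarrow> v = 0"
    and sm: "smooth_on_subspace W U \<phi>" and U0: "0 \<in> U" and \<phi>W: "\<phi> ` U \<subseteq> W'" and T\<phi>: "\<And>u. u \<in> U \<Longrightarrow> T u (\<phi> u)"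
  shows "\<exists>A. linear A \<and> (\<forall>u\<in>W. A u \<in> W' \<and> T u (A u))"
proof -
  obtain D where op: "openin (top_of_set W) U" and D0: "\<forall>x\<in>U. D [] x = \<phi> x"
    and D: "\<And>vs. set vs \<subseteq> W \<Longrightarrow> continuous_on U (D vs) \<and>
       (\<forall>v\<in>W. \<forall>x\<in>U. ((\<lambda>t. D vs (x + t *\<^sub>R v)) has_vector_derivative D (v # vs) x) (at 0))"
    using sm unfolding smooth_on_subspace_def by blast
  define \<psi> where "\<psi> u = D [] u - D [] 0" for u
  define A where "A v = D [v] 0" for v
  obtain \<delta>0 where \<delta>0: "0 < \<delta>0" "ball 0 \<delta>0 \<inter> W \<subseteq> U"
    using op U0 unfolding openin_contains_ball by blast
  have cD: "continuous_on U (D [])" using D[of "[]"] by simp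
  have "0 < \<rho> / 3" using \<rho> by simp
  then obtain d where d: "0 < d" "\<forall>u\<in>U. dist u 0 < d \<longrightarrow> dist (D [] u) (D [] 0) < \<rho> / 3"
    using continuous_on_iff[THEN iffD1, OF cD, THEN bspec, OF U0] by blast
  define \<delta> where "\<delta> = min \<delta>0 d"
  have \<delta>: "0 < \<delta>" using \<delta>0 d by (simp add: \<delta>_def)
  have inU: "u \<in> U" if "u \<in> W" "norm u < \<delta>" for u using that \<delta>0 by (auto simp: \<delta>_def)
  have small: "norm (\<psi> u) < \<rho> / 3" if "u \<in> W" "norm u < \<delta>" for u
    using d(2)[rule_format, OF inU[OF that]] that by (simp add: \<psi>_def \<delta>_def dist_norm)
  have DU: "D [] u \<in> W' \<and> T u (D [] u)" if "u \<in> U" for u using that D0 \<phi>W T\<phi> by auto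
  have \<psi>: "\<psi> u \<in> W' \<and> T u (\<psi> u)" if u: "u \<in> W" "norm u < \<delta>" for u
  proof -
    have 1: "D [] u \<in> W'" "T u (D [] u)" "D [] 0 \<in> W'" "T 0 (D [] 0)" using DU[OF inU[OF u]] DU[OF U0] by auto
    have "T (- 0) (- D [] 0)" by (rule neg[OF subspace_0[OF W] 1(3,4)])
    then have "T (u + - 0) (D [] u + - D [] 0)"
      using u(1) 1 subspace_neg[OF W'] subspace_0[OF W] by (intro add) auto
    then show ?thesis using 1 subspace_diff[OF W'] by (simp add: \<psi>_def)
  qed
  have loc_add: "\<psi> (u + v) = \<psi> u + \<psi> v" if u: "u \<in> W" "norm u < \<delta>" and v: "v \<in> W" "norm v < \<delta>" and uv: "norm (u + v) < \<delta>" for u v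
  proof -
    have uvW: "u + v \<in> W" by (rule subspace_add[OF W u(1) v(1)])
    have 1: "\<psi> u + \<psi> v \<in> W'" "T (u + v) (\<psi> u + \<psi> v)"
      using \<psi>[OF u] \<psi>[OF v] subspace_add[OF W'] add[OF u(1) v(1)] by auto
    have 2: "- (\<psi> u + \<psi> v) \<in> W'" "T (- (u + v)) (- (\<psi> u + \<psi> v))"
      using subspace_neg[OF W' 1(1)] neg[OF uvW 1] by auto
    have 3: "\<psi> (u + v) + - (\<psi> u + \<psi> v) \<in> W'" "T ((u + v) + - (u + v)) (\<psi> (u + v) + - (\<psi> u + \<psi> v))"
      using \<psi>[OF uvW uv] 2 subspace_add[OF W'] add[OF uvW subspace_neg[OF W uvW]] by auto
    have "norm (\<psi> (u + v) + - (\<psi> u + \<psi> v)) \<le> norm (\<psi> (u + v)) + (norm (\<psi> u) + norm (\<psi> v))"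
      using norm_triangle_ineq4[of "\<psi> (u + v)" "\<psi> u + \<psi> v"] norm_triangle_ineq[of "\<psi> u" "\<psi> v"]
      unfolding add_uminus_conv_diff by linarith
    also have "\<dots> < \<rho>" using small[OF u] small[OF v] small[OF uvW uv] by simp
    finally have "\<psi> (u + v) + - (\<psi> u + \<psi> v) = 0" using 3 by (intro disc) auto
    then show ?thesis unfolding add_uminus_conv_diff by (simp only: right_minus_eq)
  qed
  have \<psi>0: "\<psi> 0 = 0" by (simp add: \<psi>_def)
  have mult: "\<psi> (real k *\<^sub>R u) = real k *\<^sub>R \<psi> u" if u: "u \<in> W" "real n * norm u < \<delta>" and k: "k \<le> n" for u n k
    using k
  proof (induction k)
    case 0
    then show ?case by (simp add: \<psi>0)
  next
    case (Suc k)
    have le: "real j * norm u < \<delta>" if "j \<le> n" for j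
    proof -
      have "real j * norm u \<le> real n * norm u" using that by (intro mult_right_mono) auto
      with u(2) show ?thesis by simp
    qed
    have 1: "norm (real j *\<^sub>R u) < \<delta>" if "j \<le> n" for j using le[OF that] by simp
    have 2: "real k *\<^sub>R u + u = real (Suc k) *\<^sub>R u" by (simp add: algebra_simps)
    have "\<psi> (real k *\<^sub>R u + u) = \<psi> (real k *\<^sub>R u) + \<psi> u"
      using u(1) subspace_scale[OF W] Suc.prems 1[of k] 1[of 1] 1[of "Suc k"] 2
      by (intro loc_add) auto
    then show ?case unfolding 2 using Suc by (simp add: algebra_simps)
  qed
  have deriv: "((\<lambda>t. D [] (t *\<^sub>R v)) has_vector_derivative A v) (at 0)" if "v \<in> W" for v
  proof -
    have "((\<lambda>t. D [] (0 + t *\<^sub>R v)) has_vector_derivative D [v] 0) (at 0)"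
      using D[of "[]"] that U0 by fastforce
    then show ?thesis by (simp add: A_def)
  qed
  have A\<psi>: "A v = \<psi> v" if v: "v \<in> W" "norm v < \<delta>" for v
  proof -
    have "norm (\<psi> v - A v) \<le> e" if e: "0 < e" for e
    proof -
      obtain r where r: "0 < r" "\<And>t. norm (t - 0) < r \<Longrightarrow> norm (D [] (t *\<^sub>R v) - D [] (0 *\<^sub>R v) - (t - 0) *\<^sub>R A v) \<le> e * norm (t - 0)"
        using deriv[OF v(1)] e unfolding has_vector_derivative_def has_derivative_at_alt by blast
      obtain n where n: "inverse (real (Suc n)) < r" using reals_Archimedean[OF r(1)] by blast
      let ?t = "inverse (real (Suc n))"
      have "norm (\<psi> (?t *\<^sub>R v) - ?t *\<^sub>R A v) \<le> e * ?t" using r(2)[of ?t] n by (simp add: \<psi>_def)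
      moreover
      have \<psi>v: "\<psi> v = real (Suc n) *\<^sub>R \<psi> (?t *\<^sub>R v)"
      proof -
        have 1: "real (Suc n) * norm (?t *\<^sub>R v) = norm v" by (simp add: mult.assoc[symmetric] del: of_nat_Suc)
        have 2: "real (Suc n) *\<^sub>R (?t *\<^sub>R v) = v" by (simp del: of_nat_Suc)
        show ?thesis using mult[of "?t *\<^sub>R v" "Suc n" "Suc n", unfolded 1 2] v subspace_scale[OF W v(1)] by blast
      qed
      ultimately have X: "norm (real (Suc n) *\<^sub>R (\<psi> (?t *\<^sub>R v) - ?t *\<^sub>R A v)) \<le> real (Suc n) * (e * ?t)"
        unfolding norm_scaleR by (intro mult_mono) auto
      have Y: "real (Suc n) *\<^sub>R (\<psi> (?t *\<^sub>R v) - ?t *\<^sub>R A v) = \<psi> v - A v"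
        using \<psi>v by (simp only: scaleR_diff_right scaleR_scaleR) simp
      have "real (Suc n) * (e * ?t) = e" by (simp add: field_simps)
      then show ?thesis using X unfolding Y by (simp only:)
    qed
    then have "norm (\<psi> v - A v) \<le> 0" by (rule field_le_epsilon[of _ 0, simplified])
    then show ?thesis by simp
  qed
  have A_scale: "A (s *\<^sub>R v) = s *\<^sub>R A v" if v: "v \<in> W" for s v
  proof -
    have "((\<lambda>t. D [] (t *\<^sub>R v)) \<circ> (\<lambda>t. t * s) has_vector_derivative s *\<^sub>R A v) (at 0)"
    proof (rule vector_diff_chain_at)
      show "((\<lambda>t. t * s) has_vector_derivative s) (at 0)"
        by (auto intro!: derivative_eq_intros simp flip: has_real_derivative_iff_has_vector_derivative)
      show "((\<lambda>t. D [] (t *\<^sub>R v)) has_vector_derivative A v) (at (0 * s))" using deriv[OF v] by simp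
    qed
    then have "((\<lambda>t. D [] (t *\<^sub>R (s *\<^sub>R v))) has_vector_derivative s *\<^sub>R A v) (at 0)" by (simp add: o_def)
    then show ?thesis using deriv[OF subspace_scale[OF W v]] vector_derivative_unique_at by blast
  qed
  have shrink: "\<exists>s>0. \<forall>x\<in>{a, b, c}. norm (s *\<^sub>R x) < \<delta>" for a b c :: 'a
  proof (intro exI[of _ "\<delta> / (norm a + norm b + norm c + 1)"] conjI ballI)
    have p: "0 < norm a + norm b + norm c + 1" by (simp add: add_nonneg_pos)
    then show "0 < \<delta> / (norm a + norm b + norm c + 1)" using \<delta> by simp
    fix x assume x: "x \<in> {a, b, c}"
    have "norm x < norm a + norm b + norm c + 1" using x by (auto simp: add_nonneg_pos)
    then have "\<delta> * norm x < \<delta> * (norm a + norm b + norm c + 1)" using \<delta> by (intro mult_strict_left_mono)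
    then show "norm ((\<delta> / (norm a + norm b + norm c + 1)) *\<^sub>R x) < \<delta>"
      using p \<delta> by (simp add: abs_of_pos pos_divide_less_eq)
  qed
  have A_add: "A (u + v) = A u + A v" if u: "u \<in> W" and v: "v \<in> W" for u v
  proof -
    obtain s where s: "0 < s" "\<forall>x\<in>{u, v, u + v}. norm (s *\<^sub>R x) < \<delta>" using shrink by blast
    have uv: "u + v \<in> W" by (rule subspace_add[OF W u v])
    have W3: "s *\<^sub>R u \<in> W" "s *\<^sub>R v \<in> W" "s *\<^sub>R (u + v) \<in> W" using u v uv subspace_scale[OF W] by auto
    have "\<psi> (s *\<^sub>R u + s *\<^sub>R v) = \<psi> (s *\<^sub>R u) + \<psi> (s *\<^sub>R v)"
      using W3 s(2) by (intro loc_add) (auto simp: scaleR_add_right[symmetric])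
    then have "A (s *\<^sub>R (u + v)) = A (s *\<^sub>R u) + A (s *\<^sub>R v)"
      using W3 s(2) by (simp add: A\<psi> scaleR_add_right[symmetric])
    then have "s *\<^sub>R A (u + v) = s *\<^sub>R (A u + A v)" 
      unfolding A_scale[OF u] A_scale[OF v] A_scale[OF uv] unfolding scaleR_add_right .
    then show ?thesis using s(1) by simp
  qed
  have AT: "A u \<in> W' \<and> T u (A u)" if u: "u \<in> W" for u
  proof -
    obtain n where n: "norm u / \<delta> < real (Suc n)" using reals_Archimedean2 by (metis less_Suc_eq of_nat_less_iff order.strict_trans)
    let ?w = "inverse (real (Suc n)) *\<^sub>R u"
    have w: "?w \<in> W" by (rule subspace_scale[OF W u])
    have "norm u < \<delta> * real (Suc n)" using n \<delta> by (simp add: pos_divide_less_eq mult.commute)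
    then have "norm ?w < \<delta>" by (simp add: field_simps)
    then have Aw: "A ?w \<in> W'" "T ?w (A ?w)" using \<psi>[OF w] A\<psi>[OF w] by auto
    have "T (real (Suc k) *\<^sub>R ?w) (real (Suc k) *\<^sub>R A ?w)" for k
    proof (induction k)
      case 0
      then show ?case using Aw by simp
    next
      case (Suc k)
      have "T (real (Suc k) *\<^sub>R ?w + ?w) (real (Suc k) *\<^sub>R A ?w + A ?w)"
        by (intro add subspace_scale[OF W w] w subspace_scale[OF W' Aw(1)] Aw Suc.IH)
      moreover have "real (Suc k) *\<^sub>R x + x = real (Suc (Suc k)) *\<^sub>R x" for x :: "'c::real_vector"
        unfolding of_nat_Suc[of "Suc k"] scaleR_left_distrib scaleR_one by (rule add.commute)
      ultimately show ?case by metis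
    qed
    from this[of n] have "T u (A u)" using A_scale[OF u] by simp
    moreover have "A u \<in> W'" using subspace_scale[OF W' Aw(1), of "real (Suc n)"] A_scale[OF u] by simp
    ultimately show ?thesis by blast
  qed
  obtain g where "linear g" "\<forall>u\<in>W. g u = A u" using linear_extension_from_subspace[OF W A_add A_scale] by blast
  then show ?thesis using AT by (intro exI[of _ g]) auto
qed

section \<open>From the spectra to the isometry\<close>

text \<open>
  A value of positive multiplicity is an eigenvalue, so it is not in the resolvent set and its
  multiplicity can be read off from the spectrum.
\<close>

lemma eigen_multiplicity_eq_if_Spec_eq:
  fixes G :: "('v, 'e::finite) qgraph" and G' :: "('w, 'f::finite) qgraph"
  assumes G: "quantum_graph G" "c \<in> H1_real G" and G': "quantum_graph G'" "c' \<in> H1_real G'"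
    and Spec: "Spec G (constant_form G c) = Spec G' (constant_form G' c')"
  shows "eigen_multiplicity G (constant_form G c) z = eigen_multiplicity G' (constant_form G' c') z"
proof -
  have spec: "z \<notin> resolvent_set G (constant_form G c)"
    if G: "quantum_graph G" "c \<in> H1_real G" and pos: "0 < eigen_multiplicity G (constant_form G c) z"
    for G :: "('x, 'y::finite) qgraph" and c
  proof
    assume "z \<in> resolvent_set G (constant_form G c)"
    moreover have "(\<lambda>e x. 0) \<in> L2_graph G" by (simp add: L2_graph_def square_integrable_def)
    ultimately have uniq: "\<exists>!f. f \<in> laplacian_domain G \<and> L2_eq G (shifted_laplacian G (constant_form G c) z f) (\<lambda>e x. 0)"
      unfolding resolvent_set_def by blast
    have 0: "0 \<in> eigenspace G (constant_form G c) z" by (rule eigenfunction_if_bloch_pair[OF G bloch_pair_zero])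
    have sub: "eigenspace G (constant_form G c) z \<subseteq> {0}"
      using uniq 0 unfolding eigenspace_def by blast
    obtain B where B: "B \<subseteq> eigenspace G (constant_form G c) z" "CV.independent B" "card B = CV.dim (eigenspace G (constant_form G c) z)"
      using CV.basis_exists by metis
    have "0 \<notin> B" using B(2) CV.dependent_zero by blast
    then have "B = {}" using B(1) sub by blast
    with B(3) pos show False by (simp add: eigen_multiplicity_def)
  qed
  have *: "eigen_multiplicity G' (constant_form G' c') z = eigen_multiplicity G (constant_form G c) z"
    if "0 < eigen_multiplicity G (constant_form G c) z"
  proof -
    have "(z, eigen_multiplicity G (constant_form G c) z) \<in> Spec G (constant_form G c)"
      using spec[OF G that] by (auto simp: Spec_def)
    then show ?thesis unfolding Spec by (auto simp: Spec_def)
  qed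
  have **: "eigen_multiplicity G (constant_form G c) z = eigen_multiplicity G' (constant_form G' c') z"
    if "0 < eigen_multiplicity G' (constant_form G' c') z"
  proof -
    have "(z, eigen_multiplicity G' (constant_form G' c') z) \<in> Spec G' (constant_form G' c')"
      using spec[OF G' that] by (auto simp: Spec_def)
    then show ?thesis unfolding Spec[symmetric] by (auto simp: Spec_def)
  qed
  show ?thesis using * ** by (cases "eigen_multiplicity G (constant_form G c) z = 0") force+
qed

lemma torus_homomorphism_lift:
  fixes G :: "('v, 'e::finite) qgraph" and G' :: "('w, 'f::finite) qgraph"
  assumes G: "quantum_graph G" and G': "quantum_graph G'" and iso: "\<Phi> \<in> iso (dR_torus G) (dR_torus G')"
    and sm: "smooth_torus_map (harmonic_coords G) (dR_torus_proj G) (harmonic_coords G') (dR_torus_proj G') \<Phi>"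
  shows "\<exists>A. linear A \<and> (\<forall>u\<in>H1_real G. A u \<in> H1_real G' \<and> \<Phi> (dR_torus_proj G u) = dR_torus_proj G' (A u))"
proof -
  interpret K: comm_group "dR_torus G" by (rule dR_torus_group[OF G])
  interpret K': comm_group "dR_torus G'" by (rule dR_torus_group[OF G'])
  have hom: "\<Phi> (x \<otimes>\<^bsub>dR_torus G\<^esub> y) = \<Phi> x \<otimes>\<^bsub>dR_torus G'\<^esub> \<Phi> y"
    if "x \<in> carrier (dR_torus G)" "y \<in> carrier (dR_torus G)" for x y
    using iso that by (simp add: iso_def hom_def)
  have car: "\<Phi> x \<in> carrier (dR_torus G')" if "x \<in> carrier (dR_torus G)" for x
    using iso that by (auto simp: iso_def hom_def)
  let ?W = "H1_real G" and ?W' = "H1_real G'"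
  let ?p = "dR_torus_proj G" and ?p' = "dR_torus_proj G'"
  note W = subspace_H1_real[of G] and W' = subspace_H1_real[of G']
  have one: "?p 0 = \<one>\<^bsub>dR_torus G\<^esub>" "?p' 0 = \<one>\<^bsub>dR_torus G'\<^esub>"
    using dR_torus_proj_add[OF G subspace_0[OF W] subspace_0[OF W]] dR_torus_proj_carrier[OF G subspace_0[OF W]]
      dR_torus_proj_add[OF G' subspace_0[OF W'] subspace_0[OF W']] dR_torus_proj_carrier[OF G' subspace_0[OF W']]
    by simp_all
  have \<Phi>one: "\<Phi> (?p 0) = ?p' 0"
  proof -
    have "\<Phi> (?p 0) \<otimes>\<^bsub>dR_torus G'\<^esub> \<Phi> (?p 0) = \<Phi> (?p 0)"
      using hom[of "?p 0" "?p 0"] dR_torus_proj_carrier[OF G subspace_0[OF W]] one(1) by simp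
    then show ?thesis using car[OF dR_torus_proj_carrier[OF G subspace_0[OF W]]] one(2) by simp
  qed
  obtain \<rho> where \<rho>: "0 < \<rho>" "\<forall>v\<in>period_lattice G'. norm v < \<rho> \<longrightarrow> v = 0"
    using period_lattice_discrete[OF G'] by blast
  have "\<exists>U \<phi>. 0 \<in> U \<and> local_lift ?W ?p ?W' ?p' \<Phi> U \<phi>"
    using sm subspace_0[OF W] unfolding smooth_torus_map_def harmonic_coords_eq_H1_real[OF G] harmonic_coords_eq_H1_real[OF G'] by blast
  then obtain U \<phi> where U: "0 \<in> U" "smooth_on_subspace ?W U \<phi>" "\<phi> ` U \<subseteq> ?W'" "\<forall>u\<in>U. \<Phi> (?p u) = ?p' (\<phi> u)"
    unfolding local_lift_def by blast
  show ?thesis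
  proof (rule local_lift_linear[OF W W' _ _ \<rho>(1) _ U(2,1,3), where T = "\<lambda>u v. \<Phi> (?p u) = ?p' v"])
    show "\<Phi> (?p (u + u')) = ?p' (v + v')"
      if "u \<in> ?W" "u' \<in> ?W" "v \<in> ?W'" "v' \<in> ?W'" "\<Phi> (?p u) = ?p' v" "\<Phi> (?p u') = ?p' v'" for u u' v v'
      using that by (simp add: dR_torus_proj_add[OF G] dR_torus_proj_add[OF G'] hom dR_torus_proj_carrier[OF G])
    show "\<Phi> (?p (- u)) = ?p' (- v)" if u: "u \<in> ?W" and v: "v \<in> ?W'" and uv: "\<Phi> (?p u) = ?p' v" for u v
    proof -
      have m: "- u \<in> ?W" "- v \<in> ?W'" using u v subspace_neg[OF W] subspace_neg[OF W'] by auto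
      have "\<Phi> (?p (- u)) \<otimes>\<^bsub>dR_torus G'\<^esub> \<Phi> (?p u) = \<Phi> (?p (- u + u))"
        using u m by (simp only: dR_torus_proj_add[OF G] hom dR_torus_proj_carrier[OF G])
      also have "\<dots> = ?p' (- v + v)" using \<Phi>one by simp
      also have "\<dots> = ?p' (- v) \<otimes>\<^bsub>dR_torus G'\<^esub> \<Phi> (?p u)" unfolding uv by (rule dR_torus_proj_add[OF G' m(2) v])
      finally have E: "\<Phi> (?p (- u)) \<otimes>\<^bsub>dR_torus G'\<^esub> \<Phi> (?p u) = ?p' (- v) \<otimes>\<^bsub>dR_torus G'\<^esub> \<Phi> (?p u)" .
      show ?thesis
        by (rule iffD1[OF K'.right_cancel[OF car[OF dR_torus_proj_carrier[OF G u]]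
              car[OF dR_torus_proj_carrier[OF G m(1)]] dR_torus_proj_carrier[OF G' m(2)]] E])
    qed
    show "v = 0" if v: "v \<in> ?W'" "\<Phi> (?p 0) = ?p' v" "norm v < \<rho>" for v
      using v dR_torus_proj_eq_iff[OF G' v(1) subspace_0[OF W']] \<Phi>one \<rho>(2) by simp
    show "\<Phi> (?p u) = ?p' (\<phi> u)" if "u \<in> U" for u using U(4) that by blast
  qed
qed

text \<open>
  A linear map with discrete image vanishes, since it takes small vectors to small values.
\<close>

lemma linear_discrete_image_zero:
  fixes F :: "'a::real_vector \<Rightarrow> 'b::real_normed_vector"
  assumes "subspace W" "linear F" "0 < \<rho>" "\<And>u. u \<in> W \<Longrightarrow> norm (F u) < \<rho> \<Longrightarrow> F u = 0" "u \<in> W"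
  shows "F u = 0"
proof -
  define s where "s = \<rho> / (2 * (norm (F u) + 1))"
  have p: "0 < norm (F u) + 1" by (simp add: add_nonneg_pos)
  then have s: "0 < s" using assms(3) by (simp add: s_def)
  have "norm (F (s *\<^sub>R u)) = s * norm (F u)" using s by (simp add: linear_cmul[OF assms(2)])
  also have "\<dots> \<le> s * (norm (F u) + 1)" using s by simp
  also have "\<dots> = \<rho> / 2"
  proof -
    define P where "P = norm (F u) + 1"
    have "0 < P" using p by (simp add: P_def)
    then show ?thesis unfolding s_def P_def[symmetric] by simp
  qed
  also have "\<dots> < \<rho>" using assms(3) by simp
  finally have "F (s *\<^sub>R u) = 0" by (intro assms(4) subspace_scale[OF assms(1,5)])
  then show ?thesis using s by (simp add: linear_cmul[OF assms(2)])
qed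

text \<open>
  Both composites of the lifts of an isomorphism and of its inverse differ from the identity by
  linear maps into period lattices, which vanish.
\<close>

lemma torus_isomorphism_lift:
  fixes G :: "('v, 'e::finite) qgraph" and G' :: "('w, 'f::finite) qgraph"
  assumes G: "quantum_graph G" and G': "quantum_graph G'" and lie: "lie_group_iso G G' \<Phi>"
  shows "\<exists>A B. linear A \<and> linear B \<and>
    (\<forall>u\<in>H1_real G. A u \<in> H1_real G' \<and> B (A u) = u \<and> \<Phi> (dR_torus_proj G u) = dR_torus_proj G' (A u)) \<and>
    (\<forall>v\<in>H1_real G'. B v \<in> H1_real G \<and> A (B v) = v \<and> \<Phi> (dR_torus_proj G (B v)) = dR_torus_proj G' v)"
proof -
  let ?W = "H1_real G" and ?W' = "H1_real G'"
  let ?p = "dR_torus_proj G" and ?p' = "dR_torus_proj G'"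
  let ?\<Psi> = "inv_into (carrier (dR_torus G)) \<Phi>"
  note W = subspace_H1_real[of G] and W' = subspace_H1_real[of G']
  interpret K: comm_group "dR_torus G" by (rule dR_torus_group[OF G])
  have iso: "\<Phi> \<in> iso (dR_torus G) (dR_torus G')"
    and sm: "smooth_torus_map (harmonic_coords G) ?p (harmonic_coords G') ?p' \<Phi>"
    and sm': "smooth_torus_map (harmonic_coords G') ?p' (harmonic_coords G) ?p ?\<Psi>"
    using lie by (auto simp: lie_group_iso_def)
  have bij: "bij_betw \<Phi> (carrier (dR_torus G)) (carrier (dR_torus G'))" using iso by (simp add: iso_def)
  have iso': "?\<Psi> \<in> iso (dR_torus G') (dR_torus G)" by (rule K.iso_set_sym[OF iso])
  obtain A where A: "linear A" "\<forall>u\<in>?W. A u \<in> ?W' \<and> \<Phi> (?p u) = ?p' (A u)"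
    using torus_homomorphism_lift[OF G G' iso sm] by blast
  obtain B where B: "linear B" "\<forall>v\<in>?W'. B v \<in> ?W \<and> ?\<Psi> (?p' v) = ?p (B v)"
    using torus_homomorphism_lift[OF G' G iso' sm'] by blast
  have B': "\<Phi> (?p (B v)) = ?p' v" if "v \<in> ?W'" for v
    using B(2) that f_inv_into_f[of "?p' v" \<Phi> "carrier (dR_torus G)"] dR_torus_proj_carrier[OF G' that] bij
    by (simp add: bij_betw_def)
  obtain \<rho> where \<rho>: "0 < \<rho>" "\<forall>v\<in>period_lattice G. norm v < \<rho> \<longrightarrow> v = 0" using period_lattice_discrete[OF G] by blast
  obtain \<rho>' where \<rho>': "0 < \<rho>'" "\<forall>v\<in>period_lattice G'. norm v < \<rho>' \<longrightarrow> v = 0" using period_lattice_discrete[OF G'] by blast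
  have BA: "B (A u) - u = 0" if u: "u \<in> ?W" for u
  proof (rule linear_discrete_image_zero[OF W _ \<rho>(1) _ u, where F = "\<lambda>u. B (A u) - u"])
    show "linear (\<lambda>u. B (A u) - u)" by (rule linear_compose_sub[OF linear_compose[OF A(1) B(1), unfolded o_def] linear_ident])
    fix u assume u: "u \<in> ?W" "norm (B (A u) - u) < \<rho>"
    have BAu: "B (A u) \<in> ?W" "A u \<in> ?W'" using A(2) B(2) u(1) by auto
    have "\<Phi> (?p (B (A u))) = \<Phi> (?p u)" using B'[OF BAu(2)] A(2) u(1) by simp
    then have "?p (B (A u)) = ?p u"
      by (rule inj_onD[OF bij_betw_imp_inj_on[OF bij] _ dR_torus_proj_carrier[OF G BAu(1)] dR_torus_proj_carrier[OF G u(1)]])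
    then have "B (A u) - u \<in> period_lattice G" using dR_torus_proj_eq_iff[OF G BAu(1) u(1)] by simp
    then show "B (A u) - u = 0" using \<rho>(2) u(2) by blast
  qed
  have AB: "A (B v) - v = 0" if v: "v \<in> ?W'" for v
  proof (rule linear_discrete_image_zero[OF W' _ \<rho>'(1) _ v, where F = "\<lambda>v. A (B v) - v"])
    show "linear (\<lambda>v. A (B v) - v)" by (rule linear_compose_sub[OF linear_compose[OF B(1) A(1), unfolded o_def] linear_ident])
    fix v assume v: "v \<in> ?W'" "norm (A (B v) - v) < \<rho>'"
    have ABv: "A (B v) \<in> ?W'" "B v \<in> ?W" using A(2) B(2) v(1) by auto
    have "?p' (A (B v)) = ?p' v" using B'[OF v(1)] A(2) ABv(2) by simp
    then have "A (B v) - v \<in> period_lattice G'" using dR_torus_proj_eq_iff[OF G' ABv(1) v(1)] by simp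
    then show "A (B v) - v = 0" using \<rho>'(2) v(2) by blast
  qed
  show ?thesis using A B B' BA AB by (intro exI[of _ A] exI[of _ B]) auto
qed

text \<open>
  Scaling \<open>c\<close> towards \<open>0\<close>, the lowest eigenvalue at \<open>c\<close> is asymptotically \<open>4 \<pi>\<^sup>2 <c, c> / L\<close>, and
  it is also an eigenvalue at \<open>A c\<close>.
\<close>

lemma len_inner_le_if_isospectral:
  fixes G :: "('v, 'e::finite) qgraph" and G' :: "('w, 'f::finite) qgraph"
  assumes G: "quantum_graph G" and G': "quantum_graph G'" and A: "linear A" "\<And>u. u \<in> H1_real G \<Longrightarrow> A u \<in> H1_real G'"
    and L: "total_length G = total_length G'"
    and eq: "\<And>u z. u \<in> H1_real G \<Longrightarrow>
       eigen_multiplicity G (constant_form G u) z = eigen_multiplicity G' (constant_form G' (A u)) z"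
    and c: "c \<in> H1_real G"
  shows "len_inner G' (A c) (A c) \<le> len_inner G c c"
proof (cases "c = 0")
  case True
  then show ?thesis using linear_0[OF A(1)] by (simp add: len_inner_def)
next
  case False
  then have Q: "0 < len_inner G c c" using len_inner_eq_0[OF G c] len_inner_nonneg[OF G, of c] by fastforce
  have main: "(1 - \<epsilon>) * len_inner G' (A c) (A c) \<le> (1 + \<epsilon>) * len_inner G c c" if \<epsilon>: "0 < \<epsilon>" for \<epsilon>
  proof -
    obtain \<delta> where \<delta>: "0 < \<delta>" "\<forall>c\<in>H1_real G. 0 < len_inner G c c \<longrightarrow> norm c < \<delta> \<longrightarrow>
      (\<exists>k\<ge>0. k\<^sup>2 * total_length G \<le> (1 + \<epsilon>) * (4 * pi\<^sup>2 * len_inner G c c) \<and>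
       0 < eig_mult G c k)"
      using small_eigenvalue_exists[OF G \<epsilon>] by blast
    obtain \<delta>' where \<delta>': "0 < \<delta>'" "\<forall>c\<in>H1_real G'. norm c < \<delta>' \<longrightarrow> (\<forall>k\<ge>0.
      0 < eig_mult G' c k \<longrightarrow>
      (1 - \<epsilon>) * (4 * pi\<^sup>2 * len_inner G' c c) \<le> k\<^sup>2 * total_length G')"
      using eigenvalues_bounded_below[OF G' \<epsilon>] by blast
    define s where "s = min \<delta> \<delta>' / (norm c + norm (A c) + 1)"
    have p: "0 < norm c + norm (A c) + 1" by (simp add: add_nonneg_pos)
    have s: "0 < s" using p \<delta>(1) \<delta>'(1) by (simp add: s_def)
    have lt: "s * x < min \<delta> \<delta>'" if "x < norm c + norm (A c) + 1" for x
    proof -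
      have "s * x < s * (norm c + norm (A c) + 1)" using that s by (rule mult_strict_left_mono)
      also have "\<dots> = min \<delta> \<delta>'" using p by (simp add: s_def)
      finally show ?thesis .
    qed
    have sc: "s *\<^sub>R c \<in> H1_real G" by (rule subspace_scale[OF subspace_H1_real c])
    have Asc: "A (s *\<^sub>R c) = s *\<^sub>R A c" by (rule linear_cmul[OF A(1)])
    have n1: "norm (s *\<^sub>R c) < \<delta>" using lt[of "norm c"] s by (simp add: add_nonneg_pos)
    have n2: "norm (A (s *\<^sub>R c)) < \<delta>'" using lt[of "norm (A c)"] s by (simp add: Asc add_nonneg_pos)
    have Qs: "len_inner G (s *\<^sub>R c) (s *\<^sub>R c) = s\<^sup>2 * len_inner G c c"
      "len_inner G' (A (s *\<^sub>R c)) (A (s *\<^sub>R c)) = s\<^sup>2 * len_inner G' (A c) (A c)"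
      unfolding Asc by (simp_all add: len_inner_linear(2,4) power2_eq_square)
    obtain k where k: "0 \<le> k" "k\<^sup>2 * total_length G \<le> (1 + \<epsilon>) * (4 * pi\<^sup>2 * len_inner G (s *\<^sub>R c) (s *\<^sub>R c))"
       "0 < eig_mult G (s *\<^sub>R c) k"
      using \<delta>(2)[rule_format, OF sc _ n1] Q s unfolding Qs(1) by auto
    have "(1 - \<epsilon>) * (4 * pi\<^sup>2 * len_inner G' (A (s *\<^sub>R c)) (A (s *\<^sub>R c))) \<le> k\<^sup>2 * total_length G'"
      using \<delta>'(2) A(2)[OF sc] n2 k(1,3) unfolding eq[OF sc] by blast
    then have "(1 - \<epsilon>) * (4 * pi\<^sup>2 * (s\<^sup>2 * len_inner G' (A c) (A c))) \<le> (1 + \<epsilon>) * (4 * pi\<^sup>2 * (s\<^sup>2 * len_inner G c c))"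
      using k(2) unfolding Qs L[symmetric] by linarith
    then have "(4 * pi\<^sup>2 * s\<^sup>2) * ((1 - \<epsilon>) * len_inner G' (A c) (A c)) \<le> (4 * pi\<^sup>2 * s\<^sup>2) * ((1 + \<epsilon>) * len_inner G c c)"
      by (simp only: mult_ac)
    then show ?thesis by (rule mult_left_le_imp_le) (use s in simp)
  qed
  show ?thesis
  proof (rule field_le_epsilon)
    fix e :: real assume e: "0 < e"
    define S where "S = len_inner G' (A c) (A c) + len_inner G c c"
    have S: "0 < S" using Q len_inner_nonneg[OF G', of "A c"] by (simp add: S_def)
    have "0 < e / S" using e S by simp
    from main[OF this] have "len_inner G' (A c) (A c) \<le> len_inner G c c + e / S * S"
      by (simp add: S_def left_diff_distrib distrib_right distrib_left)
    then show "len_inner G' (A c) (A c) \<le> len_inner G c c + e" using S by simp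
  qed
qed

lemma Alb_proj_eq_iff: "Alb_proj G c = Alb_proj G d \<longleftrightarrow> c - d \<in> H1_int G"
proof -
  have add: "x + y \<in> H1_int G" "x - y \<in> H1_int G" if "x \<in> H1_int G" "y \<in> H1_int G" for x y
    using that subspace_add[OF subspace_H1_real] subspace_diff[OF subspace_H1_real] by (auto simp: H1_int_def)
  have 0: "0 \<in> H1_int G" using subspace_0[OF subspace_H1_real] by (auto simp: H1_int_def)
  have mem: "x \<in> Alb_proj G y \<longleftrightarrow> x - y \<in> H1_int G" for x y
    by (auto simp: Alb_proj_def image_iff intro!: bexI[of _ "x - y"])
  show ?thesis
  proof
    assume "Alb_proj G c = Alb_proj G d"
    moreover have "c \<in> Alb_proj G c" using mem 0 by simp
    ultimately show "c - d \<in> H1_int G" using mem by blast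
  next
    assume cd: "c - d \<in> H1_int G"
    have "x - c \<in> H1_int G \<longleftrightarrow> x - d \<in> H1_int G" for x
    proof
      assume "x - c \<in> H1_int G"
      then have "(x - c) + (c - d) \<in> H1_int G" using cd by (rule add(1))
      then show "x - d \<in> H1_int G" by simp
    next
      assume "x - d \<in> H1_int G"
      then have "(x - d) - (c - d) \<in> H1_int G" using cd by (rule add(2))
      then show "x - c \<in> H1_int G" by simp
    qed
    then show "Alb_proj G c = Alb_proj G d" using mem by blast
  qed
qed

lemma smooth_on_subspace_linear:
  fixes A :: "'a::euclidean_space \<Rightarrow> 'b::euclidean_space"
  assumes "linear A" "subspace W" shows "smooth_on_subspace W W A"
proof -
  define D where "D vs x = (case vs of [] \<Rightarrow> A x | [v] \<Rightarrow> A v | _ \<Rightarrow> 0)" for vs x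
  have "continuous_on W (D vs)" for vs
    unfolding D_def using linear_continuous_on[OF assms(1)[unfolded linear_conv_bounded_linear]]
    by (cases vs; cases "tl vs") (auto)
  moreover have "((\<lambda>t. D vs (x + t *\<^sub>R v)) has_vector_derivative D (v # vs) x) (at 0)" for vs x v
  proof (cases vs)
    case Nil
    have "((\<lambda>t. A x + t *\<^sub>R A v) has_vector_derivative A v) (at 0)"
      by (auto intro!: derivative_eq_intros simp: has_vector_derivative_def)
    then show ?thesis by (simp add: Nil D_def linear_add[OF assms(1)] linear_cmul[OF assms(1)])
  next
    case (Cons w ws)
    then show ?thesis by (cases ws) (auto simp: D_def)
  qed
  ultimately show ?thesis
    unfolding smooth_on_subspace_def by (intro conjI exI[of _ D]) (auto simp: D_def)
qed

theorem theorem1p1: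
  fixes G :: "('v, 'e::finite) qgraph" and G' :: "('w, 'f::finite) qgraph"
  assumes "quantum_graph G" and "quantum_graph G'"
    and "bloch_isospectral G G'"
  shows "\<exists>F :: (real ^ 'e) set \<Rightarrow> (real ^ 'f) set. Alb_isometry G G' F"
proof -
  note G = assms(1) and G' = assms(2)
  let ?W = "H1_real G" and ?W' = "H1_real G'"
  note W = subspace_H1_real[of G] and W' = subspace_H1_real[of G']
  obtain \<Phi> where lie: "lie_group_iso G G' \<Phi>"
    and spec: "\<forall>a\<in>one_forms G. \<forall>b\<in>one_forms G'. \<Phi> (dR_torus_class G a) = dR_torus_class G' b \<longrightarrow> Spec G a = Spec G' b"
    using assms(3) unfolding bloch_isospectral_def by blast
  obtain A B where lin: "linear A" "linear B"
    and A: "\<And>u. u \<in> ?W \<Longrightarrow> A u \<in> ?W' \<and> B (A u) = u \<and> \<Phi> (dR_torus_proj G u) = dR_torus_proj G' (A u)"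
    and B: "\<And>v. v \<in> ?W' \<Longrightarrow> B v \<in> ?W \<and> A (B v) = v \<and> \<Phi> (dR_torus_proj G (B v)) = dR_torus_proj G' v"
    using torus_isomorphism_lift[OF G G' lie] by metis
  have mult: "eigen_multiplicity G (constant_form G u) z = eigen_multiplicity G' (constant_form G' (A u)) z" if u: "u \<in> ?W" for u z
  proof (rule eigen_multiplicity_eq_if_Spec_eq[OF G u G'])
    show Au: "A u \<in> ?W'" using A[OF u] by blast
    show "Spec G (constant_form G u) = Spec G' (constant_form G' (A u))"
      using spec constant_form_one_form[OF G u] constant_form_one_form[OF G' Au] A[OF u] unfolding dR_torus_proj_def by blast
  qed
  \<comment> \<open>The trivial classes correspond under \<open>A\<close>, so their spectra agree and Weyl's law applies.\<close>
  have L: "total_length G = total_length G'"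
  proof (rule antisym)
    have 0: "0 \<in> ?W" "A 0 \<in> ?W'" using subspace_0[OF W] A by auto
    show "total_length G' \<le> total_length G"
      by (rule total_length_le_if_isospectral[OF G 0(1) G' 0(2)]) (rule mult[OF 0(1)])
    show "total_length G \<le> total_length G'"
      by (rule total_length_le_if_isospectral[OF G' 0(2) G 0(1)]) (rule mult[OF 0(1), symmetric])
  qed
  have norm_eq: "len_inner G' (A u) (A u) = len_inner G u u" if u: "u \<in> ?W" for u
  proof (rule antisym)
    show "len_inner G' (A u) (A u) \<le> len_inner G u u"
      by (rule len_inner_le_if_isospectral[OF G G' lin(1) _ L mult u]) (use A in blast)+
    have "len_inner G (B (A u)) (B (A u)) \<le> len_inner G' (A u) (A u)"
    proof (rule len_inner_le_if_isospectral[OF G' G lin(2) _ L[symmetric]])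
      show "eigen_multiplicity G' (constant_form G' v) z = eigen_multiplicity G (constant_form G (B v)) z" if "v \<in> ?W'" for v z
        using mult[of "B v" z] B[OF that] by simp
    qed (use A[OF u] B in blast)+
    then show "len_inner G u u \<le> len_inner G' (A u) (A u)" using A[OF u] by simp
  qed
  have isom: "len_inner G' (A u) (A v) = len_inner G u v" if u: "u \<in> ?W" and v: "v \<in> ?W" for u v
  proof -
    have polar: "len_inner H (x + y) (x + y) = len_inner H x x + 2 * len_inner H x y + len_inner H y y"
      for H :: "('x, 'y::finite) qgraph" and x y
      using len_inner_linear(5)[of H y x] by (simp add: len_inner_linear(1,3))
    have "len_inner G' (A u + A v) (A u + A v) = len_inner G (u + v) (u + v)"
      using norm_eq[OF subspace_add[OF W u v]] by (simp add: linear_add[OF lin(1)])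
    then show ?thesis unfolding polar using norm_eq[OF u] norm_eq[OF v] by simp
  qed
  have lat: "A u \<in> period_lattice G' \<longleftrightarrow> u \<in> period_lattice G" if u: "u \<in> ?W" for u
  proof -
    have 0: "0 \<in> ?W" "0 \<in> ?W'" by (rule subspace_0[OF W], rule subspace_0[OF W'])
    have inj: "inj_on \<Phi> (carrier (dR_torus G))"
      using lie unfolding lie_group_iso_def iso_def by (auto dest: bij_betw_imp_inj_on)
    have "A u \<in> period_lattice G' \<longleftrightarrow> dR_torus_proj G' (A u) = dR_torus_proj G' (A 0)"
      using dR_torus_proj_eq_iff[OF G', of "A u" 0] A[OF u] 0(2) linear_0[OF lin(1)] by simp
    also have "\<dots> \<longleftrightarrow> \<Phi> (dR_torus_proj G u) = \<Phi> (dR_torus_proj G 0)" using A[OF u] A[OF 0(1)] by simp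
    also have "\<dots> \<longleftrightarrow> dR_torus_proj G u = dR_torus_proj G 0"
      using inj dR_torus_proj_carrier[OF G] u 0(1) by (simp add: inj_on_eq_iff)
    also have "\<dots> \<longleftrightarrow> u \<in> period_lattice G" using dR_torus_proj_eq_iff[OF G u 0(1)] by simp
    finally show ?thesis .
  qed
  \<comment> \<open>The integral cycles form the dual lattice of the period lattice, so an isometry that
    respects the period lattices respects them too.\<close>
  have int: "A u \<in> H1_int G' \<longleftrightarrow> u \<in> H1_int G" if u: "u \<in> ?W" for u
  proof
    assume "A u \<in> H1_int G'"
    then show "u \<in> H1_int G"
      unfolding H1_int_iff_dual[OF G u] using H1_int_iff_dual[OF G', of "A u"] A[OF u] lat isom[OF _ u]
      by (metis (no_types, lifting) mem_Collect_eq period_lattice_def)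
  next
    assume R: "u \<in> H1_int G"
    have Au: "A u \<in> ?W'" using A[OF u] by blast
    show "A u \<in> H1_int G'"
      unfolding H1_int_iff_dual[OF G' Au]
    proof
      fix v assume v: "v \<in> period_lattice G'"
      then have vW: "v \<in> ?W'" by (simp add: period_lattice_def)
      then have "B v \<in> period_lattice G" using lat[of "B v"] B[OF vW] v by simp
      then have "len_inner G (B v) u \<in> \<int>" using R H1_int_iff_dual[OF G u] by blast
      then show "len_inner G' v (A u) \<in> \<int>" using isom[of "B v" u] B[OF vW] u by simp
    qed
  qed
  define F where "F X = Alb_proj G' (A (SOME u. u \<in> ?W \<and> Alb_proj G u = X))" for X
  have proj: "Alb_proj G' (A u) = Alb_proj G' (A v) \<longleftrightarrow> Alb_proj G u = Alb_proj G v" if "u \<in> ?W" "v \<in> ?W" for u v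
    unfolding Alb_proj_eq_iff linear_diff[OF lin(1), symmetric] using int subspace_diff[OF W that] by blast
  have F: "F (Alb_proj G u) = Alb_proj G' (A u)" if u: "u \<in> ?W" for u
  proof -
    have "(SOME u'. u' \<in> ?W \<and> Alb_proj G u' = Alb_proj G u) \<in> ?W \<and>
        Alb_proj G (SOME u'. u' \<in> ?W \<and> Alb_proj G u' = Alb_proj G u) = Alb_proj G u"
      by (rule someI[of "\<lambda>u'. u' \<in> ?W \<and> Alb_proj G u' = Alb_proj G u" u]) (simp add: u)
    then show ?thesis unfolding F_def using proj[OF _ u] by blast
  qed
  have bij: "bij_betw F (Alb_proj G ` ?W) (Alb_proj G' ` ?W')"
    unfolding bij_betw_def
  proof
    show "inj_on F (Alb_proj G ` ?W)" using proj F by (auto simp: inj_on_def)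
    have "Alb_proj G' v \<in> F ` Alb_proj G ` ?W" if "v \<in> ?W'" for v
      using F[of "B v"] B[OF that] by (metis imageI)
    then show "F ` Alb_proj G ` ?W = Alb_proj G' ` ?W'" using F A by auto
  qed
  have invF: "inv_into (Alb_proj G ` ?W) F (Alb_proj G' v) = Alb_proj G (B v)" if v: "v \<in> ?W'" for v
  proof -
    have "F (Alb_proj G (B v)) = Alb_proj G' v" using F[of "B v"] B[OF v] by simp
    then show ?thesis using inv_into_f_eq[OF bij_betw_imp_inj_on[OF bij]] B[OF v] by blast
  qed
  have liftA: "local_lift ?W (Alb_proj G) ?W' (Alb_proj G') F ?W A"
    unfolding local_lift_def using smooth_on_subspace_linear[OF lin(1) W] A F by blast
  have liftB: "local_lift ?W' (Alb_proj G') ?W (Alb_proj G) (inv_into (Alb_proj G ` ?W) F) ?W' B"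
    unfolding local_lift_def using smooth_on_subspace_linear[OF lin(2) W'] B invF by blast
  have deriv: "vector_derivative (\<lambda>t. A (u + t *\<^sub>R v)) (at 0) = A v" for u v
  proof (rule vector_derivative_at)
    have "((\<lambda>t. A u + t *\<^sub>R A v) has_vector_derivative A v) (at 0)"
      by (auto intro!: derivative_eq_intros simp: has_vector_derivative_def)
    then show "((\<lambda>t. A (u + t *\<^sub>R v)) has_vector_derivative A v) (at 0)"
      by (simp add: linear_add[OF lin(1)] linear_cmul[OF lin(1)])
  qed
  have "dual_inner G' (A v) (A w) = dual_inner G v w" if "v \<in> ?W" "w \<in> ?W" for v w
    using that A by (simp add: dual_inner_eq[OF G] dual_inner_eq[OF G'] isom)
  then have "Alb_isometry G G' F"
    unfolding Alb_isometry_def riemannian_isometry_def smooth_torus_map_def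
    using bij liftA liftB by (intro conjI ballI exI[of _ ?W] exI[of _ A] exI[of _ ?W'] exI[of _ B]) (auto simp: deriv)
  then show ?thesis by blast
qed

end
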